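(* Let $n\ge 1$, let $p\in\mathbb{C}[z_1,\dots,z_n]$ be an analytic polynomial, and let $\mathcal{M}=[p]$ be the cyclic submodule of the Bergman space $L_a^2(\mathbb{B}_n)$ generated by $p$. Then $\mathcal{M}$ is $q$-essentially normal for every real $q>n$; that is, with $S_{z_i}=M_{z_i}|_{\mathcal{M}}$, for all $1\le i,j\le n$ the commutator $[S_{z_i},S_{z_j}^*]=S_{z_i}S_{z_j}^*-S_{z_j}^*S_{z_i}$ belongs to the Schatten class $\mathcal{L}^q$ of $\mathcal{M}$ for every $q>n$.
   Context: $\mathbb{B}_n=\{z\in\mathbb{C}^n:|z|<1\}$. $L_a^2(\mathbb{B}_n)$ is the Hilbert space of analytic functions on $\mathbb{B}_n$ that are square integrable with respect to normalized Lebesgue measure on $\mathbb{B}_n$. $M_{z_i}$ is the operator of multiplication by the coordinate function $z_i$ on $L_a^2(\mathbb{B}_n)$. $[p]$ is the closure in $L_a^2(\mathbb{B}_n)$ of the ideal $p\,\mathbb{C}[z_1,\dots,z_n]$; it is invariant under each $M_{z_i}$. $S_{z_i}$ is the restriction of $M_{z_i}$ to $\mathcal{M}$, regarded as an operator on the Hilbert space $\mathcal{M}$. (The Schatten exponent is called $q$ here to avoid a clash with the polynomial $p$.) *)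

theory Defs
  imports "HOL-Analysis.Analysis" "HOL-Library.Poly_Mapping"
begin

section \<open>Analytic functions of several complex variables\<close>

text \<open>Analyticity is complex differentiability: the real derivative exists and is complex linear.\<close>

definition analytic_sev :: "(complex^'n \<Rightarrow> complex) \<Rightarrow> (complex^'n) set \<Rightarrow> bool" where
  "analytic_sev f U \<longleftrightarrow>
     (\<forall>z\<in>U. \<exists>D. (f has_derivative D) (at z) \<and> (\<forall>c v. D (c *s v) = c * D v))"

lemma analytic_sev_const: "analytic_sev (\<lambda>_. c) U"
  unfolding analytic_sev_def by (intro ballI exI[of _ "\<lambda>_. 0"]) auto

lemma analytic_sev_nth: "analytic_sev (\<lambda>z. z $ i) U"
  unfolding analytic_sev_def
  by (intro ballI exI[of _ "\<lambda>z. z $ i"])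
     (auto intro!: bounded_linear.has_derivative[OF bounded_linear_vec_nth] derivative_eq_intros)

lemma analytic_sev_add:
  assumes "analytic_sev f U" "analytic_sev g U"
  shows "analytic_sev (\<lambda>z. f z + g z) U"
  unfolding analytic_sev_def
proof
  fix z assume "z \<in> U"
  with assms obtain D E where "(f has_derivative D) (at z)" "\<forall>c v. D (c *s v) = c * D v"
    "(g has_derivative E) (at z)" "\<forall>c v. E (c *s v) = c * E v"
    unfolding analytic_sev_def by blast
  thus "\<exists>D. ((\<lambda>z. f z + g z) has_derivative D) (at z) \<and> (\<forall>c v. D (c *s v) = c * D v)"
    by (intro exI[of _ "\<lambda>v. D v + E v"]) (auto intro: has_derivative_add simp: algebra_simps)
qed

lemma analytic_sev_mult:
  assumes "analytic_sev f U" "analytic_sev g U"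
  shows "analytic_sev (\<lambda>z. f z * g z) U"
  unfolding analytic_sev_def
proof
  fix z assume "z \<in> U"
  with assms obtain D E where "(f has_derivative D) (at z)" "\<forall>c v. D (c *s v) = c * D v"
    "(g has_derivative E) (at z)" "\<forall>c v. E (c *s v) = c * E v"
    unfolding analytic_sev_def by blast
  thus "\<exists>D. ((\<lambda>z. f z * g z) has_derivative D) (at z) \<and> (\<forall>c v. D (c *s v) = c * D v)"
    by (intro exI[of _ "\<lambda>v. f z * E v + D v * g z"] conjI has_derivative_mult)
       (simp_all add: algebra_simps)
qed

lemma analytic_sev_sum:
  "(\<And>i. i \<in> I \<Longrightarrow> analytic_sev (f i) U) \<Longrightarrow> analytic_sev (\<lambda>z. \<Sum>i\<in>I. f i z) U"
  by (induction I rule: infinite_finite_induct) (auto intro: analytic_sev_const analytic_sev_add)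

lemma analytic_sev_prod:
  "(\<And>i. i \<in> I \<Longrightarrow> analytic_sev (f i) U) \<Longrightarrow> analytic_sev (\<lambda>z. \<Prod>i\<in>I. f i z) U"
  by (induction I rule: infinite_finite_induct) (auto intro: analytic_sev_const analytic_sev_mult)

lemma analytic_sev_power: "analytic_sev f U \<Longrightarrow> analytic_sev (\<lambda>z. f z ^ k) U"
  by (induction k) (auto intro: analytic_sev_const analytic_sev_mult)

lemma analytic_sev_cong:
  assumes "open U" "\<And>z. z \<in> U \<Longrightarrow> f z = g z"
  shows "analytic_sev f U \<longleftrightarrow> analytic_sev g U"
proof -
  have "(f has_derivative D) (at z) \<longleftrightarrow> (g has_derivative D) (at z)" if "z \<in> U" for z D
    using assms that by (metis has_derivative_transform_within_open)
  thus ?thesis unfolding analytic_sev_def by blast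
qed

lemma analytic_sev_continuous_on: "analytic_sev f U \<Longrightarrow> continuous_on U f"
  unfolding analytic_sev_def
  by (meson continuous_at_imp_continuous_on has_derivative_continuous)


section \<open>The Bergman space of the unit ball\<close>

text \<open>
  Only functions continuous on the ball and zero elsewhere are integrated; these are Borel
  measurable, so the completion of \<open>lborel\<close> is not needed.
\<close>

definition ball_measure :: "(complex^'n) measure" where
  "ball_measure = uniform_measure lborel (ball 0 1)"

lemma space_ball_measure [simp]: "space ball_measure = UNIV"
  and sets_ball_measure [simp, measurable_cong]: "sets ball_measure = sets borel"
  by (simp_all add: ball_measure_def)

lemma emeasure_ball: "emeasure lborel (ball (0::complex^'n) 1) \<noteq> 0"
    "emeasure lborel (ball (0::complex^'n) 1) \<noteq> \<infinity>"
  using emeasure_lborel_ball_finite[of "0::complex^'n" 1]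
        open_not_negligible[of "ball (0::complex^'n) 1"]
  by (auto simp: negligible_iff_emeasure0 less_top)

lemma prob_space_ball_measure: "emeasure ball_measure (UNIV :: (complex^'n) set) = 1"
proof -
  have "emeasure ball_measure (UNIV :: (complex^'n) set) =
      emeasure lborel (ball (0::complex^'n) 1) / emeasure lborel (ball (0::complex^'n) 1)"
    unfolding ball_measure_def by (subst emeasure_uniform_measure) simp_all
  also have "\<dots> = 1"
    using emeasure_ball[where 'n='n] by (intro ennreal_divide_self) (auto simp: less_top)
  finally show ?thesis .
qed

lemma finite_measure_ball_measure: "finite_measure (ball_measure :: (complex^'n) measure)"
  by (intro finite_measureI) (simp add: prob_space_ball_measure)

lemma AE_ball_measure:
  "(AE z in ball_measure. P z) \<longleftrightarrow> (AE z in lborel. z \<in> ball (0::complex^'n) 1 \<longrightarrow> P z)"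
  unfolding ball_measure_def using emeasure_ball[where 'n='n]
  by (subst AE_uniform_measure) (auto simp: less_top)

text \<open>
  Elements of the Bergman space are functions on the ball. They are represented by total functions
  vanishing outside the ball, so that equality of functions on the ball is equality in the type.
\<close>

definition bergman_functions :: "(complex^'n \<Rightarrow> complex) set" where
  "bergman_functions =
     {f. analytic_sev f (ball 0 1) \<and> (\<forall>z. z \<notin> ball 0 1 \<longrightarrow> f z = 0) \<and>
         integrable ball_measure (\<lambda>z. (norm (f z))\<^sup>2)}"

lemma bergman_functions_measurable:
  assumes "f \<in> bergman_functions"
  shows "f \<in> borel_measurable borel"
proof -
  have c: "continuous_on (ball 0 1) f"
    using assms by (auto simp: bergman_functions_def intro: analytic_sev_continuous_on)
  have "(\<lambda>z. if z \<in> ball 0 1 then f z else 0) \<in> borel_measurable borel"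
    by (intro borel_measurable_continuous_on_if c) auto
  also have "(\<lambda>z. if z \<in> ball 0 1 then f z else 0) = f"
    using assms by (fastforce simp: bergman_functions_def)
  finally show ?thesis .
qed

lemma bergman_functions_bounded:
  assumes "analytic_sev f (ball 0 1)" "\<And>z. z \<in> ball 0 1 \<Longrightarrow> norm (f z) \<le> B"
  shows "(\<lambda>z. if z \<in> ball 0 1 then f z else 0) \<in> bergman_functions"
proof -
  interpret finite_measure "ball_measure :: (complex^'a) measure"
    by (rule finite_measure_ball_measure)
  let ?g = "\<lambda>z. if z \<in> ball 0 1 then f z else 0"
  have m: "?g \<in> borel_measurable borel"
    by (intro borel_measurable_continuous_on_if analytic_sev_continuous_on[OF assms(1)]) auto
  have "integrable ball_measure (\<lambda>z. (norm (?g z))\<^sup>2)"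
  proof (rule integrable_const_bound[where B = "B\<^sup>2"])
    show "AE z in ball_measure. norm ((norm (?g z))\<^sup>2) \<le> B\<^sup>2"
      using assms(2) by (intro AE_I2) (auto intro!: power_mono simp: norm_power)
    show "(\<lambda>z. (norm (?g z))\<^sup>2) \<in> borel_measurable ball_measure"
      using m by measurable
  qed
  moreover have "analytic_sev ?g (ball 0 1)"
    using assms(1) by (rule iffD2[OF analytic_sev_cong, rotated 2]) auto
  ultimately show ?thesis unfolding bergman_functions_def by auto
qed

lemma bergman_functions_integrable_mult:
  assumes "f \<in> bergman_functions" "g \<in> bergman_functions"
  shows "integrable ball_measure (\<lambda>z. f z * cnj (g z))"
proof (rule Bochner_Integration.integrable_bound)
  show "integrable ball_measure (\<lambda>z. (norm (f z))\<^sup>2 + (norm (g z))\<^sup>2)"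
    using assms by (auto simp: bergman_functions_def)
  show "(\<lambda>z. f z * cnj (g z)) \<in> borel_measurable ball_measure"
    using assms[THEN bergman_functions_measurable]
    by (simp cong: measurable_cong_sets)
       (intro borel_measurable_times borel_measurable_continuous_on[of cnj] continuous_intros; simp)
  have "norm (f z * cnj (g z)) \<le> norm ((norm (f z))\<^sup>2 + (norm (g z))\<^sup>2)" for z
  proof -
    have "2 * (norm (f z) * norm (g z)) \<le> (norm (f z))\<^sup>2 + (norm (g z))\<^sup>2"
      using sum_squares_bound[of "norm (f z)" "norm (g z)"] by (simp add: mult.assoc)
    moreover have "0 \<le> norm (f z) * norm (g z)" by simp
    ultimately show ?thesis unfolding norm_mult complex_mod_cnj real_norm_def by linarith
  qed
  thus "AE z in ball_measure. norm (f z * cnj (g z)) \<le> norm ((norm (f z))\<^sup>2 + (norm (g z))\<^sup>2)"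
    by simp
qed

lemma bergman_functions_zero: "(\<lambda>_. 0) \<in> bergman_functions"
  by (auto simp: bergman_functions_def intro: analytic_sev_const)

lemma bergman_functions_add:
  assumes "f \<in> bergman_functions" "g \<in> bergman_functions"
  shows "(\<lambda>z. f z + g z) \<in> bergman_functions"
proof -
  have eq: "complex_of_real ((norm (f z + g z))\<^sup>2)
      = f z * cnj (f z) + f z * cnj (g z) + g z * cnj (f z) + g z * cnj (g z)" for z
    unfolding complex_norm_square by (simp add: algebra_simps)
  have "integrable ball_measure (\<lambda>z. complex_of_real ((norm (f z + g z))\<^sup>2))"
    unfolding eq using assms
    by (intro Bochner_Integration.integrable_add bergman_functions_integrable_mult) auto
  hence "integrable ball_measure (\<lambda>z. (norm (f z + g z))\<^sup>2)"
    by (simp only: complex_of_real_integrable_eq)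
  thus ?thesis using assms by (auto simp: bergman_functions_def intro: analytic_sev_add)
qed

lemma bergman_functions_scale:
  assumes "f \<in> bergman_functions"
  shows "(\<lambda>z. c * f z) \<in> bergman_functions"
  using assms
  by (auto simp: bergman_functions_def norm_mult power_mult_distrib
           intro: analytic_sev_mult analytic_sev_const)

typedef (overloaded) ('n::finite) bergman = "bergman_functions :: (complex^'n \<Rightarrow> complex) set"
  using bergman_functions_zero by blast

setup_lifting type_definition_bergman

text \<open>The complex inner product is linear in the first argument.\<close>

lift_definition cinner :: "'n::finite bergman \<Rightarrow> 'n bergman \<Rightarrow> complex" is
  "\<lambda>f g. LINT z|ball_measure. f z * cnj (g z)" .

lift_definition scaleC :: "complex \<Rightarrow> 'n::finite bergman \<Rightarrow> 'n bergman" is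
  "\<lambda>c f z. c * f z" by (rule bergman_functions_scale)

text \<open>
  Norm, metric and topology of the Bergman space come from the class of real inner product
  spaces, whose inner product is the real part of the complex one; both induce the same norm.
\<close>

instantiation bergman :: (finite) real_vector
begin

lift_definition zero_bergman :: "'a bergman" is "\<lambda>_. 0" by (rule bergman_functions_zero)

lift_definition plus_bergman :: "'a bergman \<Rightarrow> 'a bergman \<Rightarrow> 'a bergman" is
  "\<lambda>f g z. f z + g z" by (rule bergman_functions_add)

lift_definition uminus_bergman :: "'a bergman \<Rightarrow> 'a bergman" is "\<lambda>f z. - f z"
  using bergman_functions_scale[of _ "-1"] by simp

lift_definition minus_bergman :: "'a bergman \<Rightarrow> 'a bergman \<Rightarrow> 'a bergman" is
  "\<lambda>f g z. f z - g z"
  using bergman_functions_add bergman_functions_scale[of _ "-1"] by fastforce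

definition scaleR_bergman :: "real \<Rightarrow> 'a bergman \<Rightarrow> 'a bergman" where
  "scaleR_bergman r f = scaleC (complex_of_real r) f"

instance
proof
  fix x y z :: "'a bergman" and r s :: real
  show "x + y + z = x + (y + z)" "x + y = y + x" "0 + x = x" "- x + x = 0" "x - y = x + - y"
    by (transfer; simp add: algebra_simps)+
  show "r *\<^sub>R (x + y) = r *\<^sub>R x + r *\<^sub>R y" "(r + s) *\<^sub>R x = r *\<^sub>R x + s *\<^sub>R x"
    "r *\<^sub>R s *\<^sub>R x = (r * s) *\<^sub>R x" "1 *\<^sub>R x = x"
    unfolding scaleR_bergman_def by (transfer; simp add: algebra_simps)+
qed

end

instantiation bergman :: (finite) real_inner
begin

definition inner_bergman :: "'a bergman \<Rightarrow> 'a bergman \<Rightarrow> real" where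
  "inner_bergman f g = Re (cinner f g)"

definition norm_bergman :: "'a bergman \<Rightarrow> real" where
  "norm_bergman f = sqrt (inner f f)"

definition sgn_bergman :: "'a bergman \<Rightarrow> 'a bergman" where
  "sgn_bergman f = f /\<^sub>R norm f"

definition dist_bergman :: "'a bergman \<Rightarrow> 'a bergman \<Rightarrow> real" where
  "dist_bergman f g = norm (f - g)"

definition uniformity_bergman :: "('a bergman \<times> 'a bergman) filter" where
  "uniformity_bergman = (INF e\<in>{0<..}. principal {(x, y). dist x y < e})"

definition open_bergman :: "'a bergman set \<Rightarrow> bool" where
  "open_bergman S \<longleftrightarrow> (\<forall>x\<in>S. \<forall>\<^sub>F (x', y) in uniformity. x' = x \<longrightarrow> y \<in> S)"

lemma cinner_self: "cinner f f = of_real (LINT z|ball_measure. (norm (Rep_bergman f z))\<^sup>2)"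
  unfolding cinner.rep_eq by (subst integral_complex_of_real[symmetric]) (simp only: complex_norm_square)

instance
proof
  fix x y z :: "'a bergman" and r s :: real
  show "dist x y = norm (x - y)" by (simp add: dist_bergman_def)
  show "sgn x = x /\<^sub>R norm x" by (simp add: sgn_bergman_def)
  show "uniformity = (INF e\<in>{0<..}. principal {(x, y :: 'a bergman). dist x y < e})"
    by (simp add: uniformity_bergman_def)
  show "open U \<longleftrightarrow> (\<forall>x\<in>U. \<forall>\<^sub>F (x', y) in uniformity. x' = x \<longrightarrow> y \<in> U)" for U :: "'a bergman set"
    by (simp add: open_bergman_def)
  show "norm x = sqrt (inner x x)" by (simp add: norm_bergman_def)
  have "cinner y x = cnj (cinner x y)"
    unfolding cinner.rep_eq by (simp add: mult.commute flip: Bochner_Integration.integral_cnj)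
  thus "inner x y = inner y x" by (simp add: inner_bergman_def)
  show "inner (x + y) z = inner x z + inner y z"
    unfolding inner_bergman_def
    by transfer (simp add: distrib_right bergman_functions_integrable_mult)
  show "inner (r *\<^sub>R x) y = r * inner x y"
    unfolding inner_bergman_def scaleR_bergman_def by transfer (simp add: mult.assoc)
  show "0 \<le> inner x x"
    unfolding inner_bergman_def cinner_self by simp
  show "inner x x = 0 \<longleftrightarrow> x = 0"
  proof
    assume "inner x x = 0"
    hence 0: "(LINT z|ball_measure. (norm (Rep_bergman x z))\<^sup>2) = 0"
      unfolding inner_bergman_def cinner_self by simp
    have R: "Rep_bergman x \<in> bergman_functions" by (rule Rep_bergman)
    hence "integrable ball_measure (\<lambda>z. (norm (Rep_bergman x z))\<^sup>2)"
      by (simp add: bergman_functions_def)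
    with 0 have "AE z in ball_measure. (norm (Rep_bergman x z))\<^sup>2 = 0"
      by (subst (asm) integral_nonneg_eq_0_iff_AE) auto
    hence AE: "AE z in lborel. z \<in> ball 0 1 \<longrightarrow> Rep_bergman x z = 0"
      by (simp add: AE_ball_measure)
    have c: "continuous_on (ball 0 1) (Rep_bergman x)"
      using R by (auto simp: bergman_functions_def intro: analytic_sev_continuous_on)
    define W where "W = {z \<in> ball 0 1. Rep_bergman x z \<noteq> 0}"
    have "open W"
    proof -
      have "W = ball 0 1 \<inter> Rep_bergman x -` (- {0})" by (auto simp: W_def)
      thus ?thesis using continuous_open_preimage[OF c] by (simp add: open_Compl)
    qed
    have "W = {}"
    proof (rule ccontr)
      assume "W \<noteq> {}"
      with \<open>open W\<close> have "emeasure lborel W \<noteq> 0"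
        using open_not_negligible[of W] by (simp add: negligible_iff_emeasure0)
      moreover from AE have "AE z in lborel. z \<notin> W" by (simp add: W_def)
      hence "emeasure lborel W = 0"
        using \<open>open W\<close> AE_iff_measurable[of W lborel "\<lambda>z. z \<notin> W"] by simp
      ultimately show False by simp
    qed
    hence "Rep_bergman x z = 0" for z
      using R by (cases "z \<in> ball 0 1") (auto simp: W_def bergman_functions_def)
    hence "Rep_bergman x = Rep_bergman 0" by (auto simp: zero_bergman.rep_eq)
    thus "x = 0" by (simp add: Rep_bergman_inject)
  qed (simp add: inner_bergman_def cinner_self zero_bergman.rep_eq)
qed

end

global_interpretation bergman: vector_space "scaleC :: complex \<Rightarrow> 'n::finite bergman \<Rightarrow> _"
  by unfold_locales (transfer; simp add: algebra_simps)+

section \<open>Polynomials and the submodules they generate\<close>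

text \<open>
  A polynomial in the variables \<open>z\<^sub>i\<close>, \<open>i :: 'n\<close>, maps finitely many exponent vectors
  to nonzero coefficients; the multiplication of \<open>\<Rightarrow>\<^sub>0\<close> is the convolution product.
\<close>

type_synonym 'n cpoly = "('n \<Rightarrow>\<^sub>0 nat) \<Rightarrow>\<^sub>0 complex"

definition eval_cpoly :: "'n::finite cpoly \<Rightarrow> complex^'n \<Rightarrow> complex" where
  "eval_cpoly p z =
     (\<Sum>m \<in> Poly_Mapping.keys p. Poly_Mapping.lookup p m * (\<Prod>i\<in>UNIV. z $ i ^ Poly_Mapping.lookup m i))"

lemma analytic_sev_eval_cpoly: "analytic_sev (eval_cpoly p) U"
  unfolding eval_cpoly_def
  by (intro analytic_sev_sum analytic_sev_mult analytic_sev_const analytic_sev_prod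
        analytic_sev_power analytic_sev_nth)

lift_definition bergman_of_cpoly :: "'n::finite cpoly \<Rightarrow> 'n bergman" is
  "\<lambda>p z. if z \<in> ball 0 1 then eval_cpoly p z else 0"
proof -
  fix p :: "'n cpoly"
  have "compact (eval_cpoly p ` cball 0 1)"
    by (intro compact_continuous_image analytic_sev_continuous_on analytic_sev_eval_cpoly) simp
  then obtain B where "\<forall>z\<in>cball 0 1. norm (eval_cpoly p z) \<le> B"
    by (meson bounded_iff compact_imp_bounded imageI)
  thus "(\<lambda>z. if z \<in> ball 0 1 then eval_cpoly p z else 0) \<in> bergman_functions"
    by (intro bergman_functions_bounded[where B = B] analytic_sev_eval_cpoly) auto
qed

definition principal_submodule :: "'n::finite cpoly \<Rightarrow> 'n bergman set" where
  "principal_submodule p = closure (range (\<lambda>r. bergman_of_cpoly (p * r)))"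

lift_definition coord_mult :: "'n::finite \<Rightarrow> 'n bergman \<Rightarrow> 'n bergman" is
  "\<lambda>i f z. z $ i * f z"
proof -
  fix i :: 'n and f :: "complex^'n \<Rightarrow> complex" assume f: "f \<in> bergman_functions"
  have "integrable ball_measure (\<lambda>z. (norm (z $ i * f z))\<^sup>2)"
  proof (rule Bochner_Integration.integrable_bound)
    show "integrable ball_measure (\<lambda>z. (norm (f z))\<^sup>2)"
      using f by (simp add: bergman_functions_def)
    have "(\<lambda>z::complex^'n. z $ i) \<in> borel_measurable borel"
      by (intro borel_measurable_continuous_onI continuous_intros)
    thus "(\<lambda>z. (norm (z $ i * f z))\<^sup>2) \<in> borel_measurable ball_measure"
      using bergman_functions_measurable[OF f] by measurable
    have "norm ((norm (z $ i * f z))\<^sup>2) \<le> norm ((norm (f z))\<^sup>2)" for z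
    proof (cases "z \<in> ball 0 1")
      case True
      hence "norm (z $ i) \<le> 1" using Finite_Cartesian_Product.norm_nth_le[of z i] by simp
      hence "norm (z $ i * f z) \<le> norm (f z)"
        unfolding norm_mult by (simp add: mult_left_le_one_le)
      thus ?thesis by (simp add: power_mono)
    qed (use f in \<open>simp add: bergman_functions_def\<close>)
    thus "AE z in ball_measure. norm ((norm (z $ i * f z))\<^sup>2) \<le> norm ((norm (f z))\<^sup>2)" by simp
  qed
  thus "(\<lambda>z. z $ i * f z) \<in> bergman_functions"
    using f by (auto simp: bergman_functions_def intro: analytic_sev_mult analytic_sev_nth)
qed


section \<open>Operators on closed subspaces, Schatten classes, essential normality\<close>

text \<open>
  An operator on a closed subspace \<open>M\<close> is a function of which only the values on \<open>M\<close> matter.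
\<close>

definition bounded_operator_on :: "'n::finite bergman set \<Rightarrow> ('n bergman \<Rightarrow> 'n bergman) \<Rightarrow> bool" where
  "bounded_operator_on M T \<longleftrightarrow>
     (\<forall>f\<in>M. T f \<in> M) \<and>
     (\<forall>f\<in>M. \<forall>g\<in>M. T (f + g) = T f + T g) \<and>
     (\<forall>c. \<forall>f\<in>M. T (scaleC c f) = scaleC c (T f)) \<and>
     (\<exists>B. \<forall>f\<in>M. norm (T f) \<le> B * norm f)"

definition compact_operator_on :: "'n::finite bergman set \<Rightarrow> ('n bergman \<Rightarrow> 'n bergman) \<Rightarrow> bool" where
  "compact_operator_on M T \<longleftrightarrow>
     bounded_operator_on M T \<and> compact (closure (T ` (M \<inter> cball 0 1)))"

text \<open>The adjoint in \<open>M\<close>; for a bounded operator on a closed subspace it exists by Riesz.\<close>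

definition adjoint_on ::
  "'n::finite bergman set \<Rightarrow> ('n bergman \<Rightarrow> 'n bergman) \<Rightarrow> 'n bergman \<Rightarrow> 'n bergman" where
  "adjoint_on M T g = (THE h. h \<in> M \<and> (\<forall>f\<in>M. cinner (T f) g = cinner f h))"

text \<open>
  The singular values of \<open>T\<close> are the eigenvalues \<open>s\<close> of \<open>|T| = (T\<^sup>* T)\<^bsup>1/2\<^esup>\<close>,
  and \<open>|T| f = s f\<close> iff \<open>T\<^sup>* T f = s\<^sup>2 f\<close> for \<open>s \<ge> 0\<close>. The multiplicity, a complex dimension,
  is \<open>0\<close> when \<open>s\<close> is not a singular value. The library dimension of an infinite-dimensional space is
  also \<open>0\<close>, but for compact \<open>T\<close> and \<open>s > 0\<close> this case does not occur.
\<close>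

definition singular_value_mult ::
  "'n::finite bergman set \<Rightarrow> ('n bergman \<Rightarrow> 'n bergman) \<Rightarrow> real \<Rightarrow> nat" where
  "singular_value_mult M T s =
     bergman.dim {f \<in> M. adjoint_on M T (T f) = scaleC (of_real (s\<^sup>2)) f}"

definition schatten_class ::
  "'n::finite bergman set \<Rightarrow> real \<Rightarrow> ('n bergman \<Rightarrow> 'n bergman) set" where
  "schatten_class M q =
     {T. compact_operator_on M T \<and>
         (\<lambda>s. real (singular_value_mult M T s) * s powr q) summable_on {0<..}}"

definition adj_commutator ::
  "'n::finite bergman set \<Rightarrow> ('n bergman \<Rightarrow> 'n bergman) \<Rightarrow> ('n bergman \<Rightarrow> 'n bergman)
     \<Rightarrow> 'n bergman \<Rightarrow> 'n bergman" where
  "adj_commutator M A B = (\<lambda>f. A (adjoint_on M B f) - adjoint_on M B (A f))"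

text \<open>
  As \<open>M\<close> is invariant under the coordinate multiplications, their restrictions to \<open>M\<close> agree with
  them on \<open>M\<close>, and the adjoint below, taken in \<open>M\<close>, is that of the restriction.
\<close>

definition essentially_normal :: "real \<Rightarrow> 'n::finite bergman set \<Rightarrow> bool" where
  "essentially_normal q M \<longleftrightarrow>
     (\<forall>i j. adj_commutator M (coord_mult i) (coord_mult j) \<in> schatten_class M q)"

end

theory Submission
  imports Defs
begin

text \<open>Everything is reduced to integration by parts for polynomials in \<open>z\<close> and its conjugate. Write \<open>w = 1 - |z|\<^sup>2\<close>,
  \<open>\<parallel>u\<parallel>\<^sub>b\<close> for the \<open>L\<^sup>2\<close> norm with weight \<open>w\<^sup>b\<close>, and \<open>R\<close> for the Euler field. A derivative of \<open>u\<close> is bounded by \<open>u\<close> at the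
  cost of two powers of \<open>w\<close> (one power for derivatives tangential to the spheres), with a constant that depends only on
  the degree of \<open>u\<close> in the conjugate variables; hence it is uniform over all multiples \<open>p f\<close> of \<open>p\<close>. Combined with a
  Hardy inequality for \<open>R + c\<close>, this shows that for \<open>f = (R + c) \<phi>\<close> the element \<open>p \<partial>\<^sub>j \<phi>\<close> of the submodule approximates the
  adjoint of \<open>M\<^sub>j\<close> at \<open>p f\<close> with an error at most \<open>C \<parallel>p f\<parallel>\<^sub>1\<close>. Therefore the commutator \<open>T\<close> satisfies
  \<open>|\<langle>T F, G\<rangle>| \<le> C \<parallel>F\<parallel>\<^sub>1 \<parallel>G\<parallel>\<^sub>1\<close>.

  On functions orthogonal to the at most \<open>d\<^sup>n\<close> monomials of degree below \<open>d\<close>, the squared norm \<open>\<parallel>F\<parallel>\<^sub>1\<^sup>2\<close> is at most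
  \<open>\<parallel>F\<parallel>\<^sup>2 / (d + 1)\<close>. So \<open>T\<close> is compact, at most \<open>2 d\<^sup>n\<close> singular values exceed \<open>C / (d + 1)\<close>, and summing over dyadic
  layers gives the Schatten classes for \<open>q > n\<close>.\<close>

section \<open>Wirtinger derivatives\<close>

text \<open>The obstacle is the zero set of \<open>p\<close>: division by \<open>p\<close> is
  impossible, yet no constant may depend on the cofactor \<open>f\<close>. The remedy is to study
  \<open>cnj p * f\<close>, which has the modulus of \<open>p * f\<close> and, whatever
  \<open>f\<close> is, the conjugate degree of \<open>cnj p\<close>. Its \<open>dz\<close>
  differentiates only \<open>f\<close> and its \<open>dzb\<close> only \<open>p\<close>, so both
  kinds of derivatives are controlled by \<open>p * f\<close>.

  A derivative loses two powers of the weight. The Hardy inequality regains two, provided that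
  \<open>f\<close> is written as \<open>(R + c) \<phi>\<close>; this is why \<open>\<phi>\<close>
  enters the approximation of the adjoint. Only one antisymmetric term then remains one power short,
  and there tangential derivatives suffice.

  The adjoint in the submodule is the projection of the adjoint in the Bergman space. The commutator
  thus splits into that of the Bergman space and the inner product of two projection errors, each of
  which contributes one factor of weight 1. It is the product of two such factors that puts the
  threshold at \<open>n\<close>; a gain in one factor alone would only give
  \<open>2 n\<close>.\<close>

definition dz :: "'n::finite \<Rightarrow> (complex^'n \<Rightarrow> complex) \<Rightarrow> complex^'n \<Rightarrow> complex" where
  "dz j u z = (frechet_derivative u (at z) (axis j 1) - \<i> * frechet_derivative u (at z) (axis j \<i>)) / 2"

definition dzb :: "'n::finite \<Rightarrow> (complex^'n \<Rightarrow> complex) \<Rightarrow> complex^'n \<Rightarrow> complex" where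
  "dzb j u z = (frechet_derivative u (at z) (axis j 1) + \<i> * frechet_derivative u (at z) (axis j \<i>)) / 2"

lemma has_derivative_dz:
  assumes "(u has_derivative D) (at z)"
  shows "dz j u z = (D (axis j 1) - \<i> * D (axis j \<i>)) / 2"
    "dzb j u z = (D (axis j 1) + \<i> * D (axis j \<i>)) / 2"
  using frechet_derivative_at[OF assms] by (simp_all add: dz_def dzb_def)

lemma dz_const [simp]: "dz j (\<lambda>_. c) = (\<lambda>_. 0)" "dzb j (\<lambda>_. c) = (\<lambda>_. 0)"
  by (auto simp: fun_eq_iff dz_def dzb_def frechet_derivative_const)

lemma dz_coord: "dz j (\<lambda>z. z $ k) z = (if j = k then 1 else 0)" "dzb j (\<lambda>z. z $ k) z = 0"
proof -
  have D: "((\<lambda>z. z $ k) has_derivative (\<lambda>v. v $ k)) (at z)"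
    by (intro bounded_linear_imp_has_derivative bounded_linear_vec_nth)
  show "dz j (\<lambda>z. z $ k) z = (if j = k then 1 else 0)" "dzb j (\<lambda>z. z $ k) z = 0"
    unfolding has_derivative_dz[OF D] by (auto simp: axis_def)
qed

lemma dz_cnj:
  assumes "u differentiable (at z)"
  shows "dz j (\<lambda>z. cnj (u z)) z = cnj (dzb j u z)" "dzb j (\<lambda>z. cnj (u z)) z = cnj (dz j u z)"
proof -
  have "((\<lambda>z. cnj (u z)) has_derivative (\<lambda>v. cnj (frechet_derivative u (at z) v))) (at z)"
    using assms by (intro bounded_linear.has_derivative[OF bounded_linear_cnj])
      (simp add: frechet_derivative_works)
  from has_derivative_dz[OF this] show "dz j (\<lambda>z. cnj (u z)) z = cnj (dzb j u z)"
    "dzb j (\<lambda>z. cnj (u z)) z = cnj (dz j u z)" by (simp_all add: dz_def dzb_def)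
qed

lemma dz_add:
  assumes "u differentiable (at z)" "v differentiable (at z)"
  shows "dz j (\<lambda>z. u z + v z) z = dz j u z + dz j v z"
    "dzb j (\<lambda>z. u z + v z) z = dzb j u z + dzb j v z"
proof -
  have D: "((\<lambda>z. u z + v z) has_derivative
      (\<lambda>x. frechet_derivative u (at z) x + frechet_derivative v (at z) x)) (at z)"
    using assms by (intro has_derivative_add) (simp_all add: frechet_derivative_works)
  show "dz j (\<lambda>z. u z + v z) z = dz j u z + dz j v z"
    "dzb j (\<lambda>z. u z + v z) z = dzb j u z + dzb j v z"
    unfolding has_derivative_dz[OF D] by (simp_all add: dz_def dzb_def field_simps)
qed

lemma dz_mult:
  assumes "u differentiable (at z)" "v differentiable (at z)"
  shows "dz j (\<lambda>z. u z * v z) z = dz j u z * v z + u z * dz j v z"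
    "dzb j (\<lambda>z. u z * v z) z = dzb j u z * v z + u z * dzb j v z"
proof -
  have D: "((\<lambda>z. u z * v z) has_derivative
      (\<lambda>x. u z * frechet_derivative v (at z) x + frechet_derivative u (at z) x * v z)) (at z)"
    using assms by (intro has_derivative_mult) (simp_all add: frechet_derivative_works)
  show "dz j (\<lambda>z. u z * v z) z = dz j u z * v z + u z * dz j v z"
    "dzb j (\<lambda>z. u z * v z) z = dzb j u z * v z + u z * dzb j v z"
    unfolding has_derivative_dz[OF D] by (simp_all add: dz_def dzb_def field_simps)
qed

text \<open>Polynomials in \<open>z\<close> and its conjugate, of degree at most \<open>m\<close> in the conjugate variables. In particular
  \<open>bip 0\<close> characterises the analytic polynomials.\<close>

inductive bip :: "nat \<Rightarrow> (complex^'n::finite \<Rightarrow> complex) \<Rightarrow> bool" where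
  bip_const [intro, simp]: "bip m (\<lambda>_. c)"
| bip_coord_mult: "bip m u \<Longrightarrow> bip m (\<lambda>z. z $ k * u z)"
| bip_cnj_coord_mult: "bip m u \<Longrightarrow> bip (Suc m) (\<lambda>z. cnj (z $ k) * u z)"
| bip_add [intro]: "bip m u \<Longrightarrow> bip m v \<Longrightarrow> bip m (\<lambda>z. u z + v z)"

lemma bip_mono: "bip m u \<Longrightarrow> m \<le> m' \<Longrightarrow> bip m' u"
proof (induction arbitrary: m' rule: bip.induct)
  case (bip_cnj_coord_mult m u k)
  then obtain k' where "m' = Suc k'" "m \<le> k'" by (cases m') auto
  then show ?case using bip_cnj_coord_mult by (auto intro: bip.intros)
qed (auto intro: bip.intros)

lemma bip_scale: "bip m u \<Longrightarrow> bip m (\<lambda>z. c * u z)"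
proof (induction rule: bip.induct)
  case (bip_coord_mult m u k)
  show ?case using bip.bip_coord_mult[OF bip_coord_mult.IH, of k] by (simp add: mult.left_commute)
next
  case (bip_cnj_coord_mult m u k)
  show ?case using bip.bip_cnj_coord_mult[OF bip_cnj_coord_mult.IH, of k] by (simp add: mult.left_commute)
qed (auto simp: distrib_left)

lemma bip_mult: "bip m u \<Longrightarrow> bip k v \<Longrightarrow> bip (m + k) (\<lambda>z. u z * v z)"
proof (induction rule: bip.induct)
  case (bip_const m c)
  show ?case by (rule bip_mono[OF bip_scale[OF bip_const]]) simp
next
  case (bip_coord_mult m u j)
  show ?case using bip.bip_coord_mult[OF bip_coord_mult.IH[OF bip_coord_mult.prems], of j]
    by (simp add: mult.assoc)
next
  case (bip_cnj_coord_mult m u j)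
  show ?case using bip.bip_cnj_coord_mult[OF bip_cnj_coord_mult.IH[OF bip_cnj_coord_mult.prems], of j]
    by (simp add: mult.assoc)
next
  case (bip_add m u w)
  show ?case using bip.bip_add[OF bip_add.IH(1)[OF bip_add.prems] bip_add.IH(2)[OF bip_add.prems]]
    by (simp add: distrib_right)
qed

lemma bip_mult0: "bip 0 u \<Longrightarrow> bip k v \<Longrightarrow> bip k (\<lambda>z. u z * v z)"
  using bip_mult[of 0 u k v] by simp

lemma bip_coord [simp]: "bip m (\<lambda>z. z $ k)"
  using bip_coord_mult[OF bip_const[of m 1]] by simp

lemma bip_cnj_coord: "bip (Suc m) (\<lambda>z. cnj (z $ k))"
  using bip_cnj_coord_mult[OF bip_const[of m 1]] by simp

lemma bip_uminus: "bip m u \<Longrightarrow> bip m (\<lambda>z. - u z)"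
  using bip_scale[of m u "-1"] by simp

lemma bip_diff: "bip m u \<Longrightarrow> bip m v \<Longrightarrow> bip m (\<lambda>z. u z - v z)"
  using bip_add[OF _ bip_uminus, of m u v] by simp

lemma bip_sum: "(\<And>i. i \<in> I \<Longrightarrow> bip m (u i)) \<Longrightarrow> bip m (\<lambda>z. \<Sum>i\<in>I. u i z)"
  by (induction I rule: infinite_finite_induct) auto

lemma bip_power0: "bip 0 u \<Longrightarrow> bip 0 (\<lambda>z. u z ^ k)"
  by (induction k) (auto intro: bip_mult0)

lemma bip_prod0: "(\<And>i. i \<in> I \<Longrightarrow> bip 0 (u i)) \<Longrightarrow> bip 0 (\<lambda>z. \<Prod>i\<in>I. u i z)"
  by (induction I rule: infinite_finite_induct) (auto intro: bip_mult0)

lemma bip_power: "bip m u \<Longrightarrow> bip (k * m) (\<lambda>z. u z ^ k)"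
  by (induction k) (auto intro: bip_mult)

lemma bip_cnj: "bip m u \<Longrightarrow> \<exists>m'. bip m' (\<lambda>z. cnj (u z))"
proof (induction rule: bip.induct)
  case (bip_coord_mult m u k)
  then show ?case by (auto intro: bip.bip_cnj_coord_mult)
next
  case (bip_cnj_coord_mult m u k)
  then show ?case by (auto intro: bip.bip_coord_mult)
next
  case (bip_add m u v)
  then obtain a b where "bip a (\<lambda>z. cnj (u z))" "bip b (\<lambda>z. cnj (v z))" by auto
  then have "bip (max a b) (\<lambda>z. cnj (u z))" "bip (max a b) (\<lambda>z. cnj (v z))"
    by (auto intro: bip_mono)
  then show ?case by (auto intro!: exI bip.bip_add)
qed auto

lemma bip_differentiable: "bip m u \<Longrightarrow> u differentiable (at z)"
proof (induction rule: bip.induct)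
  case (bip_coord_mult m u k)
  have "(\<lambda>z::complex^'a. z $ k) differentiable (at z)"
    by (simp add: bounded_linear_imp_differentiable bounded_linear_vec_nth)
  then show ?case using bip_coord_mult by (intro differentiable_mult)
next
  case (bip_cnj_coord_mult m u k)
  have "(\<lambda>z::complex^'a. cnj (z $ k)) differentiable (at z)"
    by (intro bounded_linear_imp_differentiable bounded_linear_compose[OF bounded_linear_cnj]
        bounded_linear_vec_nth)
  then show ?case using bip_cnj_coord_mult by (intro differentiable_mult)
qed (auto intro: differentiable_add)

lemma bip_continuous_on: "bip m u \<Longrightarrow> continuous_on S u"
  by (intro continuous_at_imp_continuous_on ballI differentiable_imp_continuous_within bip_differentiable)

lemma dz_coord_mult:
  assumes "bip m u"
  shows "dz j (\<lambda>z. z $ k * u z) = (\<lambda>z. (if j = k then u z else 0) + z $ k * dz j u z)"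
    "dzb j (\<lambda>z. z $ k * u z) = (\<lambda>z. z $ k * dzb j u z)"
  using bip_differentiable[OF assms] bip_differentiable[OF bip_coord[of 0 k]]
  by (auto simp: dz_mult dz_coord fun_eq_iff)

lemma dz_cnj_coord_mult:
  assumes "bip m u"
  shows "dz j (\<lambda>z. cnj (z $ k) * u z) = (\<lambda>z. cnj (z $ k) * dz j u z)"
    "dzb j (\<lambda>z. cnj (z $ k) * u z) = (\<lambda>z. (if j = k then u z else 0) + cnj (z $ k) * dzb j u z)"
  using bip_differentiable[OF assms] bip_differentiable[OF bip_coord[of 0 k]]
   bip_differentiable[OF bip_cnj_coord[of 0 k]]
  by (auto simp: dz_mult dz_coord dz_cnj fun_eq_iff)

lemma dz_bip_add:
  assumes "bip m u" "bip k v"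
  shows "dz j (\<lambda>z. u z + v z) = (\<lambda>z. dz j u z + dz j v z)"
    "dzb j (\<lambda>z. u z + v z) = (\<lambda>z. dzb j u z + dzb j v z)"
  using assms[THEN bip_differentiable] by (auto simp: dz_add)

lemma dz_bip_mult:
  assumes "bip m u" "bip k v"
  shows "dz j (\<lambda>z. u z * v z) = (\<lambda>z. dz j u z * v z + u z * dz j v z)"
    "dzb j (\<lambda>z. u z * v z) = (\<lambda>z. dzb j u z * v z + u z * dzb j v z)"
  using assms[THEN bip_differentiable] by (auto simp: dz_mult)

lemma dz_bip_scale:
  assumes "bip m u"
  shows "dz j (\<lambda>z. c * u z) = (\<lambda>z. c * dz j u z)"
    "dzb j (\<lambda>z. c * u z) = (\<lambda>z. c * dzb j u z)"
  using dz_bip_mult[OF bip_const[of 0 c] assms] by auto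

lemma dz_bip_diff:
  assumes "bip m u" "bip k v"
  shows "dz j (\<lambda>z. u z - v z) = (\<lambda>z. dz j u z - dz j v z)"
    "dzb j (\<lambda>z. u z - v z) = (\<lambda>z. dzb j u z - dzb j v z)"
  using dz_bip_add[OF assms(1) bip_scale[OF assms(2), of "-1"]] dz_bip_scale[OF assms(2), of _ "-1"]
  by auto

lemma dz_bip_sum:
  assumes "\<And>i. i \<in> I \<Longrightarrow> bip m (u i)"
  shows "dz j (\<lambda>z. \<Sum>i\<in>I. u i z) = (\<lambda>z. \<Sum>i\<in>I. dz j (u i) z)"
    "dzb j (\<lambda>z. \<Sum>i\<in>I. u i z) = (\<lambda>z. \<Sum>i\<in>I. dzb j (u i) z)"
proof -
  have "dz j (\<lambda>z. \<Sum>i\<in>I. u i z) = (\<lambda>z. \<Sum>i\<in>I. dz j (u i) z) \<and>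
     dzb j (\<lambda>z. \<Sum>i\<in>I. u i z) = (\<lambda>z. \<Sum>i\<in>I. dzb j (u i) z)" using assms
  proof (induction I rule: infinite_finite_induct)
    case (insert i I)
    then have "bip m (u i)" "bip m (\<lambda>z. \<Sum>i\<in>I. u i z)" by (auto intro: bip_sum)
    from dz_bip_add[OF this] insert show ?case by simp
  qed auto
  then show "dz j (\<lambda>z. \<Sum>i\<in>I. u i z) = (\<lambda>z. \<Sum>i\<in>I. dz j (u i) z)"
    "dzb j (\<lambda>z. \<Sum>i\<in>I. u i z) = (\<lambda>z. \<Sum>i\<in>I. dzb j (u i) z)" by auto
qed

lemma dz_bip_cnj:
  assumes "bip m u"
  shows "dz j (\<lambda>z. cnj (u z)) = (\<lambda>z. cnj (dzb j u z))" "dzb j (\<lambda>z. cnj (u z)) = (\<lambda>z. cnj (dz j u z))"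
  using bip_differentiable[OF assms] by (auto simp: dz_cnj)

text \<open>At \<open>m = 0\<close> truncated subtraction would leave \<open>dzb j u\<close> merely
  analytic. The last conjunct records that it vanishes, and the induction needs this when
  multiplication by \<open>cnj (z $ k)\<close> raises the degree from 0.\<close>

lemma bip_dz_aux:
  "bip m u \<Longrightarrow> bip m (dz j u) \<and> bip (m - 1) (dzb j u) \<and> (m = 0 \<longrightarrow> dzb j u = (\<lambda>_. 0))"
proof (induction rule: bip.induct)
  case (bip_coord_mult m u k)
  then have "bip m (\<lambda>z. (if j = k then u z else 0))" by (cases "j = k") auto
  with bip_coord_mult show ?case
    by (auto simp: dz_coord_mult intro!: bip.bip_coord_mult bip_add)
next
  case (bip_cnj_coord_mult m u k)
  then have "bip m (\<lambda>z. (if j = k then u z else 0))" by (cases "j = k") auto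
  moreover have "bip m (\<lambda>z. cnj (z $ k) * dzb j u z)"
    using bip_cnj_coord_mult bip.bip_cnj_coord_mult[of "m - 1" "dzb j u" k] by (cases m) auto
  ultimately show ?case using bip_cnj_coord_mult
    by (auto simp: dz_cnj_coord_mult intro!: bip.bip_cnj_coord_mult bip_add)
qed (auto simp: dz_bip_add)

lemma bip_dz: "bip m u \<Longrightarrow> bip m (dz j u)"
  and bip_dzb: "bip m u \<Longrightarrow> bip (m - 1) (dzb j u)"
  and dzb_bip0: "bip 0 u \<Longrightarrow> dzb j u = (\<lambda>_. 0)"
  using bip_dz_aux by auto

lemma bip_dzb': "bip m u \<Longrightarrow> bip m (dzb j u)"
  by (rule bip_mono[OF bip_dzb]) auto

text \<open>Induction over the generators takes the place of the symmetry of second derivatives: for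
  each generator both orders produce the same product-rule terms.\<close>

lemma dz_commute:
  assumes "bip m u"
  shows "dz j (dzb k u) = dzb k (dz j u)" "dz j (dz k u) = dz k (dz j u)"
    "dzb j (dzb k u) = dzb k (dzb j u)"
proof -
  have "dz j (dzb k u) = dzb k (dz j u) \<and> dz j (dz k u) = dz k (dz j u) \<and>
    dzb j (dzb k u) = dzb k (dzb j u)" using assms
  proof (induction rule: bip.induct)
    case (bip_coord_mult m u l)
    note [simp] = dz_coord_mult[OF bip_coord_mult.hyps] dz_coord_mult[OF bip_dz[OF bip_coord_mult.hyps]]
       dz_coord_mult[OF bip_dzb'[OF bip_coord_mult.hyps]]
    have b: "bip m (\<lambda>z. if P then u z else 0)" for P
      using bip_coord_mult.hyps by (cases P) auto
    have i: "dz a (\<lambda>z. if P then u z else 0) = (\<lambda>z. if P then dz a u z else 0)"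
       "dzb a (\<lambda>z. if P then u z else 0) = (\<lambda>z. if P then dzb a u z else 0)" for a P
      by (cases P; simp)+
    note [simp] = dz_bip_add[OF b bip.bip_coord_mult[OF bip_dz[OF bip_coord_mult.hyps]]]
      i bip_coord_mult.IH
    show ?case using bip_coord_mult.IH by auto
  next
    case (bip_cnj_coord_mult m u l)
    note [simp] = dz_cnj_coord_mult[OF bip_cnj_coord_mult.hyps] dz_cnj_coord_mult[OF bip_dz[OF bip_cnj_coord_mult.hyps]]
       dz_cnj_coord_mult[OF bip_dzb'[OF bip_cnj_coord_mult.hyps]]
    have b: "bip m (\<lambda>z. if P then u z else 0)" for P
      using bip_cnj_coord_mult.hyps by (cases P) auto
    have i: "dz a (\<lambda>z. if P then u z else 0) = (\<lambda>z. if P then dz a u z else 0)"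
       "dzb a (\<lambda>z. if P then u z else 0) = (\<lambda>z. if P then dzb a u z else 0)" for a P
      by (cases P; simp)+
    note [simp] = dz_bip_add[OF b bip.bip_cnj_coord_mult[OF bip_dzb'[OF bip_cnj_coord_mult.hyps]]]
      i bip_cnj_coord_mult.IH
    show ?case using bip_cnj_coord_mult.IH by auto
  next
    case (bip_add m u v)
    then show ?case
      by (simp add: dz_bip_add[of m u m v] dz_bip_add[OF bip_dz bip_dz, of m u m v]
         dz_bip_add[OF bip_dzb bip_dzb, of m u m v])
  qed auto
  then show "dz j (dzb k u) = dzb k (dz j u)" "dz j (dz k u) = dz k (dz j u)"
    "dzb j (dzb k u) = dzb k (dzb j u)" by auto
qed

section \<open>The divergence theorem for functions vanishing on the sphere\<close>

lemma integral_translate: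
  fixes h :: "'a::euclidean_space \<Rightarrow> complex"
  assumes [measurable]: "h \<in> borel_measurable borel"
  shows "(LINT x|lborel. h (a + x)) = (LINT x|lborel. h x)"
proof -
  have "(LINT x|lborel. h x) = (LINT x|distr lborel borel ((+) a). h x)"
    by (simp add: lborel_distr_plus)
  also have "\<dots> = (LINT x|lborel. h (a + x))"
    by (subst integral_distr) auto
  finally show ?thesis ..
qed

text \<open>For \<open>x\<close> inside and \<open>y\<close> outside, \<open>H x\<close> is compared
  with the zero of \<open>H\<close> at the radial projection \<open>s\<close> of \<open>x\<close>;
  the distance \<open>1 - norm x\<close> from \<open>x\<close> to \<open>s\<close> is at most
  \<open>norm (x - y)\<close>. The other positions of the two points are immediate.\<close>

lemma lipschitz_extend_zero:
  fixes H :: "'a::euclidean_space \<Rightarrow> complex"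
  assumes Lip: "\<And>x y. x \<in> cball 0 1 \<Longrightarrow> y \<in> cball 0 1 \<Longrightarrow> norm (H x - H y) \<le> K * norm (x - y)"
    and 0: "\<And>x. norm x = 1 \<Longrightarrow> H x = 0" and K: "0 \<le> K"
  defines "h \<equiv> \<lambda>x. if x \<in> ball 0 1 then H x else 0"
  shows "norm (h x - h y) \<le> K * norm (x - y)"
proof -
  have *: "norm (H x) \<le> K * norm (x - y)" if x: "norm x < 1" and y: "norm y \<ge> 1" for x y
  proof -
    \<comment> \<open>At the centre every unit vector is a nearest point of the sphere, so a basis
      vector is taken.\<close>
    define s where "s = (if x = 0 then SOME b. b \<in> Basis else x /\<^sub>R norm x)"
    have s1: "norm s = 1" by (simp add: s_def some_in_eq)
    have xs: "norm (x - s) = 1 - norm x"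
    proof (cases "x = 0")
      case False
      then have "x - s = - ((1 / norm x - 1) *\<^sub>R x)"
        by (simp add: s_def algebra_simps inverse_eq_divide)
      moreover have "1 / norm x - 1 \<ge> 0" using False x by simp
      ultimately have "norm (x - s) = (1 / norm x - 1) * norm x" by simp
      then show ?thesis using False by (simp add: left_diff_distrib)
    qed (use s1 in auto)
    have "norm (H x) = norm (H x - H s)" using 0[OF s1] by simp
    also have "\<dots> \<le> K * norm (x - s)" using x s1 by (intro Lip) auto
    also have "norm (x - s) \<le> norm (x - y)"
      using xs y norm_triangle_ineq2[of y x] by (simp add: norm_minus_commute)
    finally show ?thesis using K by (simp add: mult_left_mono)
  qed
  show ?thesis
    using Lip[of x y] *[of x y] *[of y x] K
    by (auto simp: h_def norm_minus_commute)
qed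

text \<open>The integral of a difference quotient of the extension by zero vanishes by translation
  invariance, and the extension is Lipschitz, so dominated convergence applies.\<close>

lemma integral_ball_derivative_zero:
  fixes H :: "'a::euclidean_space \<Rightarrow> complex"
  assumes Lip: "\<And>x y. x \<in> cball 0 1 \<Longrightarrow> y \<in> cball 0 1 \<Longrightarrow> norm (H x - H y) \<le> K * norm (x - y)"
    and 0: "\<And>x. norm x = 1 \<Longrightarrow> H x = 0"
    and D: "\<And>x. (H has_derivative D x) (at x)"
    and cD: "continuous_on UNIV (\<lambda>x. D x v)"
  shows "(LINT x|lborel. (if x \<in> ball 0 1 then D x v else 0)) = 0"
proof -
  obtain b :: 'a where b: "b \<in> Basis" using nonempty_Basis by blast
  have "0 \<le> norm (H b - H 0)" by simp
  also have "\<dots> \<le> K * norm (b - 0)" using b by (intro Lip) auto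
  finally have K: "0 \<le> K" using b by simp
  define h where "h = (\<lambda>x. if x \<in> ball 0 1 then H x else 0)"
  define t where "t = (\<lambda>k. 1 / real (Suc k))"
  have t: "0 < t k" "t k \<le> 1" for k by (auto simp: t_def)
  have lim_t: "t \<longlonglongrightarrow> 0" unfolding t_def by (rule LIMSEQ_inverse_real_of_nat[unfolded inverse_eq_divide])
  have Lh: "norm (h x - h y) \<le> K * norm (x - y)" for x y
    unfolding h_def using lipschitz_extend_zero[OF Lip 0 K] by auto
  have hm[measurable]: "h \<in> borel_measurable borel"
  proof -
    have "continuous_on (ball 0 1) H"
      using D by (meson continuous_at_imp_continuous_on has_derivative_continuous)
    then show ?thesis unfolding h_def by (intro borel_measurable_continuous_on_if) auto
  qed
  \<comment> \<open>Since \<open>t k \<le> 1\<close>, the difference quotients vanish outside the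
    ball of radius \<open>1 + norm v\<close>; the Lipschitz constant bounds them inside.\<close>
  define B where "B = (\<lambda>x::'a. indicator (cball 0 (1 + norm v)) x *\<^sub>R (K * norm v))"
  have h0: "h x = 0" if "norm x \<ge> 1" for x using that by (simp add: h_def)
  \<comment> \<open>The unit vector \<open>b\<close> is a zero of \<open>h\<close> at distance at
    most 2 from every point of the ball.\<close>
  have hb: "norm (h x) \<le> K * 2" for x
  proof (cases "norm x < 1")
    case True
    have "norm (b - x) \<le> norm b + norm x" by (rule norm_triangle_ineq4)
    then have "norm (x - b) \<le> 2" using True b by (simp add: norm_minus_commute)
    then show ?thesis using Lh[of x b] h0[of b] b K mult_left_mono[of "norm (x - b)" 2 K] by auto
  qed (use h0 K in auto)
  have hi: "integrable lborel h"
  proof (rule Bochner_Integration.integrable_bound)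
    show "integrable lborel (\<lambda>x::'a. indicator (ball 0 1) x *\<^sub>R (K * 2))"
      using emeasure_lborel_ball_finite[of "0::'a" 1]
      by (intro integrable_scaleR_left integrable_real_indicator) auto
    show "AE x in lborel. norm (h x) \<le> norm (indicator (ball 0 1) x *\<^sub>R (K * 2))"
      using hb K h0 by (intro AE_I2) (auto simp: indicator_def)
  qed simp
  let ?g = "\<lambda>k x. (h (t k *\<^sub>R v + x) - h x) /\<^sub>R t k"
  have int0: "(LINT x|lborel. ?g k x) = 0" for k
  proof -
    have "integrable lborel (\<lambda>x. h (t k *\<^sub>R v + x))"
    proof -
      have "integrable (distr lborel borel ((+) (t k *\<^sub>R v))) h"
        using hi by (simp add: lborel_distr_plus)
      then show ?thesis by (subst (asm) integrable_distr_eq) auto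
    qed
    then show ?thesis using hi by (simp add: integral_translate)
  qed
  have "(\<lambda>k. LINT x|lborel. ?g k x) \<longlonglongrightarrow> (LINT x|lborel. (if x \<in> ball 0 1 then D x v else 0))"
  proof (rule integral_dominated_convergence[where w = B])
    show "(\<lambda>x. if x \<in> ball 0 1 then D x v else 0) \<in> borel_measurable lborel"
      using borel_measurable_continuous_on_if[of "ball 0 1" "\<lambda>x. D x v" "\<lambda>_. 0"] cD
      by (auto intro: continuous_on_subset)
    show "?g k \<in> borel_measurable lborel" for k by measurable
    show "integrable lborel B" unfolding B_def
      using emeasure_lborel_cball_finite[of "0::'a" "1 + norm v"]
      by (intro integrable_scaleR_left integrable_real_indicator) auto
    have "norm (?g k x) \<le> B x" for k x
    proof (cases "norm x \<le> 1 + norm v")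
      case True
      have "norm (?g k x) \<le> (K * norm (t k *\<^sub>R v)) / t k"
        using Lh[of "t k *\<^sub>R v + x" x] t(1)[of k] by (simp add: divide_inverse mult.commute mult_left_mono)
      also have "\<dots> = K * norm v" using t(1)[of k] by simp
      finally show ?thesis using True by (simp add: B_def)
    next
      case False
      have "norm (t k *\<^sub>R v) \<le> norm v"
        using t[of k] by (simp add: mult_left_le_one_le)
      then have "norm (t k *\<^sub>R v + x) \<ge> 1"
        using False norm_triangle_ineq2[of x "- (t k *\<^sub>R v)"] by (simp add: add.commute)
      moreover have "norm x \<ge> 1" using False norm_ge_zero[of v] by linarith
      ultimately show ?thesis using K by (simp add: h0 B_def)
    qed
    then show "AE x in lborel. norm (?g k x) \<le> B x" for k by simp
    \<comment> \<open>On the sphere the extension by zero need not be differentiable, but the sphere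
      is a null set.\<close>
    have "AE x::'a in lborel. x \<notin> sphere 0 1"
      using negligible_sphere[of "0::'a" 1]
      by (intro AE_not_in) (simp add: negligible_iff_null_sets null_sets_completion_iff closed_sphere borel_closed)
    moreover have "(\<lambda>k. ?g k x) \<longlonglongrightarrow> (if x \<in> ball 0 1 then D x v else 0)" if "x \<notin> sphere 0 1" for x
    proof -
      define D' where "D' = (if x \<in> ball 0 1 then D x else (\<lambda>_. 0))"
      have hd: "(h has_derivative D') (at x)"
      proof (cases "norm x < 1")
        case True
        have "(h has_derivative D x) (at x)"
          by (rule has_derivative_transform_within_open[OF D, of "ball 0 1"]) (use True in \<open>auto simp: h_def\<close>)
        then show ?thesis using True by (simp add: D'_def)
      next
        case False
        have "(h has_derivative (\<lambda>_. 0)) (at x)"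
          by (rule has_derivative_transform_within_open[of "\<lambda>_. 0" _ x UNIV "- cball 0 1"])
            (use False that in \<open>auto simp: h_def\<close>)
        then show ?thesis using False by (simp add: D'_def)
      qed
      have "((\<lambda>s::real. x + s *\<^sub>R v) has_derivative (\<lambda>s. s *\<^sub>R v)) (at 0)"
        by (auto intro!: derivative_eq_intros)
      then have "((\<lambda>s. h (x + s *\<^sub>R v)) has_derivative (\<lambda>s. D' (s *\<^sub>R v))) (at 0)"
        using has_derivative_compose[of "\<lambda>s::real. x + s *\<^sub>R v" "\<lambda>s. s *\<^sub>R v" 0 UNIV h D'] hd by simp
      moreover have "D' (s *\<^sub>R v) = s *\<^sub>R D' v" for s
        using hd by (simp add: has_derivative_linear linear_cmul)
      ultimately have "((\<lambda>s. h (x + s *\<^sub>R v)) has_vector_derivative D' v) (at 0)"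
        by (simp add: has_vector_derivative_def)
      then have "((\<lambda>s. norm (h (x + s *\<^sub>R v) - h x - s *\<^sub>R D' v) / norm s) \<longlongrightarrow> 0) (at 0)"
        by (simp add: has_vector_derivative_def has_derivative_at)
      moreover have "norm (h (x + s *\<^sub>R v) - h x - s *\<^sub>R D' v) / norm s
          = norm ((h (x + s *\<^sub>R v) - h x) /\<^sub>R s - D' v)" if "s \<noteq> 0" for s
      proof -
        have "(h (x + s *\<^sub>R v) - h x) /\<^sub>R s - D' v = (h (x + s *\<^sub>R v) - h x - s *\<^sub>R D' v) /\<^sub>R s"
          using that by (simp add: scaleR_diff_right)
        then show ?thesis by (simp add: divide_inverse mult.commute)
      qed
      ultimately have "((\<lambda>s. norm ((h (x + s *\<^sub>R v) - h x) /\<^sub>R s - D' v)) \<longlongrightarrow> 0) (at 0)"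
        by (elim Lim_transform_eventually) (simp add: eventually_at_filter)
      then have "((\<lambda>s. (h (x + s *\<^sub>R v) - h x) /\<^sub>R s) \<longlongrightarrow> D' v) (at 0)"
        by (simp add: tendsto_norm_zero_iff LIM_zero_iff)
      moreover have "filterlim t (at 0) sequentially"
        using lim_t t by (auto simp: filterlim_at less_imp_neq[symmetric])
      ultimately have "(\<lambda>k. (h (x + t k *\<^sub>R v) - h x) /\<^sub>R t k) \<longlonglongrightarrow> D' v"
        by (rule filterlim_compose)
      then show ?thesis by (auto simp: D'_def add.commute)
    qed
    ultimately show "AE x in lborel. (\<lambda>k. ?g k x) \<longlonglongrightarrow> (if x \<in> ball 0 1 then D x v else 0)"
      by (rule eventually_mono)
  qed
  then show ?thesis unfolding int0 by (simp add: LIMSEQ_const_iff)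
qed

lemma integral_ball_measure:
  fixes f :: "complex^'n::finite \<Rightarrow> 'b::{banach, second_countable_topology}"
  assumes [measurable]: "f \<in> borel_measurable borel"
  shows "(LINT z|ball_measure. f z) =
    (LINT z|lborel. (if z \<in> ball 0 1 then f z else 0)) /\<^sub>R measure lborel (ball (0::complex^'n) 1)"
proof -
  let ?V = "measure lborel (ball (0::complex^'n) 1)"
  have V1: "emeasure lborel (ball (0::complex^'n) 1) = ennreal ?V"
    using emeasure_ball(2)[where 'n='n] by (intro emeasure_eq_ennreal_measure) simp
  have V2: "?V > 0"
    using emeasure_ball(1)[where 'n='n] unfolding V1 by (simp add: zero_less_measure_iff)
  have e: "indicator (ball 0 1) z / ennreal ?V = ennreal (indicator (ball 0 1) z / ?V)" for z :: "complex^'n"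
    using divide_ennreal[of "indicator (ball 0 1) z" ?V] V2 by (cases "z \<in> ball 0 1") auto
  have d: "ball_measure = density lborel (\<lambda>z::complex^'n. ennreal (indicator (ball 0 1) z / ?V))"
    unfolding ball_measure_def uniform_measure_def V1 e ..
  have "(LINT z|ball_measure. f z) = (LINT z|lborel. (indicator (ball 0 1) z / ?V) *\<^sub>R f z)"
    unfolding d
    by (rule integral_density) (use V2 in \<open>auto intro!: borel_measurable_divide borel_measurable_indicator\<close>)
  also have "\<dots> = (LINT z|lborel. (if z \<in> ball 0 1 then f z else 0) /\<^sub>R ?V)"
    by (intro Bochner_Integration.integral_cong) (auto simp: indicator_def divide_inverse)
  finally show ?thesis by simp
qed

lemma bip_measurable [measurable]: "bip m u \<Longrightarrow> u \<in> borel_measurable borel"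
  by (intro borel_measurable_continuous_onI bip_continuous_on)

lemma bip_bounded:
  assumes "bip m u" shows "\<exists>B\<ge>0. \<forall>z\<in>cball 0 1. norm (u z) \<le> B"
proof -
  have "compact (u ` cball 0 1)"
    by (intro compact_continuous_image bip_continuous_on[OF assms]) simp
  then obtain B where B: "\<forall>z\<in>cball 0 1. norm (u z) \<le> B"
    by (meson bounded_iff compact_imp_bounded imageI)
  then have "B \<ge> 0" using norm_ge_zero order_trans by (metis centre_in_cball zero_le_one)
  with B show ?thesis by auto
qed

lemma bip_lipschitz:
  "bip m u \<Longrightarrow> \<exists>K. \<forall>x\<in>cball 0 1. \<forall>y\<in>cball 0 1. norm (u x - u y) \<le> K * norm (x - y)"
proof (induction rule: bip.induct)
  case (bip_const m c)
  show ?case by (intro exI[of _ 0]) auto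
next
  case (bip_add m u v)
  then obtain K L where
    "\<forall>x\<in>cball 0 1. \<forall>y\<in>cball 0 1. norm (u x - u y) \<le> K * norm (x - y)"
    "\<forall>x\<in>cball 0 1. \<forall>y\<in>cball 0 1. norm (v x - v y) \<le> L * norm (x - y)" by auto
  then have "norm (u x + v x - (u y + v y)) \<le> (K + L) * norm (x - y)"
    if "x \<in> cball 0 1" "y \<in> cball 0 1" for x y
    using that norm_diff_triangle_ineq[of "u x" "v x" "u y" "v y"]
    by (smt (verit) distrib_right)
  then show ?case by blast
next
  case (bip_coord_mult m u k)
  then obtain K where K: "\<forall>x\<in>cball 0 1. \<forall>y\<in>cball 0 1. norm (u x - u y) \<le> K * norm (x - y)" by auto
  obtain B where B: "B \<ge> 0" "\<forall>z\<in>cball 0 1. norm (u z) \<le> B" using bip_bounded bip_coord_mult.hyps by blast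
  have "norm (x $ k * u x - y $ k * u y) \<le> (K + B) * norm (x - y)" if "x \<in> cball 0 1" "y \<in> cball 0 1" for x y
  proof -
    have "x $ k * u x - y $ k * u y = x $ k * (u x - u y) + (x - y) $ k * u y"
      by (simp add: algebra_simps)
    also have "norm \<dots> \<le> norm (x $ k) * norm (u x - u y) + norm ((x - y) $ k) * norm (u y)"
      by (metis norm_mult norm_triangle_ineq)
    also have "\<dots> \<le> 1 * (K * norm (x - y)) + norm (x - y) * B"
      using that K B Finite_Cartesian_Product.norm_nth_le[of x k]
        Finite_Cartesian_Product.norm_nth_le[of "x - y" k]
      by (intro add_mono mult_mono) auto
    finally show ?thesis by (simp add: algebra_simps)
  qed
  then show ?case by blast
next
  case (bip_cnj_coord_mult m u k)
  then obtain K where K: "\<forall>x\<in>cball 0 1. \<forall>y\<in>cball 0 1. norm (u x - u y) \<le> K * norm (x - y)" by auto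
  obtain B where B: "B \<ge> 0" "\<forall>z\<in>cball 0 1. norm (u z) \<le> B" using bip_bounded bip_cnj_coord_mult.hyps by blast
  have "norm (cnj (x $ k) * u x - cnj (y $ k) * u y) \<le> (K + B) * norm (x - y)"
    if "x \<in> cball 0 1" "y \<in> cball 0 1" for x y
  proof -
    have "cnj (x $ k) * u x - cnj (y $ k) * u y = cnj (x $ k) * (u x - u y) + cnj ((x - y) $ k) * u y"
      by (simp add: algebra_simps)
    also have "norm \<dots> \<le> norm (x $ k) * norm (u x - u y) + norm ((x - y) $ k) * norm (u y)"
      by (metis norm_mult norm_triangle_ineq complex_mod_cnj)
    also have "\<dots> \<le> 1 * (K * norm (x - y)) + norm (x - y) * B"
      using that K B Finite_Cartesian_Product.norm_nth_le[of x k]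
        Finite_Cartesian_Product.norm_nth_le[of "x - y" k]
      by (intro add_mono mult_mono) auto
    finally show ?thesis by (simp add: algebra_simps)
  qed
  then show ?case by blast
qed

lemma frechet_derivative_dz:
  "frechet_derivative u (at z) (axis j 1) = dz j u z + dzb j u z"
  "frechet_derivative u (at z) (axis j \<i>) = \<i> * (dz j u z - dzb j u z)"
  by (simp_all add: dz_def dzb_def field_simps)

text \<open>The real directions \<open>axis j 1\<close> and \<open>axis j \<i>\<close> yield
  vanishing integrals of \<open>dz j H + dzb j H\<close> and of \<open>dz j H - dzb j H\<close>;
  solving for the two summands gives the claim.\<close>

lemma integral_dz_zero:
  fixes H :: "complex^'n::finite \<Rightarrow> complex"
  assumes H: "bip m H" and 0: "\<And>z. norm z = 1 \<Longrightarrow> H z = 0"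
  shows "(LINT z|ball_measure. dz j H z) = 0" "(LINT z|ball_measure. dzb j H z) = 0"
proof -
  obtain K where K: "\<forall>x\<in>cball 0 1. \<forall>y\<in>cball 0 1. norm (H x - H y) \<le> K * norm (x - y)"
    using bip_lipschitz[OF H] by blast
  define D where "D = (\<lambda>z. frechet_derivative H (at z))"
  have D: "(H has_derivative D z) (at z)" for z
    using bip_differentiable[OF H] by (simp add: D_def frechet_derivative_works)
  note bz [measurable] = bip_dz[OF H, THEN bip_measurable] bip_dzb[OF H, THEN bip_measurable]
  note c = bip_dz[OF H, THEN bip_continuous_on] bip_dzb[OF H, THEN bip_continuous_on]
  have i: "integrable lborel (\<lambda>z::complex^'n. if z \<in> ball 0 1 then u z else 0)" if u: "bip k u" for k u
  proof -
    obtain B where B: "B \<ge> 0" "\<forall>z\<in>cball 0 1. norm (u z) \<le> B" using bip_bounded u by blast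
    note [measurable] = bip_measurable[OF u]
    show ?thesis
    proof (rule Bochner_Integration.integrable_bound)
      show "integrable lborel (\<lambda>x. indicator (ball (0::complex^'n) 1) x *\<^sub>R B)"
        using emeasure_ball(2) by (intro integrable_scaleR_left integrable_real_indicator) (auto simp: less_top)
    qed (use B in \<open>auto simp: indicator_def\<close>)
  qed
  have zero: "(LINT z|lborel. (if z \<in> ball 0 1 then D z v else 0)) = 0"
    if "continuous_on UNIV (\<lambda>z. D z v)" for v
    by (rule integral_ball_derivative_zero[OF _ 0 D that, of K]) (use K in auto)
  have "(LINT z|lborel. (if z \<in> ball 0 1 then dz j H z + dzb j H z else 0)) = 0"
    by (rule zero[of "axis j 1", unfolded D_def frechet_derivative_dz]) (intro continuous_on_add c)
  moreover have "(LINT z|lborel. (if z \<in> ball 0 1 then \<i> * (dz j H z - dzb j H z) else 0)) = 0"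
    by (rule zero[of "axis j \<i>", unfolded D_def frechet_derivative_dz]) (intro continuous_on_mult continuous_on_const continuous_on_diff c)
  moreover have "(\<lambda>z. if z \<in> ball 0 1 then dz j H z + dzb j H z else 0) =
      (\<lambda>z. (if z \<in> ball 0 1 then dz j H z else 0) + (if z \<in> ball 0 1 then dzb j H z else 0))"
    "(\<lambda>z. if z \<in> ball 0 1 then \<i> * (dz j H z - dzb j H z) else 0) =
      (\<lambda>z. \<i> * ((if z \<in> ball 0 1 then dz j H z else 0) - (if z \<in> ball 0 1 then dzb j H z else 0)))"
    by auto
  ultimately have "(LINT z|lborel. (if z \<in> ball 0 1 then dz j H z else 0) + (if z \<in> ball 0 1 then dzb j H z else 0)) = 0"
    "(LINT z|lborel. \<i> * ((if z \<in> ball 0 1 then dz j H z else 0) - (if z \<in> ball 0 1 then dzb j H z else 0))) = 0"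
    by metis+
  then have "(LINT z|lborel. (if z \<in> ball 0 1 then dz j H z else 0)) = 0 \<and>
     (LINT z|lborel. (if z \<in> ball 0 1 then dzb j H z else 0)) = 0"
    using i[OF bip_dz[OF H, of j]] i[OF bip_dzb[OF H, of j]] by (auto simp: add_eq_0_iff)
  then show "(LINT z|ball_measure. dz j H z) = 0" "(LINT z|ball_measure. dzb j H z) = 0"
    by (simp_all add: integral_ball_measure)
qed

section \<open>Weighted inner products\<close>

definition wt :: "complex^'n::finite \<Rightarrow> real" where "wt z = 1 - (norm z)\<^sup>2"

lemma norm_cvec_sq: "(norm z)\<^sup>2 = (\<Sum>j\<in>UNIV. (norm (z $ j))\<^sup>2)" for z :: "complex^'n"
  by (simp add: norm_vec_def L2_set_def sum_nonneg)

lemma wt_complex: "complex_of_real (wt z) = 1 - (\<Sum>j\<in>UNIV. z $ j * cnj (z $ j))"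
  by (simp add: wt_def norm_cvec_sq flip: complex_norm_square)

lemma wt_ball: "z \<in> ball 0 1 \<Longrightarrow> 0 < wt z" "wt z \<le> 1"
  by (auto simp: wt_def power_less_one_iff abs_square_less_1)

lemma wt_measurable [measurable]: "wt \<in> borel_measurable borel"
  unfolding wt_def by measurable

lemma bip_wt: "bip 1 (\<lambda>z. complex_of_real (wt z))"
  unfolding wt_complex
  by (intro bip_diff bip_sum bip_const) (use bip_coord_mult[OF bip_cnj_coord[of 0]] in simp)

lemma dz_wt: "dz j (\<lambda>z. complex_of_real (wt z)) = (\<lambda>z. - cnj (z $ j))"
  "dzb j (\<lambda>z. complex_of_real (wt z)) = (\<lambda>z. - (z $ j))"
proof -
  have b: "bip 1 (\<lambda>z. z $ k * cnj (z $ k))" for k :: 'a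
    using bip_coord_mult[OF bip_cnj_coord[of 0]] by simp
  have d: "dz j (\<lambda>z. z $ k * cnj (z $ k)) = (\<lambda>z. if j = k then cnj (z $ k) else 0)"
    "dzb j (\<lambda>z. z $ k * cnj (z $ k)) = (\<lambda>z. if j = k then z $ k else 0)" for k :: 'a
    unfolding dz_coord_mult[OF bip_cnj_coord[of 0]] fun_eq_iff dz_cnj[OF bip_differentiable[OF bip_coord[of 0 k]]]
    by (auto simp: dz_coord)
  have s: "bip 1 (\<lambda>z::complex^'a. \<Sum>k\<in>UNIV. z $ k * cnj (z $ k))" by (intro bip_sum b)
  show "dz j (\<lambda>z. complex_of_real (wt z)) = (\<lambda>z. - cnj (z $ j))"
    "dzb j (\<lambda>z. complex_of_real (wt z)) = (\<lambda>z. - (z $ j))"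
    unfolding wt_complex dz_bip_diff[OF bip_const[of 0 1] s] dz_bip_sum[OF b] d by simp_all
qed

lemma dz_wt_power:
  assumes u: "bip m u"
  shows "dz j (\<lambda>z. complex_of_real (wt z) ^ Suc b * u z) =
      (\<lambda>z. complex_of_real (wt z) ^ Suc b * dz j u z - of_nat (Suc b) * complex_of_real (wt z) ^ b * (cnj (z $ j) * u z))"
    "dzb j (\<lambda>z. complex_of_real (wt z) ^ Suc b * u z) =
      (\<lambda>z. complex_of_real (wt z) ^ Suc b * dzb j u z - of_nat (Suc b) * complex_of_real (wt z) ^ b * (z $ j * u z))"
proof -
  have P: "dz j (\<lambda>z. complex_of_real (wt z) ^ Suc b) = (\<lambda>z. - of_nat (Suc b) * complex_of_real (wt z) ^ b * cnj (z $ j)) \<and>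
    dzb j (\<lambda>z. complex_of_real (wt z) ^ Suc b) = (\<lambda>z. - of_nat (Suc b) * complex_of_real (wt z) ^ b * (z $ j))"
  proof (induction b)
    case 0
    then show ?case using dz_wt[of j] by simp
  next
    case (Suc b)
    have e: "(\<lambda>z::complex^'a. complex_of_real (wt z) ^ Suc (Suc b)) = (\<lambda>z. complex_of_real (wt z) * complex_of_real (wt z) ^ Suc b)"
      by simp
    show ?case
      unfolding e dz_bip_mult[OF bip_wt bip_power[OF bip_wt, of "Suc b"]] Suc[THEN conjunct1] Suc[THEN conjunct2] dz_wt
      by (simp add: fun_eq_iff algebra_simps)
  qed
  show "dz j (\<lambda>z. complex_of_real (wt z) ^ Suc b * u z) =
      (\<lambda>z. complex_of_real (wt z) ^ Suc b * dz j u z - of_nat (Suc b) * complex_of_real (wt z) ^ b * (cnj (z $ j) * u z))"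
    "dzb j (\<lambda>z. complex_of_real (wt z) ^ Suc b * u z) =
      (\<lambda>z. complex_of_real (wt z) ^ Suc b * dzb j u z - of_nat (Suc b) * complex_of_real (wt z) ^ b * (z $ j * u z))"
    unfolding dz_bip_mult[OF bip_power[OF bip_wt, of "Suc b"] u] P[THEN conjunct1] P[THEN conjunct2]
    by (simp_all add: fun_eq_iff algebra_simps)
qed

text \<open>A common home for elements of the Bergman space and for polynomials that also involve
  conjugates. No weight occurs, because \<open>wt \<le> 1\<close> makes all weighted integrals
  finite as well.\<close>

definition sqi :: "(complex^'n::finite \<Rightarrow> complex) \<Rightarrow> bool" where
  "sqi u \<longleftrightarrow> u \<in> borel_measurable borel \<and> integrable ball_measure (\<lambda>z. (norm (u z))\<^sup>2)"

definition ip :: "nat \<Rightarrow> (complex^'n::finite \<Rightarrow> complex) \<Rightarrow> (complex^'n \<Rightarrow> complex) \<Rightarrow> complex" where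
  "ip b u v = (LINT z|ball_measure. complex_of_real (wt z) ^ b * (u z * cnj (v z)))"

text \<open>The exponent \<open>b\<close> weights the squared modulus, so a factor \<open>wt\<close>
  in front of \<open>u\<close> shifts it by 2. Hence a derivative of size \<open>1 / wt\<close>
  costs two powers, and one of size \<open>1 / sqrt wt\<close> costs one.\<close>

definition nrm :: "nat \<Rightarrow> (complex^'n::finite \<Rightarrow> complex) \<Rightarrow> real" where
  "nrm b u = sqrt (LINT z|ball_measure. wt z ^ b * (norm (u z))\<^sup>2)"

lemma AE_ball: "AE z in ball_measure. z \<in> ball (0::complex^'n::finite) 1"
  by (simp add: AE_ball_measure)

lemma bip_sqi: assumes "bip m u" shows "sqi u"
proof -
  interpret finite_measure "ball_measure :: (complex^'a) measure" by (rule finite_measure_ball_measure)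
  obtain B where B: "B \<ge> 0" "\<forall>z\<in>cball 0 1. norm (u z) \<le> B" using bip_bounded assms by blast
  note [measurable] = bip_measurable[OF assms]
  have "integrable ball_measure (\<lambda>z. (norm (u z))\<^sup>2)"
  proof (rule integrable_const_bound[where B = "B\<^sup>2"])
    show "AE z in ball_measure. norm ((norm (u z))\<^sup>2) \<le> B\<^sup>2"
      using AE_ball by eventually_elim (use B in \<open>auto intro!: power_mono\<close>)
  qed measurable
  then show ?thesis by (simp add: sqi_def bip_measurable[OF assms])
qed

lemma bergman_sqi: "sqi (Rep_bergman f)"
  using Rep_bergman[of f] by (auto simp: sqi_def bergman_functions_measurable) (simp add: bergman_functions_def)

lemma sqi_wt_integrable:
  assumes "sqi u" shows "integrable ball_measure (\<lambda>z. wt z ^ b * (norm (u z))\<^sup>2)"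
proof (rule Bochner_Integration.integrable_bound)
  have [measurable]: "u \<in> borel_measurable borel" using assms by (simp add: sqi_def)
  show "integrable ball_measure (\<lambda>z. (norm (u z))\<^sup>2)" using assms by (simp add: sqi_def)
  show "AE z in ball_measure. norm (wt z ^ b * (norm (u z))\<^sup>2) \<le> norm ((norm (u z))\<^sup>2)"
    using AE_ball
  proof eventually_elim
    case (elim z)
    then have "0 \<le> wt z ^ b" "wt z ^ b \<le> 1" using wt_ball[of z] by (auto intro: power_le_one)
    then show ?case by (simp add: abs_mult mult_left_le_one_le)
  qed
  show "(\<lambda>z. wt z ^ b * (norm (u z))\<^sup>2) \<in> borel_measurable ball_measure" by measurable
qed

lemma sqi_integrable:
  assumes "sqi u" "sqi v"
  shows "integrable ball_measure (\<lambda>z. complex_of_real (wt z) ^ b * (u z * cnj (v z)))"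
proof (rule Bochner_Integration.integrable_bound)
  have [measurable]: "u \<in> borel_measurable borel" "v \<in> borel_measurable borel" using assms by (auto simp: sqi_def)
  have [measurable]: "cnj \<in> borel_measurable borel"
    by (intro borel_measurable_continuous_onI continuous_intros)
  show "integrable ball_measure (\<lambda>z. wt z ^ b * (norm (u z))\<^sup>2 + wt z ^ b * (norm (v z))\<^sup>2)"
    using assms by (intro Bochner_Integration.integrable_add sqi_wt_integrable)
  show "AE z in ball_measure. norm (complex_of_real (wt z) ^ b * (u z * cnj (v z))) \<le> norm (wt z ^ b * (norm (u z))\<^sup>2 + wt z ^ b * (norm (v z))\<^sup>2)"
    using AE_ball
  proof eventually_elim
    case (elim z)
    then have w: "0 \<le> wt z" using wt_ball[of z] by auto
    have "2 * (norm (u z) * norm (v z)) \<le> (norm (u z))\<^sup>2 + (norm (v z))\<^sup>2"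
      using sum_squares_bound[of "norm (u z)" "norm (v z)"] by (simp add: mult.assoc)
    moreover have "0 \<le> norm (u z) * norm (v z)" by simp
    ultimately have "norm (u z) * norm (v z) \<le> (norm (u z))\<^sup>2 + (norm (v z))\<^sup>2" by linarith
    then have "wt z ^ b * (norm (u z) * norm (v z)) \<le> wt z ^ b * ((norm (u z))\<^sup>2 + (norm (v z))\<^sup>2)"
      using w by (intro mult_left_mono) auto
    then show ?case using w by (simp add: norm_mult norm_power distrib_left)
  qed
  show "(\<lambda>z. complex_of_real (wt z) ^ b * (u z * cnj (v z))) \<in> borel_measurable ball_measure" by measurable
qed

lemma sqi_add: assumes "sqi u" "sqi v" shows "sqi (\<lambda>z. u z + v z)"
proof -
  have [measurable]: "u \<in> borel_measurable borel" "v \<in> borel_measurable borel" using assms by (auto simp: sqi_def)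
  have "integrable ball_measure (\<lambda>z. (norm (u z + v z))\<^sup>2)"
  proof (rule Bochner_Integration.integrable_bound)
    show "integrable ball_measure (\<lambda>z. 2 * ((norm (u z))\<^sup>2 + (norm (v z))\<^sup>2))"
      using assms by (simp add: sqi_def)
    have "(norm (u z + v z))\<^sup>2 \<le> 2 * ((norm (u z))\<^sup>2 + (norm (v z))\<^sup>2)" for z
    proof -
      have "(norm (u z + v z))\<^sup>2 \<le> (norm (u z) + norm (v z))\<^sup>2"
        by (intro power_mono norm_triangle_ineq) auto
      also have "\<dots> \<le> 2 * ((norm (u z))\<^sup>2 + (norm (v z))\<^sup>2)"
        using sum_squares_bound[of "norm (u z)" "norm (v z)"] by (simp add: power2_sum)
      finally show ?thesis .
    qed
    then show "AE z in ball_measure. norm ((norm (u z + v z))\<^sup>2) \<le> norm (2 * ((norm (u z))\<^sup>2 + (norm (v z))\<^sup>2))"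
      by simp
  qed measurable
  then show ?thesis unfolding sqi_def by simp
qed

lemma sqi_scale: assumes "sqi u" shows "sqi (\<lambda>z. c * u z)"
proof -
  have [measurable]: "u \<in> borel_measurable borel" using assms by (simp add: sqi_def)
  have "integrable ball_measure (\<lambda>z. (norm c)\<^sup>2 * (norm (u z))\<^sup>2)"
    using assms by (intro integrable_mult_right) (simp add: sqi_def)
  then show ?thesis unfolding sqi_def norm_mult power_mult_distrib by simp
qed

lemma ip_add_left: "sqi u \<Longrightarrow> sqi v \<Longrightarrow> sqi x \<Longrightarrow> ip b (\<lambda>z. u z + v z) x = ip b u x + ip b v x"
  unfolding ip_def
  by (subst Bochner_Integration.integral_add[OF sqi_integrable sqi_integrable, symmetric]; (assumption)?)
     (simp add: algebra_simps)

lemma ip_add_right: "sqi u \<Longrightarrow> sqi v \<Longrightarrow> sqi x \<Longrightarrow> ip b x (\<lambda>z. u z + v z) = ip b x u + ip b x v"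
  unfolding ip_def
  by (subst Bochner_Integration.integral_add[OF sqi_integrable sqi_integrable, symmetric]; (assumption)?)
     (simp add: algebra_simps)

lemma ip_scale_left: "ip b (\<lambda>z. c * u z) x = c * ip b u x"
  unfolding ip_def by (subst integral_mult_right_zero[symmetric]) (simp add: mult_ac)

lemma ip_scale_right: "ip b x (\<lambda>z. c * u z) = cnj c * ip b x u"
  unfolding ip_def by (subst integral_mult_right_zero[symmetric]) (simp add: mult_ac)

lemma ip_cnj: "cnj (ip b u v) = ip b v u"
  unfolding ip_def by (simp add: mult_ac flip: Bochner_Integration.integral_cnj)

lemma ip_coord_left: "ip b (\<lambda>z. z $ j * u z) v = ip b u (\<lambda>z. cnj (z $ j) * v z)"
  unfolding ip_def by (simp add: mult_ac)

lemma ip_cnj_coord_left: "ip b (\<lambda>z. cnj (z $ j) * u z) v = ip b u (\<lambda>z. z $ j * v z)"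
  unfolding ip_def by (simp add: mult_ac)

lemma nrm_nonneg [simp]: "0 \<le> nrm b u"
  unfolding nrm_def by (auto intro!: integral_nonneg_AE eventually_mono[OF AE_ball] dest: wt_ball(1))

lemma nrm_sq: "(nrm b u)\<^sup>2 = (LINT z|ball_measure. wt z ^ b * (norm (u z))\<^sup>2)"
  using nrm_nonneg[of b u] unfolding nrm_def by simp

lemma ip_self: "ip b u u = complex_of_real ((nrm b u)\<^sup>2)"
  unfolding nrm_sq ip_def complex_norm_square[symmetric]
  by (subst integral_complex_of_real[symmetric]) simp

text \<open>The right side is minimal at \<open>t = C / A\<close>, with value
  \<open>2 * A * C\<close>. The shift of both numbers by a small \<open>d\<close> covers the cases
  in which \<open>A\<close> or \<open>C\<close> is 0.\<close>

lemma real_le_geometric_mean: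
  fixes x A C :: real
  assumes "\<And>t. t > 0 \<Longrightarrow> 2 * x \<le> t * A\<^sup>2 + C\<^sup>2 / t" "A \<ge> 0" "C \<ge> 0"
  shows "x \<le> A * C"
proof (rule field_le_epsilon)
  fix e :: real assume e: "e > 0"
  define d where "d = e / (A + C + 1)"
  have d: "d > 0" "d * (A + C) \<le> e" using e assms(2,3) by (auto simp: d_def field_simps)
  have "2 * x \<le> (C + d) / (A + d) * A\<^sup>2 + C\<^sup>2 / ((C + d) / (A + d))"
    using d assms(2,3) by (intro assms(1)) (auto intro!: divide_pos_pos add_nonneg_pos)
  moreover have "(C + d) / (A + d) * A\<^sup>2 \<le> (C + d) * A"
  proof -
    have "A\<^sup>2 / (A + d) \<le> A" using d assms(2) by (simp add: divide_le_eq power2_eq_square distrib_left)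
    then show ?thesis using d assms(3) mult_left_mono[of "A\<^sup>2 / (A + d)" A "C + d"] by simp
  qed
  moreover have "C\<^sup>2 / ((C + d) / (A + d)) \<le> C * (A + d)"
  proof -
    have "C\<^sup>2 / (C + d) \<le> C" using d assms(3) by (simp add: divide_le_eq power2_eq_square distrib_left)
    then show ?thesis using d assms(2) mult_right_mono[of "C\<^sup>2 / (C + d)" C "A + d"] by simp
  qed
  ultimately have "2 * x \<le> 2 * (A * C) + d * (A + C)" by (simp add: algebra_simps)
  then show "x \<le> A * C + e" using d e by linarith
qed

text \<open>Cauchy-Schwarz with \<open>wt ^ b\<close> split unevenly into the roots of
  \<open>wt ^ a\<close> and \<open>wt ^ c\<close>, so that a factor carrying a derivative can take
  the heavier weight. Pointwise it is the arithmetic-geometric inequality with a parameter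
  \<open>t\<close>, optimised after integration.\<close>

lemma ip_bound:
  assumes "sqi u" "sqi v" "a + c = 2 * b"
  shows "norm (ip b u v) \<le> nrm a u * nrm c v"
proof (rule real_le_geometric_mean)
  fix t :: real assume t: "t > 0"
  let ?h = "\<lambda>z. complex_of_real (wt z) ^ b * (u z * cnj (v z))"
  have "2 * norm (ip b u v) \<le> 2 * (LINT z|ball_measure. norm (?h z))"
    unfolding ip_def by (intro mult_left_mono integral_norm_bound) auto
  also have "\<dots> = (LINT z|ball_measure. 2 * norm (?h z))" by simp
  also have "\<dots> \<le> (LINT z|ball_measure. t * (wt z ^ a * (norm (u z))\<^sup>2) + (wt z ^ c * (norm (v z))\<^sup>2) / t)"
  proof (rule integral_mono_AE)
    show "integrable ball_measure (\<lambda>z. 2 * norm (?h z))" using sqi_integrable[OF assms(1,2), of b] by simp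
    show "integrable ball_measure (\<lambda>z. t * (wt z ^ a * (norm (u z))\<^sup>2) + (wt z ^ c * (norm (v z))\<^sup>2) / t)"
      using assms by (intro Bochner_Integration.integrable_add) (auto intro!: sqi_wt_integrable)
    show "AE z in ball_measure. 2 * norm (?h z) \<le> t * (wt z ^ a * (norm (u z))\<^sup>2) + (wt z ^ c * (norm (v z))\<^sup>2) / t"
      using AE_ball
    proof eventually_elim
      case (elim z)
      then have w: "wt z > 0" by (rule wt_ball)
      define x where "x = sqrt t * (sqrt (wt z ^ a) * norm (u z))"
      define y where "y = (sqrt (wt z ^ c) * norm (v z)) / sqrt t"
      have "sqrt (wt z ^ a) * sqrt (wt z ^ c) = wt z ^ b"
        using w assms(3) by (simp add: real_sqrt_mult[symmetric] power_add[symmetric] power_mult mult.commute)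
      then have "2 * norm (?h z) = 2 * (x * y)"
        using t w by (simp add: x_def y_def norm_mult norm_power field_simps)
      also have "\<dots> \<le> x\<^sup>2 + y\<^sup>2" using sum_squares_bound[of x y] by (simp add: mult.assoc)
      also have "\<dots> = t * (wt z ^ a * (norm (u z))\<^sup>2) + (wt z ^ c * (norm (v z))\<^sup>2) / t"
        using t w by (simp add: x_def y_def power_mult_distrib power_divide)
      finally show ?case .
    qed
  qed
  also have "\<dots> = t * (nrm a u)\<^sup>2 + (nrm c v)\<^sup>2 / t"
    unfolding nrm_sq using assms by (subst Bochner_Integration.integral_add) (auto intro!: sqi_wt_integrable)
  finally show "2 * norm (ip b u v) \<le> t * (nrm a u)\<^sup>2 + (nrm c v)\<^sup>2 / t" .
qed auto

lemma nrm_triangle: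
  assumes "sqi u" "sqi v"
  shows "nrm b (\<lambda>z. u z + v z) \<le> nrm b u + nrm b v"
proof (rule power2_le_imp_le)
  have "complex_of_real ((nrm b (\<lambda>z. u z + v z))\<^sup>2) = ip b u u + ip b u v + (cnj (ip b u v) + ip b v v)"
    unfolding ip_self[symmetric] ip_cnj using assms by (simp add: ip_add_left ip_add_right sqi_add)
  then have "Re (complex_of_real ((nrm b (\<lambda>z. u z + v z))\<^sup>2)) = (nrm b u)\<^sup>2 + 2 * Re (ip b u v) + (nrm b v)\<^sup>2"
    by (simp add: ip_self)
  moreover have "Re (ip b u v) \<le> nrm b u * nrm b v"
    using complex_Re_le_cmod ip_bound[OF assms, of b b b] by (metis mult_2 order_trans)
  ultimately show "(nrm b (\<lambda>z. u z + v z))\<^sup>2 \<le> (nrm b u + nrm b v)\<^sup>2"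
    by (simp add: power2_sum)
qed auto

lemma nrm_scale: "nrm b (\<lambda>z. c * u z) = norm c * nrm b u"
proof -
  have "(LINT z|ball_measure. wt z ^ b * (norm (c * u z))\<^sup>2) =
      (norm c)\<^sup>2 * (LINT z|ball_measure. wt z ^ b * (norm (u z))\<^sup>2)"
    by (subst integral_mult_right_zero[symmetric]) (simp add: norm_mult power_mult_distrib mult_ac)
  then show ?thesis by (simp add: nrm_def real_sqrt_mult)
qed

lemma nrm_uminus: "nrm b (\<lambda>z. - u z) = nrm b u"
  unfolding nrm_def by simp

lemma nrm_triangle_diff:
  assumes "sqi u" "sqi v"
  shows "nrm b (\<lambda>z. u z - v z) \<le> nrm b u + nrm b v"
  using nrm_triangle[OF assms(1) sqi_scale[OF assms(2), of "-1"], of b] nrm_uminus[of b v] by simp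

lemma nrm_cong_norm:
  "(\<And>z. norm (u z) = norm (v z)) \<Longrightarrow> nrm b u = nrm b v"
  unfolding nrm_def by simp

lemma nrm_mono_AE:
  assumes "sqi u" "sqi v" "\<And>z. z \<in> ball 0 1 \<Longrightarrow> wt z ^ a * (norm (u z))\<^sup>2 \<le> wt z ^ b * (norm (v z))\<^sup>2"
  shows "nrm a u \<le> nrm b v"
  unfolding nrm_def using assms
  by (intro real_sqrt_le_mono integral_mono_AE sqi_wt_integrable eventually_mono[OF AE_ball])

lemma nrm_antimono: "sqi u \<Longrightarrow> a \<le> b \<Longrightarrow> nrm b u \<le> nrm a u"
  using wt_ball by (intro nrm_mono_AE mult_right_mono power_decreasing) (auto simp: less_imp_le)

lemma sqi_mult_bounded:
  assumes "sqi u" "v \<in> borel_measurable borel" "\<And>z. z \<in> ball 0 1 \<Longrightarrow> norm (v z) \<le> norm (u z)"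
  shows "sqi v"
proof -
  note [measurable] = assms(2)
  have "integrable ball_measure (\<lambda>z. (norm (v z))\<^sup>2)"
  proof (rule Bochner_Integration.integrable_bound)
    show "integrable ball_measure (\<lambda>z. (norm (u z))\<^sup>2)" using assms(1) by (simp add: sqi_def)
    show "AE z in ball_measure. norm ((norm (v z))\<^sup>2) \<le> norm ((norm (u z))\<^sup>2)"
      using AE_ball by eventually_elim (use assms(3) in \<open>auto intro!: power_mono\<close>)
  qed measurable
  then show ?thesis using assms(2) by (simp add: sqi_def)
qed

lemma norm_coord_le1: "z \<in> ball (0::complex^'n) 1 \<Longrightarrow> norm (z $ k) \<le> 1"
  using Finite_Cartesian_Product.norm_nth_le[of z k] by simp

lemma sqi_coord: "sqi u \<Longrightarrow> sqi (\<lambda>z. z $ k * u z)"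
proof (rule sqi_mult_bounded[of u])
  assume "sqi u"
  then have [measurable]: "u \<in> borel_measurable borel" by (simp add: sqi_def)
  show "(\<lambda>z. z $ k * u z) \<in> borel_measurable borel" by measurable
qed (auto simp: norm_mult norm_coord_le1 mult_left_le_one_le)

lemma nrm_coord: "sqi u \<Longrightarrow> nrm b (\<lambda>z. z $ k * u z) \<le> nrm b u"
  by (intro nrm_mono_AE sqi_coord mult_left_mono power_mono zero_le_power)
     (auto simp: norm_mult norm_coord_le1 mult_left_le_one_le wt_ball less_imp_le)

lemma nrm_cnj_coord: "sqi u \<Longrightarrow> nrm b (\<lambda>z. cnj (z $ k) * u z) \<le> nrm b u"
  using nrm_coord[of u b k] nrm_cong_norm[of "\<lambda>z. cnj (z $ k) * u z" "\<lambda>z. z $ k * u z" b]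
  by (simp add: norm_mult)

lemma nrm_wt: "nrm b (\<lambda>z. complex_of_real (wt z) * u z) = nrm (b + 2) u"
  unfolding nrm_def by (simp only: norm_mult power_mult_distrib norm_of_real power2_abs power_add mult.assoc)

lemma nrm_zero [simp]: "nrm b (\<lambda>_. 0) = 0" by (simp add: nrm_def)

lemma nrm_sum:
  assumes "\<And>i. i \<in> I \<Longrightarrow> bip m (u i)"
  shows "nrm b (\<lambda>z. \<Sum>i\<in>I. u i z) \<le> (\<Sum>i\<in>I. nrm b (u i))"
  using assms
proof (induction I rule: infinite_finite_induct)
  case (insert i I)
  then have "nrm b (\<lambda>z. u i z + (\<Sum>i\<in>I. u i z)) \<le> nrm b (u i) + nrm b (\<lambda>z. \<Sum>i\<in>I. u i z)"
    by (intro nrm_triangle bip_sqi[of m] bip_sum) auto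
  with insert show ?case by simp
qed auto

text \<open>The function \<open>wt ^ b * u * cnj v\<close> vanishes on the sphere because
  \<open>b \<ge> 1\<close>, so the integral of its derivative is 0. Conjugation exchanges
  \<open>dz\<close> and \<open>dzb\<close> on \<open>v\<close>, and the derivative of the weight
  yields the term with \<open>b - 1\<close>.\<close>

lemma ip_dz:
  assumes u: "bip m u" and v: "bip k v" and b: "b \<ge> 1"
  shows "ip b (dz j u) v = - ip b u (dzb j v) + of_nat b * ip (b - 1) u (\<lambda>z. z $ j * v z)"
    "ip b (dzb j u) v = - ip b u (dz j v) + of_nat b * ip (b - 1) u (\<lambda>z. cnj (z $ j) * v z)"
proof -
  obtain c where c: "b = Suc c" using b by (cases b) auto
  obtain l where l: "bip l (\<lambda>z. cnj (v z))" using bip_cnj[OF v] by auto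
  have uv: "bip (m + l) (\<lambda>z. u z * cnj (v z))" by (rule bip_mult[OF u l])
  have H: "bip (b * 1 + (m + l)) (\<lambda>z. complex_of_real (wt z) ^ b * (u z * cnj (v z)))"
    by (intro bip_mult bip_power bip_wt u l)
  have 0: "complex_of_real (wt z) ^ b * (u z * cnj (v z)) = 0" if "norm z = 1" for z
    using that c by (simp add: wt_def)
  note s = bip_sqi[OF u] bip_sqi[OF v] bip_sqi[OF bip_dz[OF u]] bip_sqi[OF bip_dz[OF v]]
    bip_sqi[OF bip_dzb[OF u]] bip_sqi[OF bip_dzb[OF v]] bip_sqi[OF bip_cnj_coord_mult[OF v]] bip_sqi[OF bip_coord_mult[OF v]]
  note d = dz_wt_power[OF uv, of _ c, folded c] dz_bip_mult[OF u l] dz_bip_cnj[OF v]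
  have eq: "A + B = of_nat b * C"
    if "(LINT z|ball_measure. complex_of_real (wt z) ^ b * (f z * cnj (v z) + u z * cnj (g z))
       - of_nat b * complex_of_real (wt z) ^ c * (u z * cnj (h z))) = 0"
      "A = ip b f v" "B = ip b u g" "C = ip c u h" "sqi f" "sqi g" "sqi h" for f g h A B C
  proof -
    have i: "integrable ball_measure (\<lambda>z. complex_of_real (wt z) ^ b * (f z * cnj (v z)))"
      "integrable ball_measure (\<lambda>z. complex_of_real (wt z) ^ b * (u z * cnj (g z)))"
      "integrable ball_measure (\<lambda>z. complex_of_real (wt z) ^ c * (u z * cnj (h z)))"
      using that s by (auto intro: sqi_integrable)
    have "(LINT z|ball_measure. (complex_of_real (wt z) ^ b * (f z * cnj (v z)) + complex_of_real (wt z) ^ b * (u z * cnj (g z)))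
       - of_nat b * (complex_of_real (wt z) ^ c * (u z * cnj (h z)))) = 0"
      using that(1) by (simp add: distrib_left mult.assoc)
    then show ?thesis
      unfolding Bochner_Integration.integral_diff[OF Bochner_Integration.integrable_add[OF i(1,2)] integrable_mult_right[OF i(3)]]
        Bochner_Integration.integral_add[OF i(1,2)] integral_mult_right_zero that(2-4) ip_def
      by simp
  qed
  have "ip b (dz j u) v + ip b u (dzb j v) = of_nat b * ip c u (\<lambda>z. z $ j * v z)"
    by (rule eq[OF _ refl refl refl]) (use integral_dz_zero(1)[OF H 0, of j, unfolded d] s in \<open>simp_all add: mult_ac\<close>)
  then show "ip b (dz j u) v = - ip b u (dzb j v) + of_nat b * ip (b - 1) u (\<lambda>z. z $ j * v z)"
    using c by (simp add: algebra_simps)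
  have "ip b (dzb j u) v + ip b u (dz j v) = of_nat b * ip c u (\<lambda>z. cnj (z $ j) * v z)"
    by (rule eq[OF _ refl refl refl]) (use integral_dz_zero(2)[OF H 0, of j, unfolded d] s in \<open>simp_all add: mult_ac\<close>)
  then show "ip b (dzb j u) v = - ip b u (dz j v) + of_nat b * ip (b - 1) u (\<lambda>z. cnj (z $ j) * v z)"
    using c by (simp add: algebra_simps)
qed

section \<open>Caccioppoli inequalities\<close>

text \<open>The first hypothesis says \<open>(x - (c + K) * y) * (x + K * y) \<le> 0\<close>, so
  \<open>c + K\<close> is the root of the quadratic.\<close>

lemma quadratic_bound:
  fixes x y c K :: real
  assumes "x\<^sup>2 \<le> (K * y)\<^sup>2 + c * K * y\<^sup>2 + c * y * x" "0 \<le> x" "0 \<le> y" "0 \<le> c" "0 \<le> K"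
  shows "x \<le> (c + K) * y"
proof (rule ccontr)
  assume "\<not> x \<le> (c + K) * y"
  then have x: "(c + K) * y < x" by simp
  have "0 \<le> (c + K) * y" using assms by simp
  then have "0 < x" using x by simp
  have "(c + K) * y * (K * y) \<le> x * (K * y)" using x assms by (intro mult_right_mono) auto
  also have "\<dots> < x * (x - c * y)" using x \<open>0 < x\<close> by (intro mult_strict_left_mono) (auto simp: algebra_simps)
  finally show False using assms(1) by (simp add: power2_eq_square algebra_simps)
qed

text \<open>Two integrations by parts, with the commuting derivatives exchanged in between, turn the
  square of \<open>nrm c (dz j u)\<close> into that of \<open>nrm c (dzb j u)\<close>. The two terms
  from the weight contain a single derivative each and are split between weights \<open>b\<close>
  and \<open>b + 2\<close>.\<close>

lemma dz_bound_of_dzb_bound: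
  assumes u: "bip m u" and K: "nrm (b + 2) (dzb j u) \<le> K * nrm b u" "0 \<le> K"
  shows "nrm (b + 2) (dz j u) \<le> (real (b + 2) + K) * nrm b u"
proof (rule quadratic_bound)
  define c where "c = b + 2"
  have c: "c \<ge> 1" "b + c = 2 * (c - 1)" "c + b = 2 * (c - 1)" by (auto simp: c_def)
  let ?x = "nrm c (dz j u)" and ?y = "nrm b u" and ?V = "dzb j u"
  have V: "bip m ?V" and D: "bip m (dz j u)" using u by (auto intro: bip_dzb' bip_dz)
  note s = u[THEN bip_sqi] V[THEN bip_sqi] D[THEN bip_sqi] bip_coord_mult[OF u, THEN bip_sqi]
    bip_coord_mult[OF D, THEN bip_sqi]
  have "ip c (dz j u) (dz j u) = - ip c u (dz j ?V) + of_nat c * ip (c - 1) u (\<lambda>z. z $ j * dz j u z)"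
    by (subst ip_dz(1)[OF u D c(1)]) (simp add: dz_commute[OF u])
  also have "ip c u (dz j ?V) = cnj (ip c (dz j ?V) u)" by (simp add: ip_cnj)
  also have "ip c (dz j ?V) u = - ip c ?V ?V + of_nat c * ip (c - 1) ?V (\<lambda>z. z $ j * u z)"
    by (rule ip_dz(1)[OF V u c(1)])
  finally have "complex_of_real (?x\<^sup>2) = complex_of_real ((nrm c ?V)\<^sup>2)
      - of_nat c * cnj (ip (c - 1) ?V (\<lambda>z. z $ j * u z)) + of_nat c * ip (c - 1) u (\<lambda>z. z $ j * dz j u z)"
    by (simp add: ip_self)
  then have "norm (complex_of_real (?x\<^sup>2)) \<le> norm (complex_of_real ((nrm c ?V)\<^sup>2))
      + norm (of_nat c * cnj (ip (c - 1) ?V (\<lambda>z. z $ j * u z))) + norm (of_nat c * ip (c - 1) u (\<lambda>z. z $ j * dz j u z))"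
    by (smt (verit) norm_triangle_ineq norm_triangle_ineq4)
  then have "?x\<^sup>2 \<le> (nrm c ?V)\<^sup>2 + c * norm (ip (c - 1) ?V (\<lambda>z. z $ j * u z)) + c * norm (ip (c - 1) u (\<lambda>z. z $ j * dz j u z))"
    by (simp add: norm_mult norm_power)
  moreover have "norm (ip (c - 1) ?V (\<lambda>z. z $ j * u z)) \<le> (K * ?y) * ?y"
    using K s c unfolding c_def
    by (intro order_trans[OF ip_bound[where a = "b + 2" and c = b]] mult_mono nrm_coord) auto
  then have "c * norm (ip (c - 1) ?V (\<lambda>z. z $ j * u z)) \<le> c * ((K * ?y) * ?y)"
    by (rule mult_left_mono) simp
  moreover have "norm (ip (c - 1) u (\<lambda>z. z $ j * dz j u z)) \<le> ?y * ?x"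
    using s c unfolding c_def
    by (intro order_trans[OF ip_bound[where a = b and c = "b + 2"]] mult_left_mono nrm_coord) auto
  then have "c * norm (ip (c - 1) u (\<lambda>z. z $ j * dz j u z)) \<le> c * (?y * ?x)"
    by (rule mult_left_mono) simp
  moreover have "(nrm c ?V)\<^sup>2 \<le> (K * ?y)\<^sup>2" using K unfolding c_def by (intro power_mono) auto
  ultimately have "?x\<^sup>2 \<le> (K * ?y)\<^sup>2 + c * ((K * ?y) * ?y) + c * (?y * ?x)" by linarith
  then show "(nrm (b + 2) (dz j u))\<^sup>2 \<le> (K * ?y)\<^sup>2 + real (b + 2) * K * ?y\<^sup>2 + real (b + 2) * ?y * nrm (b + 2) (dz j u)"
    unfolding c_def by (simp add: power2_eq_square mult_ac)
qed (use K in auto)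

text \<open>Every derivative costs two powers of the weight. The induction on the degree in the conjugate
  variables works because a conjugate derivative lowers that degree.\<close>

lemma caccioppoli:
  "\<exists>C\<ge>0. \<forall>u j. bip m u \<longrightarrow> nrm (b + 2) (dz j u) \<le> C * nrm b u \<and> nrm (b + 2) (dzb j u) \<le> C * nrm b u"
proof (induction m arbitrary: b)
  case 0
  show ?case
  proof (intro exI[of _ "real (b + 2)"] conjI allI impI)
    fix u :: "complex^'a \<Rightarrow> complex" and j assume u: "bip 0 u"
    show "nrm (b + 2) (dz j u) \<le> real (b + 2) * nrm b u"
      using dz_bound_of_dzb_bound[OF u, of b j 0] by (simp add: dzb_bip0[OF u])
    show "nrm (b + 2) (dzb j u) \<le> real (b + 2) * nrm b u"
      by (simp add: dzb_bip0[OF u])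
  qed simp
next
  case (Suc m)
  \<comment> \<open>The induction hypothesis enters at weight \<open>b + 2\<close>, for
    \<open>dzb j u\<close>, whose conjugate degree is \<open>m\<close>; this is why \<open>b\<close>
    is arbitrary in the induction.\<close>
  obtain C where C: "C \<ge> 0" "\<And>(u::complex^'a \<Rightarrow> complex) j. bip m u \<Longrightarrow> nrm (b + 2 + 2) (dz j u) \<le> C * nrm (b + 2) u"
    using Suc[of "b + 2"] by auto
  define K where "K = C + real (b + 2)"
  have K: "K \<ge> 0" using C by (simp add: K_def)
  have *: "nrm (b + 2) (dzb j u) \<le> K * nrm b u" if u: "bip (Suc m) u" for u :: "complex^'a \<Rightarrow> complex" and j
  proof -
    let ?V = "dzb j u"
    have V: "bip m ?V" using bip_dzb[OF u] by simp
    note s = u[THEN bip_sqi] V[THEN bip_sqi] bip_dz[OF V, THEN bip_sqi] bip_cnj_coord_mult[OF V, THEN bip_sqi]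
    \<comment> \<open>After integration by parts \<open>u\<close> has weight \<open>b\<close>, and
      the second derivative \<open>dz j (dzb j u)\<close> has weight \<open>b + 4\<close>, where the
      hypothesis bounds it by \<open>dzb j u\<close> at weight \<open>b + 2\<close>. Dividing by
      that norm leaves the constant \<open>K\<close>.\<close>
    have "complex_of_real ((nrm (b + 2) ?V)\<^sup>2) = - ip (b + 2) u (dz j ?V) + of_nat (b + 2) * ip (b + 1) u (\<lambda>z. cnj (z $ j) * ?V z)"
      unfolding ip_self[symmetric] using ip_dz(2)[OF u V, of "b + 2" j] by simp
    then have "norm (complex_of_real ((nrm (b + 2) ?V)\<^sup>2)) \<le> norm (ip (b + 2) u (dz j ?V))
        + norm (of_nat (b + 2) * ip (b + 1) u (\<lambda>z. cnj (z $ j) * ?V z))"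
      by (metis norm_minus_cancel norm_triangle_ineq)
    then have "(nrm (b + 2) ?V)\<^sup>2 \<le> norm (ip (b + 2) u (dz j ?V)) + real (b + 2) * norm (ip (b + 1) u (\<lambda>z. cnj (z $ j) * ?V z))"
      unfolding norm_mult norm_of_nat by (simp add: norm_power)
    moreover have "norm (ip (b + 2) u (dz j ?V)) \<le> nrm b u * nrm (b + 2 + 2) (dz j ?V)"
      using s by (intro ip_bound) auto
    moreover have "nrm b u * nrm (b + 2 + 2) (dz j ?V) \<le> nrm b u * (C * nrm (b + 2) ?V)"
      using C(2)[OF V] by (intro mult_left_mono) auto
    moreover have "norm (ip (b + 1) u (\<lambda>z. cnj (z $ j) * ?V z)) \<le> nrm b u * nrm (b + 2) ?V"
      using s by (intro order_trans[OF ip_bound[where a = b and c = "b + 2"]] mult_left_mono nrm_cnj_coord) auto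
    then have "real (b + 2) * norm (ip (b + 1) u (\<lambda>z. cnj (z $ j) * ?V z)) \<le> real (b + 2) * (nrm b u * nrm (b + 2) ?V)"
      by (rule mult_left_mono) simp
    ultimately have "(nrm (b + 2) ?V)\<^sup>2 \<le> nrm b u * (C * nrm (b + 2) ?V) + real (b + 2) * (nrm b u * nrm (b + 2) ?V)"
      by linarith
    then have "nrm (b + 2) ?V * nrm (b + 2) ?V \<le> (K * nrm b u) * nrm (b + 2) ?V"
      by (simp add: K_def power2_eq_square algebra_simps)
    then show ?thesis
      using mult_right_le_imp_le[of "nrm (b + 2) ?V" "nrm (b + 2) ?V" "K * nrm b u"] K
      by (cases "nrm (b + 2) ?V = 0") (auto simp: less_le)
  qed
  show ?case
  proof (intro exI[of _ "real (b + 2) + K"] conjI allI impI)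
    fix u :: "complex^'a \<Rightarrow> complex" and j assume u: "bip (Suc m) u"
    show "nrm (b + 2) (dz j u) \<le> (real (b + 2) + K) * nrm b u"
      by (rule dz_bound_of_dzb_bound[OF u *[OF u] K])
    have "K * nrm b u \<le> (real (b + 2) + K) * nrm b u" by (intro mult_right_mono) auto
    then show "nrm (b + 2) (dzb j u) \<le> (real (b + 2) + K) * nrm b u" using *[OF u, of j] by linarith
  qed (use K in auto)
qed

section \<open>Derivatives tangential to the spheres\<close>

definition tz :: "'n::finite \<Rightarrow> 'n \<Rightarrow> (complex^'n \<Rightarrow> complex) \<Rightarrow> complex^'n \<Rightarrow> complex" where
  "tz j k u z = cnj (z $ k) * dz j u z - cnj (z $ j) * dz k u z"

definition tzb :: "'n::finite \<Rightarrow> 'n \<Rightarrow> (complex^'n \<Rightarrow> complex) \<Rightarrow> complex^'n \<Rightarrow> complex" where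
  "tzb j k u z = z $ k * dzb j u z - z $ j * dzb k u z"

lemma bip_tz: assumes "bip m u" shows "bip (Suc m) (tz j k u)"
proof -
  have "bip (Suc m) (\<lambda>z. cnj (z $ k) * dz j u z - cnj (z $ j) * dz k u z)"
    by (intro bip_diff bip_cnj_coord_mult bip_dz assms)
  then show ?thesis by (simp add: tz_def[abs_def])
qed

lemma bip_tzb: assumes "bip m u" shows "bip (m - 1) (tzb j k u)"
proof -
  have "bip (m - 1) (\<lambda>z. z $ k * dzb j u z - z $ j * dzb k u z)"
    by (intro bip_diff bip_coord_mult bip_dzb assms)
  then show ?thesis by (simp add: tzb_def[abs_def])
qed

lemma ip_diff_left: "sqi u \<Longrightarrow> sqi v \<Longrightarrow> sqi x \<Longrightarrow> ip b (\<lambda>z. u z - v z) x = ip b u x - ip b v x"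
  using ip_add_left[OF _ sqi_scale, of u v x b "-1"] ip_scale_left[of b "-1" v x] by simp

lemma ip_diff_right: "sqi u \<Longrightarrow> sqi v \<Longrightarrow> sqi x \<Longrightarrow> ip b x (\<lambda>z. u z - v z) = ip b x u - ip b x v"
  using ip_add_right[OF _ sqi_scale, of u v x b "-1"] ip_scale_right[of b x "-1" v] by simp

text \<open>The coefficients are conjugated on their way to the other factor, where the derivative
  annihilates them. The terms that differentiate the weight are symmetric in \<open>j\<close> and
  \<open>k\<close> and cancel, so no lower weight appears.\<close>

lemma ip_tz:
  assumes u: "bip m u" and v: "bip l v" and c: "c \<ge> 1"
  shows "ip c (tz j k u) v = - ip c u (tzb j k v)" "ip c (tzb j k u) v = - ip c u (tz j k v)"
proof -
  have 1: "ip c (\<lambda>z. cnj (z $ k) * dz j u z) v = - ip c u (\<lambda>z. z $ k * dzb j v z)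
     + of_nat c * ip (c - 1) u (\<lambda>z. z $ j * (z $ k * v z))" for j k
    unfolding ip_cnj_coord_left ip_dz(1)[OF u bip_coord_mult[OF v] c] dz_coord_mult[OF v] ..
  have 2: "ip c (\<lambda>z. z $ k * dzb j u z) v = - ip c u (\<lambda>z. cnj (z $ k) * dz j v z)
     + of_nat c * ip (c - 1) u (\<lambda>z. cnj (z $ j) * (cnj (z $ k) * v z))" for j k
    unfolding ip_coord_left ip_dz(2)[OF u bip_cnj_coord_mult[OF v] c] dz_cnj_coord_mult[OF v] ..
  note s = u[THEN bip_sqi] v[THEN bip_sqi]
    bip_cnj_coord_mult[OF bip_dz[OF u], THEN bip_sqi] bip_coord_mult[OF bip_dzb[OF u], THEN bip_sqi]
    bip_cnj_coord_mult[OF bip_dz[OF v], THEN bip_sqi] bip_coord_mult[OF bip_dzb[OF v], THEN bip_sqi]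
  show "ip c (tz j k u) v = - ip c u (tzb j k v)"
    unfolding tz_def[abs_def] tzb_def[abs_def] by (simp add: ip_diff_left ip_diff_right s 1 mult.left_commute)
  show "ip c (tzb j k u) v = - ip c u (tz j k v)"
    unfolding tz_def[abs_def] tzb_def[abs_def] by (simp add: ip_diff_left ip_diff_right s 2 mult.left_commute)
qed

text \<open>The commutator of the two tangential fields is of first order, hence within reach of
  \<open>caccioppoli\<close>. For \<open>j = k\<close> the left side is 0, whereas the first-order
  terms need not cancel.\<close>

lemma tzb_tz:
  assumes u: "bip m u" and jk: "j \<noteq> k"
  shows "tzb j k (tz j k u) z = tz j k (tzb j k u) z - (z $ j * dz j u z + z $ k * dz k u z)
    + (cnj (z $ j) * dzb j u z + cnj (z $ k) * dzb k u z)"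
proof -
  note a = bip_dz[OF u] bip_dzb'[OF u]
  have 1: "dzb a (tz j k u) = (\<lambda>z. ((if a = k then dz j u z else 0) + cnj (z $ k) * dzb a (dz j u) z)
      - ((if a = j then dz k u z else 0) + cnj (z $ j) * dzb a (dz k u) z))" for a
    unfolding tz_def[abs_def] dz_bip_diff[OF bip_cnj_coord_mult[OF a(1)] bip_cnj_coord_mult[OF a(1)]]
      dz_cnj_coord_mult[OF a(1)] ..
  have 2: "dz a (tzb j k u) = (\<lambda>z. ((if a = k then dzb j u z else 0) + z $ k * dzb j (dz a u) z)
      - ((if a = j then dzb k u z else 0) + z $ j * dzb k (dz a u) z))" for a
    unfolding tzb_def[abs_def] dz_bip_diff[OF bip_coord_mult[OF a(2)] bip_coord_mult[OF a(2)]]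
      dz_coord_mult[OF a(2)] dz_commute[OF u] ..
  show ?thesis
    unfolding tzb_def[of j k "tz j k u"] tz_def[of j k "tzb j k u"] 1 2 using jk
    by (simp add: algebra_simps)
qed

text \<open>Two integrations by parts turn \<open>tz\<close> into \<open>tzb\<close>, but the fields
  do not commute. The first-order commutator is paired with \<open>u\<close> by splitting the weight
  \<open>b + 1\<close> into \<open>b\<close> for \<open>u\<close> and \<open>b + 2\<close> for the
  derivative, which \<open>C\<close> controls.\<close>

lemma tz_bound_of_tzb_bound:
  assumes u: "bip m u" and C: "C \<ge> 0" "\<And>j. nrm (b + 2) (dz j u) \<le> C * nrm b u" "\<And>j. nrm (b + 2) (dzb j u) \<le> C * nrm b u"
    and K: "K \<ge> 0" "nrm (b + 1) (tzb j k u) \<le> K * nrm b u"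
  shows "nrm (b + 1) (tz j k u) \<le> (K + 4 * C + 1) * nrm b u"
proof (cases "j = k")
  case True
  then have "tz j k u = (\<lambda>_. 0)" by (auto simp: tz_def)
  then show ?thesis using K C by simp
next
  case False
  let ?c = "b + 1" and ?V = "tzb j k u" and ?y = "nrm b u"
  have V: "bip m ?V" by (rule bip_mono[OF bip_tzb[OF u]]) simp
  have d: "bip (Suc m) (\<lambda>z. z $ l * dz l u z)" "bip (Suc m) (\<lambda>z. cnj (z $ l) * dzb l u z)" for l
    by (auto intro!: bip_coord_mult bip_cnj_coord_mult bip_dzb' bip_mono[OF bip_dz[OF u]] u)
  have "ip ?c (tz j k u) (tz j k u) = - ip ?c u (tzb j k (tz j k u))"
    by (rule ip_tz(1)[OF u bip_tz[OF u]]) simp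
  also have "tzb j k (tz j k u) = (\<lambda>z. tz j k ?V z - (z $ j * dz j u z + z $ k * dz k u z)
    + (cnj (z $ j) * dzb j u z + cnj (z $ k) * dzb k u z))"
    using tzb_tz[OF u False] by auto
  also have "ip ?c u \<dots> = ip ?c u (tz j k ?V) - (ip ?c u (\<lambda>z. z $ j * dz j u z) + ip ?c u (\<lambda>z. z $ k * dz k u z))
    + (ip ?c u (\<lambda>z. cnj (z $ j) * dzb j u z) + ip ?c u (\<lambda>z. cnj (z $ k) * dzb k u z))"
    using bip_tz[OF V, THEN bip_sqi] d[THEN bip_sqi] u[THEN bip_sqi] bip_add[OF d(1) d(1), THEN bip_sqi]
       bip_add[OF d(2) d(2), THEN bip_sqi] bip_diff[OF bip_tz[OF V] bip_add[OF d(1) d(1)], THEN bip_sqi]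
    by (simp add: ip_add_right ip_diff_right)
  also have "ip ?c u (tz j k ?V) = cnj (ip ?c (tz j k ?V) u)" by (simp add: ip_cnj)
  also have "ip ?c (tz j k ?V) u = - ip ?c ?V ?V" by (rule ip_tz(1)[OF V u]) simp
  finally have E: "complex_of_real ((nrm ?c (tz j k u))\<^sup>2) = complex_of_real ((nrm ?c ?V)\<^sup>2)
      + (ip ?c u (\<lambda>z. z $ j * dz j u z) + ip ?c u (\<lambda>z. z $ k * dz k u z))
    - (ip ?c u (\<lambda>z. cnj (z $ j) * dzb j u z) + ip ?c u (\<lambda>z. cnj (z $ k) * dzb k u z))"
    by (simp add: ip_self)
  have b1: "norm (ip ?c u (\<lambda>z. z $ l * dz l u z)) \<le> C * ?y\<^sup>2" for l
  proof -
    have "norm (ip ?c u (\<lambda>z. z $ l * dz l u z)) \<le> ?y * nrm (b + 2) (\<lambda>z. z $ l * dz l u z)"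
      by (intro ip_bound bip_sqi[OF u] bip_sqi[OF d(1)]) simp
    also have "\<dots> \<le> ?y * (C * ?y)"
      by (intro mult_left_mono order_trans[OF nrm_coord C(2)] bip_sqi[OF bip_dz[OF u]]) simp
    finally show ?thesis by (simp add: power2_eq_square algebra_simps)
  qed
  have b2: "norm (ip ?c u (\<lambda>z. cnj (z $ l) * dzb l u z)) \<le> C * ?y\<^sup>2" for l
  proof -
    have "norm (ip ?c u (\<lambda>z. cnj (z $ l) * dzb l u z)) \<le> ?y * nrm (b + 2) (\<lambda>z. cnj (z $ l) * dzb l u z)"
      by (intro ip_bound bip_sqi[OF u] bip_sqi[OF d(2)]) simp
    also have "\<dots> \<le> ?y * (C * ?y)"
      by (intro mult_left_mono order_trans[OF nrm_cnj_coord C(3)] bip_sqi[OF bip_dzb[OF u]]) simp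
    finally show ?thesis by (simp add: power2_eq_square algebra_simps)
  qed
  have "norm (complex_of_real ((nrm ?c (tz j k u))\<^sup>2)) \<le> norm (complex_of_real ((nrm ?c ?V)\<^sup>2))
      + (C * ?y\<^sup>2 + C * ?y\<^sup>2) + (C * ?y\<^sup>2 + C * ?y\<^sup>2)"
    unfolding E by (intro order_trans[OF norm_triangle_ineq4] add_mono order_trans[OF norm_triangle_ineq] b1 b2 order_refl)
  then have "(nrm ?c (tz j k u))\<^sup>2 \<le> (nrm ?c ?V)\<^sup>2 + 4 * C * ?y\<^sup>2" by (simp add: norm_power)
  also have "(nrm ?c ?V)\<^sup>2 \<le> (K * ?y)\<^sup>2" using K by (intro power_mono) auto
  finally have "(nrm ?c (tz j k u))\<^sup>2 \<le> (K\<^sup>2 + 4 * C) * ?y\<^sup>2" by (simp add: algebra_simps)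
  \<comment> \<open>Four commutator terms give \<open>K\<^sup>2 + 4 * C\<close>; the square of the
    linear constant dominates it and spares a root.\<close>
  also have "\<dots> \<le> (K + 4 * C + 1)\<^sup>2 * ?y\<^sup>2"
    using K C by (intro mult_right_mono) (auto simp: power2_eq_square algebra_simps)
  finally show ?thesis
    using K C by (intro power2_le_imp_le[OF _ mult_nonneg_nonneg]) (auto simp: power_mult_distrib)
qed

text \<open>The tangential fields annihilate the weight, so a tangential derivative costs only one power.\<close>

lemma caccioppoli_tangential:
  "\<exists>C\<ge>0. \<forall>u j k. bip m u \<longrightarrow> nrm (b + 1) (tz j k u) \<le> C * nrm b u \<and> nrm (b + 1) (tzb j k u) \<le> C * nrm b u"
proof (induction m arbitrary: b)
  case 0
  obtain C where C: "C \<ge> 0" "\<And>(u::complex^'a \<Rightarrow> complex) j. bip 0 u \<Longrightarrow> nrm (b + 2) (dz j u) \<le> C * nrm b u"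
    "\<And>(u::complex^'a \<Rightarrow> complex) j. bip 0 u \<Longrightarrow> nrm (b + 2) (dzb j u) \<le> C * nrm b u"
    using caccioppoli[of 0 b] by auto
  show ?case
  proof (intro exI[of _ "4 * C + 1"] conjI allI impI)
    fix u :: "complex^'a \<Rightarrow> complex" and j k assume u: "bip 0 u"
    have 0: "tzb j k u = (\<lambda>_. 0)" using dzb_bip0[OF u] by (auto simp: tzb_def)
    show "nrm (b + 1) (tz j k u) \<le> (4 * C + 1) * nrm b u"
      using tz_bound_of_tzb_bound[OF u C(1) C(2,3)[OF u], of 0 j k] by (simp add: 0)
    show "nrm (b + 1) (tzb j k u) \<le> (4 * C + 1) * nrm b u" using C(1) by (simp add: 0)
  qed (use C in auto)
next
  case (Suc m)
  obtain C where C: "C \<ge> 0" "\<And>(u::complex^'a \<Rightarrow> complex) j. bip (Suc m) u \<Longrightarrow> nrm (b + 2) (dz j u) \<le> C * nrm b u"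
    "\<And>(u::complex^'a \<Rightarrow> complex) j. bip (Suc m) u \<Longrightarrow> nrm (b + 2) (dzb j u) \<le> C * nrm b u"
    using caccioppoli[of "Suc m" b] by auto
  obtain K where K: "K \<ge> 0" "\<And>(u::complex^'a \<Rightarrow> complex) j k. bip m u \<Longrightarrow> nrm (b + 1 + 1) (tz j k u) \<le> K * nrm (b + 1) u"
    using Suc[of "b + 1"] by auto
  have *: "nrm (b + 1) (tzb j k u) \<le> K * nrm b u" if u: "bip (Suc m) u" for u :: "complex^'a \<Rightarrow> complex" and j k
  proof -
    let ?V = "tzb j k u"
    have V: "bip m ?V" using bip_tzb[OF u] by simp
    have "complex_of_real ((nrm (b + 1) ?V)\<^sup>2) = - ip (b + 1) u (tz j k ?V)"
      unfolding ip_self[symmetric] using ip_tz(2)[OF u V, of "b + 1" j k] by simp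
    then have "norm (complex_of_real ((nrm (b + 1) ?V)\<^sup>2)) = norm (ip (b + 1) u (tz j k ?V))" by simp
    then have "(nrm (b + 1) ?V)\<^sup>2 \<le> norm (ip (b + 1) u (tz j k ?V))" by (simp add: norm_power)
    also have "\<dots> \<le> nrm b u * nrm (b + 1 + 1) (tz j k ?V)"
      by (intro ip_bound bip_sqi[OF u] bip_sqi[OF bip_tz[OF V]]) auto
    also have "\<dots> \<le> nrm b u * (K * nrm (b + 1) ?V)" using K(2)[OF V] by (intro mult_left_mono) auto
    finally have "nrm (b + 1) ?V * nrm (b + 1) ?V \<le> (K * nrm b u) * nrm (b + 1) ?V"
      by (simp add: power2_eq_square algebra_simps)
    then show ?thesis
      using mult_right_le_imp_le[of "nrm (b + 1) ?V" "nrm (b + 1) ?V" "K * nrm b u"] K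
      by (cases "nrm (b + 1) ?V = 0") (auto simp: less_le)
  qed
  show ?case
  proof (intro exI[of _ "K + 4 * C + 1"] conjI allI impI)
    fix u :: "complex^'a \<Rightarrow> complex" and j k assume u: "bip (Suc m) u"
    show "nrm (b + 1) (tz j k u) \<le> (K + 4 * C + 1) * nrm b u"
      by (rule tz_bound_of_tzb_bound[OF u C(1) C(2,3)[OF u] K(1) *[OF u]])
    have "K * nrm b u \<le> (K + 4 * C + 1) * nrm b u" using C by (intro mult_right_mono) auto
    then show "nrm (b + 1) (tzb j k u) \<le> (K + 4 * C + 1) * nrm b u" using *[OF u, of j k] by linarith
  qed (use K C in auto)
qed

section \<open>The Euler field and Hardy inequalities\<close>

definition eul :: "(complex^'n::finite \<Rightarrow> complex) \<Rightarrow> complex^'n \<Rightarrow> complex" where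
  "eul u z = (\<Sum>k\<in>UNIV. z $ k * dz k u z)"

lemma bip_eul: assumes "bip m u" shows "bip m (eul u)"
proof -
  have "bip m (\<lambda>z. \<Sum>k\<in>UNIV. z $ k * dz k u z)"
    by (intro bip_sum bip_coord_mult bip_dz assms)
  then show ?thesis by (simp add: eul_def[abs_def])
qed

lemma eul_const [simp]: "eul (\<lambda>_. c) = (\<lambda>_. 0)"
  by (simp add: eul_def[abs_def])

lemma eul_add: "bip m u \<Longrightarrow> bip k v \<Longrightarrow> eul (\<lambda>z. u z + v z) = (\<lambda>z. eul u z + eul v z)"
  by (simp add: eul_def[abs_def] dz_bip_add distrib_left sum.distrib)

lemma eul_diff: "bip m u \<Longrightarrow> bip k v \<Longrightarrow> eul (\<lambda>z. u z - v z) = (\<lambda>z. eul u z - eul v z)"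
  by (simp add: eul_def[abs_def] dz_bip_diff right_diff_distrib sum_subtractf)

lemma eul_scale: "bip m u \<Longrightarrow> eul (\<lambda>z. c * u z) = (\<lambda>z. c * eul u z)"
  by (simp add: eul_def[abs_def] dz_bip_scale sum_distrib_left mult.left_commute)

lemma eul_mult: "bip m u \<Longrightarrow> bip k v \<Longrightarrow> eul (\<lambda>z. u z * v z) = (\<lambda>z. eul u z * v z + u z * eul v z)"
  by (simp add: eul_def[abs_def] dz_bip_mult distrib_left sum.distrib sum_distrib_left sum_distrib_right mult_ac)

lemma eul_sum: "(\<And>i. i \<in> I \<Longrightarrow> bip m (u i)) \<Longrightarrow> eul (\<lambda>z. \<Sum>i\<in>I. u i z) = (\<lambda>z. \<Sum>i\<in>I. eul (u i) z)"
proof (induction I rule: infinite_finite_induct)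
  case (insert i I)
  then show ?case by (simp add: eul_add[of m "u i" m "\<lambda>z. \<Sum>i\<in>I. u i z"] bip_sum)
qed auto

lemma dz_eul: assumes u: "bip m u" shows "dz j (eul u) = (\<lambda>z. dz j u z + eul (dz j u) z)"
proof -
  have "dz j (eul u) = (\<lambda>z. \<Sum>k\<in>UNIV. (if j = k then dz k u z else 0) + z $ k * dz k (dz j u) z)"
    unfolding eul_def[abs_def] dz_bip_sum[OF bip_coord_mult[OF bip_dz[OF u]]] dz_coord_mult[OF bip_dz[OF u]]
      dz_commute[OF u] ..
  then show ?thesis by (simp add: eul_def sum.distrib fun_eq_iff)
qed

lemma eul_coord_mult: "bip m u \<Longrightarrow> eul (\<lambda>z. z $ k * u z) = (\<lambda>z. z $ k * (u z + eul u z))"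
proof -
  assume u: "bip m u"
  have "eul (\<lambda>z. z $ k :: complex) = (\<lambda>z. z $ k)"
    by (simp add: eul_def fun_eq_iff dz_coord if_distrib cong: if_cong)
  then show ?thesis using eul_mult[OF bip_coord[of 0] u, of k] by (simp add: distrib_left)
qed

section \<open>Homogeneous components and inversion of the shifted Euler field\<close>

definition hom :: "nat \<Rightarrow> (complex^'n::finite \<Rightarrow> complex) \<Rightarrow> bool" where
  "hom i u \<longleftrightarrow> bip 0 u \<and> eul u = (\<lambda>z. of_nat i * u z)"

lemma hom_const: "hom 0 (\<lambda>_. c)" by (simp add: hom_def)

lemma hom_coord_mult: "hom i u \<Longrightarrow> hom (Suc i) (\<lambda>z. z $ k * u z)"
  unfolding hom_def using eul_coord_mult[of 0 u k] bip_coord_mult[of 0 u k]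
  by (auto simp: distrib_left distrib_right mult.left_commute)

lemma hom_zero: "hom i (\<lambda>_. 0)" by (simp add: hom_def)

lemma hom_add: "hom i u \<Longrightarrow> hom i v \<Longrightarrow> hom i (\<lambda>z. u z + v z)"
  unfolding hom_def by (auto simp: eul_add distrib_left)

lemma hom_scale: "hom i u \<Longrightarrow> hom i (\<lambda>z. c * u z)"
  unfolding hom_def by (auto simp: eul_scale bip_scale)

text \<open>Since homogeneity is encoded by the Euler identity, 0 has every degree. This allows
  padding with zeros, both in sums of different length and after a coordinate factor has shifted all
  degrees.\<close>

lemma hom_decomposition: "bip 0 F \<Longrightarrow> \<exists>N P. (\<forall>i. hom i (P i)) \<and> F = (\<lambda>z. \<Sum>i\<le>N. P i z)"
proof (induction "0::nat" F rule: bip.induct)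
  case (bip_const c)
  show ?case
    by (intro exI[of _ 0] exI[of _ "\<lambda>i. if i = 0 then (\<lambda>_. c) else (\<lambda>_. 0)"]) (auto simp: hom_const hom_zero)
next
  case (bip_coord_mult u k)
  then obtain N P where P: "\<forall>i. hom i (P i)" "u = (\<lambda>z. \<Sum>i\<le>N. P i z)" by auto
  define Q where "Q = (\<lambda>i z. if i = 0 then 0 else z $ k * P (i - 1) z)"
  have "hom i (Q i)" for i
    using hom_coord_mult[of "i - 1" "P (i - 1)" k] P(1) by (cases i) (auto simp: Q_def hom_zero)
  moreover have "(\<lambda>z. z $ k * u z) = (\<lambda>z. \<Sum>i\<le>Suc N. Q i z)"
    unfolding sum.atMost_Suc_shift by (simp add: Q_def P(2) sum_distrib_left)
  ultimately show ?case by blast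
next
  case (bip_add u v)
  then obtain N P M Q where P: "\<forall>i. hom i (P i)" "u = (\<lambda>z. \<Sum>i\<le>N. P i z)"
    and Q: "\<forall>i. hom i (Q i)" "v = (\<lambda>z. \<Sum>i\<le>M. Q i z)" by auto
  define S where "S = (\<lambda>i z. (if i \<le> N then P i z else 0) + (if i \<le> M then Q i z else 0))"
  have "hom i (S i)" for i
    unfolding S_def using P(1) Q(1)
    by (intro hom_add; cases "i \<le> N"; cases "i \<le> M") (auto simp: hom_zero)
  moreover have "(\<lambda>z. u z + v z) = (\<lambda>z. \<Sum>i\<le>max N M. S i z)"
  proof
    fix z
    have "(\<Sum>i\<le>max N M. (if i \<le> N then P i z else 0)) = (\<Sum>i\<le>N. P i z)"
      by (rule sum.mono_neutral_cong_right) auto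
    moreover have "(\<Sum>i\<le>max N M. (if i \<le> M then Q i z else 0)) = (\<Sum>i\<le>M. Q i z)"
      by (rule sum.mono_neutral_cong_right) auto
    ultimately show "u z + v z = (\<Sum>i\<le>max N M. S i z)" by (simp add: P Q S_def sum.distrib)
  qed
  ultimately show ?case by blast
qed

text \<open>On the component of degree \<open>i\<close> the operator is multiplication by
  \<open>i + \<kappa>\<close>, which is nonzero because \<open>\<kappa> > 0\<close>.\<close>

lemma eul_solve:
  assumes F: "bip 0 F" and k: "\<kappa> > (0::real)"
  shows "\<exists>\<phi>. bip 0 \<phi> \<and> (\<lambda>z. eul \<phi> z + of_real \<kappa> * \<phi> z) = F"
proof -
  obtain N P where P: "\<forall>i. hom i (P i)" "F = (\<lambda>z. \<Sum>i\<le>N. P i z)" using hom_decomposition[OF F] by auto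
  define \<phi> where "\<phi> = (\<lambda>z. \<Sum>i\<le>N. inverse (of_real (real i + \<kappa>)) * P i z)"
  have b: "bip 0 (\<lambda>z. inverse (of_real (real i + \<kappa>)) * P i z)" for i
    using P(1) by (auto intro: bip_scale simp: hom_def)
  have e: "eul \<phi> = (\<lambda>z. \<Sum>i\<le>N. inverse (of_real (real i + \<kappa>)) * (of_nat i * P i z))"
    unfolding \<phi>_def eul_sum[OF b] using P(1) eul_scale[of 0 "P _"] by (simp add: hom_def)
  have "eul \<phi> z + of_real \<kappa> * \<phi> z = F z" for z
  proof -
    have "eul \<phi> z + of_real \<kappa> * \<phi> z = (\<Sum>i\<le>N. inverse (of_real (real i + \<kappa>)) * (of_real (real i + \<kappa>) * P i z))"
      unfolding e by (simp add: \<phi>_def sum_distrib_left sum.distrib[symmetric] algebra_simps)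
    also have "\<dots> = F z"
    proof -
      have "complex_of_real (real i + \<kappa>) \<noteq> 0" for i
        using k by (simp only: of_real_eq_0_iff)
      then show ?thesis by (simp add: P(2) mult.assoc[symmetric] del: of_real_add)
    qed
    finally show ?thesis .
  qed
  moreover have "bip 0 \<phi>" unfolding \<phi>_def by (intro bip_sum b)
  ultimately show ?thesis by auto
qed

text \<open>The products \<open>z $ k * cnj (z $ k)\<close> add up to \<open>1 - wt z\<close>; this
  is how the Euler field produces differences of consecutive weights.\<close>

lemma sum_ip_coord:
  assumes u: "sqi u" and v: "sqi v"
  shows "(\<Sum>k\<in>UNIV. ip b (\<lambda>z. z $ k * u z) (\<lambda>z. z $ k * v z)) = ip b u v - ip (b + 1) u v"
proof -
  note i = sqi_integrable[OF u v] sqi_integrable[OF sqi_coord[OF u] sqi_coord[OF v]]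
  have "(\<Sum>k\<in>UNIV. ip b (\<lambda>z. z $ k * u z) (\<lambda>z. z $ k * v z)) =
      (LINT z|ball_measure. (\<Sum>k\<in>UNIV. complex_of_real (wt z) ^ b * (z $ k * u z * cnj (z $ k * v z))))"
    unfolding ip_def by (subst Bochner_Integration.integral_sum) (rule i, simp)
  also have "\<dots> = (LINT z|ball_measure. complex_of_real (wt z) ^ b * (u z * cnj (v z))
      - complex_of_real (wt z) ^ (b + 1) * (u z * cnj (v z)))"
  proof (rule Bochner_Integration.integral_cong)
    fix z :: "complex^'a"
    have "(\<Sum>k\<in>UNIV. complex_of_real (wt z) ^ b * (z $ k * u z * cnj (z $ k * v z)))
        = complex_of_real (wt z) ^ b * (u z * cnj (v z)) * (\<Sum>k\<in>UNIV. z $ k * cnj (z $ k))"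
      by (simp add: sum_distrib_left mult_ac)
    also have "(\<Sum>k\<in>UNIV. z $ k * cnj (z $ k)) = 1 - complex_of_real (wt z)" by (simp add: wt_complex)
    finally show "(\<Sum>k\<in>UNIV. complex_of_real (wt z) ^ b * (z $ k * u z * cnj (z $ k * v z)))
        = complex_of_real (wt z) ^ b * (u z * cnj (v z)) - complex_of_real (wt z) ^ (b + 1) * (u z * cnj (v z))"
      by (simp add: algebra_simps)
  qed simp
  also have "\<dots> = ip b u v - ip (b + 1) u v"
    unfolding ip_def by (rule Bochner_Integration.integral_diff[OF i(1) i(1)])
  finally show ?thesis .
qed

lemma ip_sum_left:
  assumes "\<And>i. i \<in> I \<Longrightarrow> bip m (u i)" "sqi v"
  shows "ip b (\<lambda>z. \<Sum>i\<in>I. u i z) v = (\<Sum>i\<in>I. ip b (u i) v)"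
  using assms(1)
proof (induction I rule: infinite_finite_induct)
  case (insert i I)
  then show ?case
    using ip_add_left[OF bip_sqi[of m "u i"] bip_sqi[OF bip_sum[of I m u]] assms(2), of b] by simp
qed (simp_all add: ip_def)

text \<open>Integration by parts is applied to \<open>dz k (z $ k * F)\<close>. As \<open>G\<close>
  is analytic, only the weight is differentiated, and the product rule accounts for the subtracted
  term.\<close>

lemma ip_coord_dz:
  assumes F: "bip 0 F" and G: "bip 0 G"
  shows "ip (b + 1) (\<lambda>z. z $ k * dz k F z) G =
      of_nat (b + 1) * ip b (\<lambda>z. z $ k * F z) (\<lambda>z. z $ k * G z) - ip (b + 1) F G"
proof -
  note s = F[THEN bip_sqi] G[THEN bip_sqi] bip_coord_mult[OF bip_dz[OF F], THEN bip_sqi]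
  have "ip (b + 1) (dz k (\<lambda>z. z $ k * F z)) G = of_nat (b + 1) * ip b (\<lambda>z. z $ k * F z) (\<lambda>z. z $ k * G z)"
    using ip_dz(1)[OF bip_coord_mult[OF F] G, of "b + 1" k k] dzb_bip0[OF G, of k] by (simp add: ip_def)
  moreover have "dz k (\<lambda>z. z $ k * F z) = (\<lambda>z. F z + z $ k * dz k F z)"
    using dz_coord_mult(1)[OF F, of k k] by simp
  ultimately have "ip (b + 1) F G + ip (b + 1) (\<lambda>z. z $ k * dz k F z) G = of_nat (b + 1) * ip b (\<lambda>z. z $ k * F z) (\<lambda>z. z $ k * G z)"
    using ip_add_left[OF s(1) s(3) s(2), of "b + 1" k k] by simp
  then show ?thesis by (simp add: algebra_simps)
qed

text \<open>The number of complex variables enters through the divergence of the field \<open>z\<close>.\<close>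

lemma ip_eul:
  fixes F G :: "complex^'n::finite \<Rightarrow> complex"
  assumes F: "bip 0 F" and G: "bip 0 G"
  shows "ip (b + 1) (eul F) G = of_nat (b + 1) * (ip b F G - ip (b + 1) F G) - of_nat CARD('n) * ip (b + 1) F G"
proof -
  have "ip (b + 1) (eul F) G = (\<Sum>k\<in>UNIV. ip (b + 1) (\<lambda>z. z $ k * dz k F z) G)"
    unfolding eul_def[abs_def] by (intro ip_sum_left[of _ 0] bip_coord_mult bip_dz F bip_sqi[OF G])
  also have "\<dots> = of_nat (b + 1) * (\<Sum>k\<in>UNIV. ip b (\<lambda>z. z $ k * F z) (\<lambda>z. z $ k * G z)) - of_nat CARD('n) * ip (b + 1) F G"
    unfolding ip_coord_dz[OF F G] by (simp add: sum_subtractf sum_distrib_left)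
  finally show ?thesis by (simp add: sum_ip_coord[OF bip_sqi[OF F] bip_sqi[OF G]])
qed

text \<open>By \<open>ip_eul\<close> at \<open>b = 0\<close> the Euler field turns weight 1 into
  weight 0, up to \<open>n + 1\<close> times the pairing at weight 1. The shift removes this
  remainder, which is the origin of \<open>n + 1\<close> in the formulas for adjoints.\<close>

lemma ip_eul_solve:
  fixes e G :: "complex^'n::finite \<Rightarrow> complex"
  assumes "bip 0 e" "bip 0 G"
  shows "ip 1 (\<lambda>z. eul e z + of_real (real CARD('n) + 1) * e z) G = ip 0 e G"
proof -
  have "ip 1 (\<lambda>z. eul e z + of_real (real CARD('n) + 1) * e z) G = ip 1 (eul e) G + of_real (real CARD('n) + 1) * ip 1 e G"
    using assms by (simp add: ip_add_left bip_sqi[OF bip_eul] bip_sqi[OF bip_scale] bip_sqi ip_scale_left del: of_real_add)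
  also have "ip 1 (eul e) G = (ip 0 e G - ip 1 e G) - of_nat CARD('n) * ip 1 e G"
    using ip_eul[OF assms, of 0] by simp
  finally show ?thesis by (simp add: algebra_simps)
qed

text \<open>Pairing \<open>(R + c) F\<close> with \<open>F\<close> at weight \<open>b + 1\<close>
  has real part \<open>(b + 1) * X\<^sup>2 + (c - n - b - 1) * Y\<^sup>2\<close>, with
  \<open>X\<close> and \<open>Y\<close> the norms of \<open>F\<close> at weights \<open>b\<close>
  and \<open>b + 1\<close>. As \<open>Y \<le> X\<close>, the minimum works for either sign of the
  second coefficient.\<close>

lemma hardy:
  fixes F :: "complex^'n::finite \<Rightarrow> complex"
  assumes F: "bip 0 F" and c: "c > real CARD('n)"
  shows "min (real (b + 1)) (c - real CARD('n)) * nrm b F \<le> nrm (b + 2) (\<lambda>z. eul F z + of_real c * F z)"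
proof -
  let ?n = "real CARD('n)" and ?X = "nrm b F" and ?Y = "nrm (b + 1) F"
  let ?G = "\<lambda>z. eul F z + of_real c * F z"
  have G: "bip 0 ?G" by (intro bip_add bip_eul bip_scale F)
  define \<mu> where "\<mu> = min (real (b + 1)) (c - ?n)"
  have "ip (b + 1) ?G F = ip (b + 1) (eul F) F + of_real c * ip (b + 1) F F"
    using ip_add_left[OF bip_sqi[OF bip_eul[OF F]] bip_sqi[OF bip_scale[OF F]] bip_sqi[OF F]]
    by (simp add: ip_scale_left)
  also have "\<dots> = of_real (real (b + 1) * (?X\<^sup>2 - ?Y\<^sup>2) - ?n * ?Y\<^sup>2 + c * ?Y\<^sup>2)"
    unfolding ip_eul[OF F F] ip_self by simp
  finally have "ip (b + 1) ?G F = of_real (real (b + 1) * (?X\<^sup>2 - ?Y\<^sup>2) - ?n * ?Y\<^sup>2 + c * ?Y\<^sup>2)" .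
  then have "Re (ip (b + 1) ?G F) = real (b + 1) * ?X\<^sup>2 + (c - ?n - real (b + 1)) * ?Y\<^sup>2"
    by (simp only: Re_complex_of_real) (simp add: algebra_simps)
  moreover have "Re (ip (b + 1) ?G F) \<le> nrm (b + 2) ?G * ?X"
    by (rule order_trans[OF complex_Re_le_cmod ip_bound[OF bip_sqi[OF G] bip_sqi[OF F]]]) simp
  moreover have "\<mu> * ?X\<^sup>2 \<le> real (b + 1) * ?X\<^sup>2 + (c - ?n - real (b + 1)) * ?Y\<^sup>2"
  proof (cases "c - ?n \<ge> real (b + 1)")
    case True
    then have "0 \<le> (c - ?n - real (b + 1)) * ?Y\<^sup>2" by (intro mult_nonneg_nonneg) auto
    moreover have "\<mu> = real (b + 1)" using True by (simp add: \<mu>_def)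
    ultimately show ?thesis by simp
  next
    case False
    have "?Y\<^sup>2 \<le> ?X\<^sup>2" using bip_sqi[OF F] by (intro power_mono nrm_antimono) auto
    then have "(c - ?n - real (b + 1)) * ?X\<^sup>2 \<le> (c - ?n - real (b + 1)) * ?Y\<^sup>2"
      using False by (intro mult_left_mono_neg) auto
    moreover have \<mu>: "\<mu> = c - ?n" using False by (simp add: \<mu>_def)
    ultimately show ?thesis unfolding \<mu> by (simp add: algebra_simps)
  qed
  ultimately have "(\<mu> * ?X) * ?X \<le> nrm (b + 2) ?G * ?X" by (simp add: power2_eq_square algebra_simps)
  then show ?thesis unfolding \<mu>_def[symmetric]
    by (cases "?X = 0") (auto dest!: mult_right_le_imp_le simp: less_le)
qed

text \<open>Both Caccioppoli inequalities are applied to \<open>u = cnj p * f\<close>: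
  \<open>dz\<close> and \<open>tz\<close> fall on \<open>f\<close>, \<open>dzb\<close> and
  \<open>tzb\<close> on \<open>p\<close>. The constant is uniform in \<open>f\<close> because
  \<open>m\<close> comes from \<open>cnj p\<close> alone.\<close>

lemma holomorphic_mult_bounds:
  assumes p: "bip 0 (p :: complex^'n::finite \<Rightarrow> complex)"
  shows "\<exists>C\<ge>0. \<forall>f j k. bip 0 f \<longrightarrow>
    nrm (b + 2) (\<lambda>z. f z * dz j p z) \<le> C * nrm b (\<lambda>z. p z * f z) \<and>
    nrm (b + 2) (\<lambda>z. p z * dz j f z) \<le> C * nrm b (\<lambda>z. p z * f z) \<and>
    nrm (b + 1) (\<lambda>z. f z * tz j k p z) \<le> C * nrm b (\<lambda>z. p z * f z) \<and>
    nrm (b + 1) (\<lambda>z. p z * tz j k f z) \<le> C * nrm b (\<lambda>z. p z * f z)"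
proof -
  obtain m where m: "bip m (\<lambda>z. cnj (p z))" using bip_cnj[OF p] by auto
  obtain C where C: "C \<ge> 0" "\<And>(u::complex^'n \<Rightarrow> complex) j. bip m u \<Longrightarrow> nrm (b + 2) (dz j u) \<le> C * nrm b u"
    "\<And>(u::complex^'n \<Rightarrow> complex) j. bip m u \<Longrightarrow> nrm (b + 2) (dzb j u) \<le> C * nrm b u"
    using caccioppoli[of m b] by auto
  obtain K where K: "K \<ge> 0" "\<And>(u::complex^'n \<Rightarrow> complex) j k. bip m u \<Longrightarrow> nrm (b + 1) (tz j k u) \<le> K * nrm b u"
    "\<And>(u::complex^'n \<Rightarrow> complex) j k. bip m u \<Longrightarrow> nrm (b + 1) (tzb j k u) \<le> K * nrm b u"
    using caccioppoli_tangential[of m b] by auto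
  show ?thesis
  proof (intro exI[of _ "C + K"] conjI allI impI)
    fix f :: "complex^'n \<Rightarrow> complex" and j k assume f: "bip 0 f"
    define u where "u = (\<lambda>z. cnj (p z) * f z)"
    have u: "bip m u" unfolding u_def using bip_mult[OF m f] by simp
    have eq: "nrm b u = nrm b (\<lambda>z. p z * f z)" unfolding u_def by (rule nrm_cong_norm) (simp add: norm_mult)
    have d: "dz j u = (\<lambda>z. cnj (p z) * dz j f z)" "dzb j u = (\<lambda>z. f z * cnj (dz j p z))" for j
      unfolding u_def dz_bip_mult[OF m f] dz_bip_cnj[OF p] by (auto simp: dzb_bip0[OF p] dzb_bip0[OF f])
    have up: "C * nrm b u \<le> (C + K) * nrm b u" "K * nrm b u \<le> (C + K) * nrm b u"
      using C K by (auto intro!: mult_right_mono)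
    have "nrm (b + 2) (\<lambda>z. f z * dz j p z) = nrm (b + 2) (dzb j u)"
      unfolding d by (rule nrm_cong_norm) (simp add: norm_mult)
    with C(3)[OF u, of j] up show "nrm (b + 2) (\<lambda>z. f z * dz j p z) \<le> (C + K) * nrm b (\<lambda>z. p z * f z)"
      unfolding eq by linarith
    have "nrm (b + 2) (\<lambda>z. p z * dz j f z) = nrm (b + 2) (dz j u)"
      unfolding d by (rule nrm_cong_norm) (simp add: norm_mult)
    with C(2)[OF u, of j] up show "nrm (b + 2) (\<lambda>z. p z * dz j f z) \<le> (C + K) * nrm b (\<lambda>z. p z * f z)"
      unfolding eq by linarith
    have "tzb j k u = (\<lambda>z. f z * cnj (tz j k p z))"
      unfolding tzb_def[abs_def] tz_def[abs_def] d by (simp add: algebra_simps)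
    then have "nrm (b + 1) (\<lambda>z. f z * tz j k p z) = nrm (b + 1) (tzb j k u)"
      by (intro nrm_cong_norm) (simp add: norm_mult)
    with K(3)[OF u, of j k] up show "nrm (b + 1) (\<lambda>z. f z * tz j k p z) \<le> (C + K) * nrm b (\<lambda>z. p z * f z)"
      unfolding eq by linarith
    have "tz j k u = (\<lambda>z. cnj (p z) * tz j k f z)"
      unfolding tz_def[abs_def] d by (simp add: algebra_simps)
    then have "nrm (b + 1) (\<lambda>z. p z * tz j k f z) = nrm (b + 1) (tz j k u)"
      by (intro nrm_cong_norm) (simp add: norm_mult)
    with K(2)[OF u, of j k] up show "nrm (b + 1) (\<lambda>z. p z * tz j k f z) \<le> (C + K) * nrm b (\<lambda>z. p z * f z)"
      unfolding eq by linarith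
  qed (use C K in auto)
qed

text \<open>Removing one homogeneous component of \<open>p\<close> at a time: if \<open>i\<close> is the degree of a component then
  \<open>(R + c - i) (p \<phi>) = p (R + c) \<phi> + ((R - i) p) \<phi>\<close>, where \<open>R\<close> is the Euler field.\<close>

lemma hardy_mult:
  fixes P :: "nat \<Rightarrow> complex^'n::finite \<Rightarrow> complex"
  assumes "finite I" "\<And>i. i \<in> I \<Longrightarrow> hom i (P i)" "\<And>i. i \<in> I \<Longrightarrow> c > real CARD('n) + real i"
    "p = (\<lambda>z. \<Sum>i\<in>I. P i z)"
  shows "\<exists>C\<ge>0. \<forall>\<phi>. bip 0 \<phi> \<longrightarrow>
    nrm b (\<lambda>z. p z * \<phi> z) \<le> C * nrm (b + 2) (\<lambda>z. p z * (eul \<phi> z + of_real c * \<phi> z))"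
  using assms
proof (induction I arbitrary: P b p rule: finite_induct)
  case empty
  then show ?case by (intro exI[of _ 0]) auto
next
  case (insert i I)
  let ?f = "\<lambda>\<phi> z. eul \<phi> z + complex_of_real c * \<phi> z"
  have P: "bip 0 (P l)" "eul (P l) = (\<lambda>z. of_nat l * P l z)" if "l \<in> insert i I" for l
    using insert.prems(1)[OF that] by (auto simp: hom_def)
  have p: "bip 0 p" unfolding insert.prems(3) by (intro bip_sum P)
  \<comment> \<open>The component of degree \<open>i\<close> cancels in \<open>(R - i) p\<close>,
    and the others are only rescaled, so the induction hypothesis for \<open>I\<close> applies to
    \<open>q\<close>.\<close>
  define q where "q = (\<lambda>z. eul p z - of_nat i * p z)"
  have "q = (\<lambda>z. \<Sum>l\<in>I. (of_nat l - of_nat i) * P l z)"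
  proof -
    have "eul p = (\<lambda>z. \<Sum>l\<in>insert i I. of_nat l * P l z)"
      unfolding insert.prems(3) by (subst eul_sum[of _ 0]) (use P in auto)
    then show ?thesis using insert.hyps
      by (auto simp: q_def insert.prems(3) fun_eq_iff sum_distrib_left sum_subtractf left_diff_distrib algebra_simps)
  qed
  moreover have "hom l (\<lambda>z. (of_nat l - of_nat i) * P l z)" if "l \<in> I" for l
    using insert.prems(1) that by (intro hom_scale) auto
  ultimately obtain C1 where C1: "C1 \<ge> 0" "\<And>\<phi>. bip 0 \<phi> \<Longrightarrow>
      nrm (b + 2) (\<lambda>z. q z * \<phi> z) \<le> C1 * nrm (b + 2 + 2) (\<lambda>z. q z * ?f \<phi> z)"
    using insert.IH[of "\<lambda>l z. (of_nat l - of_nat i) * P l z" q "b + 2"] insert.prems(2) by auto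
  obtain C2 where C2: "C2 \<ge> 0" "\<And>f j. bip 0 f \<Longrightarrow>
      nrm (b + 2 + 2) (\<lambda>z. f z * dz j p z) \<le> C2 * nrm (b + 2) (\<lambda>z. p z * f z)"
    using holomorphic_mult_bounds[OF p, of "b + 2"] by blast
  have q: "bip 0 q" unfolding q_def by (intro bip_diff bip_eul bip_scale p)
  \<comment> \<open>Replacing \<open>p\<close> by \<open>q\<close> costs two powers of the weight,
    as \<open>q\<close> is built from first derivatives of \<open>p\<close>; the induction
    hypothesis at weight \<open>b + 2\<close> has gained these two.\<close>
  define C3 where "C3 = real CARD('n) * C2 + real i"
  have C3: "nrm (b + 2 + 2) (\<lambda>z. q z * f z) \<le> C3 * nrm (b + 2) (\<lambda>z. p z * f z)" if f: "bip 0 f" for f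
  proof -
    have fp: "bip 0 (\<lambda>z. f z * dz j p z)" "bip 0 (\<lambda>z. p z * f z)" for j by (intro bip_mult0 bip_dz f p)+
    have "(\<lambda>z. q z * f z) = (\<lambda>z. (\<Sum>k\<in>UNIV. z $ k * (f z * dz k p z)) - of_nat i * (p z * f z))"
      by (simp add: q_def eul_def algebra_simps sum_distrib_left)
    then have "nrm (b + 2 + 2) (\<lambda>z. q z * f z) \<le> nrm (b + 2 + 2) (\<lambda>z. \<Sum>k\<in>UNIV. z $ k * (f z * dz k p z))
        + nrm (b + 2 + 2) (\<lambda>z. of_nat i * (p z * f z))"
      by (simp only:) (intro nrm_triangle_diff bip_sqi[of 0] bip_sum bip_coord_mult bip_scale fp)
    also have "\<dots> \<le> (\<Sum>k\<in>(UNIV::'n set). C2 * nrm (b + 2) (\<lambda>z. p z * f z)) + real i * nrm (b + 2) (\<lambda>z. p z * f z)"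
    proof (intro add_mono)
      show "nrm (b + 2 + 2) (\<lambda>z. \<Sum>k\<in>UNIV. z $ k * (f z * dz k p z)) \<le> (\<Sum>k\<in>(UNIV::'n set). C2 * nrm (b + 2) (\<lambda>z. p z * f z))"
        by (intro order_trans[OF nrm_sum[where m=0]] sum_mono order_trans[OF nrm_coord C2(2)] bip_sqi[of 0] bip_coord_mult fp f)
      show "nrm (b + 2 + 2) (\<lambda>z. of_nat i * (p z * f z)) \<le> real i * nrm (b + 2) (\<lambda>z. p z * f z)"
        unfolding nrm_scale norm_of_nat using bip_sqi[OF fp(2)] by (intro mult_left_mono nrm_antimono) auto
    qed
    finally show ?thesis by (simp add: C3_def algebra_simps)
  qed
  \<comment> \<open>The Hardy constant of \<open>p * \<phi>\<close> for the shift
    \<open>c - i\<close>, positive because \<open>c\<close> exceeds \<open>n + i\<close>.\<close>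
  define \<mu> where "\<mu> = min (real (b + 1)) (c - real i - real CARD('n))"
  have \<mu>: "\<mu> > 0" using insert.prems(2)[of i] by (simp add: \<mu>_def)
  have main: "\<mu> * nrm b (\<lambda>z. p z * \<phi> z) \<le> (1 + C1 * C3) * nrm (b + 2) (\<lambda>z. p z * ?f \<phi> z)" if \<phi>: "bip 0 \<phi>" for \<phi>
  proof -
    have f: "bip 0 (?f \<phi>)" by (intro bip_add bip_eul bip_scale \<phi>)
    have "\<mu> * nrm b (\<lambda>z. p z * \<phi> z) \<le> nrm (b + 2) (\<lambda>z. eul (\<lambda>z. p z * \<phi> z) z + of_real (c - real i) * (p z * \<phi> z))"
      unfolding \<mu>_def by (rule hardy[OF bip_mult0[OF p \<phi>]]) (use insert.prems(2)[of i] in simp)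
    also have "(\<lambda>z. eul (\<lambda>z. p z * \<phi> z) z + of_real (c - real i) * (p z * \<phi> z)) = (\<lambda>z. p z * ?f \<phi> z + q z * \<phi> z)"
      unfolding eul_mult[OF p \<phi>] q_def by (simp add: algebra_simps)
    also have "nrm (b + 2) \<dots> \<le> nrm (b + 2) (\<lambda>z. p z * ?f \<phi> z) + nrm (b + 2) (\<lambda>z. q z * \<phi> z)"
      by (intro nrm_triangle bip_sqi[of 0] bip_mult0 p q f \<phi>)
    also have "nrm (b + 2) (\<lambda>z. q z * \<phi> z) \<le> C1 * (C3 * nrm (b + 2) (\<lambda>z. p z * ?f \<phi> z))"
      using C1(2)[OF \<phi>] mult_left_mono[OF C3[OF f] C1(1)] by linarith
    finally show ?thesis by (simp add: algebra_simps)
  qed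
  show ?case
  proof (intro exI[of _ "(1 + C1 * C3) / \<mu>"] conjI allI impI)
    show "0 \<le> (1 + C1 * C3) / \<mu>" using C1 C2 \<mu> by (simp add: C3_def)
    fix \<phi> :: "complex^'n \<Rightarrow> complex" assume "bip 0 \<phi>"
    from main[OF this] \<mu> show "nrm b (\<lambda>z. p z * \<phi> z) \<le> (1 + C1 * C3) / \<mu> * nrm (b + 2) (\<lambda>z. p z * ?f \<phi> z)"
      by (simp add: field_simps)
  qed
qed

text \<open>The threshold depends on a degree bound for \<open>p\<close> but not on the weight, so
  that one \<open>c\<close> can serve several polynomials and weights at once.\<close>

lemma hardy_mult_large:
  assumes p: "bip 0 (p :: complex^'n::finite \<Rightarrow> complex)"
  shows "\<exists>c0. \<forall>c\<ge>c0. \<forall>b. \<exists>C\<ge>0. \<forall>\<phi>. bip 0 \<phi> \<longrightarrow>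
    nrm b (\<lambda>z. p z * \<phi> z) \<le> C * nrm (b + 2) (\<lambda>z. p z * (eul \<phi> z + of_real c * \<phi> z))"
proof -
  obtain N P where P: "\<forall>i. hom i (P i)" "p = (\<lambda>z. \<Sum>i\<le>N. P i z)" using hom_decomposition[OF p] by auto
  have "\<exists>C\<ge>0. \<forall>\<phi>. bip 0 \<phi> \<longrightarrow>
      nrm b (\<lambda>z. p z * \<phi> z) \<le> C * nrm (b + 2) (\<lambda>z. p z * (eul \<phi> z + of_real c * \<phi> z))"
    if "real CARD('n) + real N + 1 \<le> c" for c b
    by (intro hardy_mult[where I = "{..N}" and P = P]) (use P that in auto)
  then show ?thesis by blast
qed

lemma uniform_bound:
  fixes f g :: "'k::finite \<Rightarrow> 'x \<Rightarrow> real"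
  assumes "\<And>k. \<exists>C\<ge>0. \<forall>x. A x \<longrightarrow> f k x \<le> C * g k x" "\<And>k x. 0 \<le> g k x"
  shows "\<exists>C\<ge>0. \<forall>x k. A x \<longrightarrow> f k x \<le> C * g k x"
proof -
  obtain C where C: "\<And>k. C k \<ge> 0" "\<And>k x. A x \<Longrightarrow> f k x \<le> C k * g k x" using assms(1) by metis
  have "f k x \<le> sum C UNIV * g k x" if "A x" for k x
  proof -
    have "C k \<le> sum C UNIV" by (rule member_le_sum) (auto intro: C)
    then have "C k * g k x \<le> sum C UNIV * g k x" by (intro mult_right_mono assms)
    then show ?thesis using C(2)[OF that, of k] by linarith
  qed
  then show ?thesis using C(1) by (intro exI[of _ "sum C UNIV"]) (auto intro: sum_nonneg)
qed

section \<open>The commutator on polynomials\<close>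

text \<open>\<open>e\<close> is the adjoint of multiplication by \<open>z\<^sub>j\<close>, applied to \<open>p f\<close>. With \<open>f = (R + c) \<phi>\<close> the element
  \<open>p \<partial>\<^sub>j \<phi>\<close> of the submodule approximates it, and
  \<open>(R + n + 1) (e - p \<partial>\<^sub>j \<phi>) = (c - n) p \<partial>\<^sub>j \<phi> + f \<partial>\<^sub>j p - (R p) \<partial>\<^sub>j \<phi>\<close>.
  The antisymmetric part \<open>R \<phi> \<partial>\<^sub>j p - R p \<partial>\<^sub>j \<phi>\<close> only involves tangential derivatives, up to a factor \<open>1 - |z|\<^sup>2\<close>.\<close>

lemma adjoint_approximation:
  assumes p: "bip 0 (p :: complex^'n::finite \<Rightarrow> complex)"
  shows "\<exists>C\<ge>0. \<forall>f j. bip 0 f \<longrightarrow> (\<exists>g. bip 0 g \<and> (\<forall>e. bip 0 e \<longrightarrow>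
    (\<lambda>z. eul e z + of_real (real CARD('n) + 1) * e z) = dz j (\<lambda>z. p z * f z) \<longrightarrow>
    nrm 0 (\<lambda>z. e z - p z * g z) \<le> C * nrm 1 (\<lambda>z. p z * f z)))"
proof -
  let ?n = "real CARD('n)"
  define r where "r = eul p"
  have r: "bip 0 r" unfolding r_def by (rule bip_eul[OF p])
  note dp = bip_dz[OF p]
  obtain c0 where c0: "\<And>c b. c \<ge> c0 \<Longrightarrow> \<exists>C\<ge>0. \<forall>\<phi>. bip 0 \<phi> \<longrightarrow>
    nrm b (\<lambda>z. p z * \<phi> z) \<le> C * nrm (b + 2) (\<lambda>z. p z * (eul \<phi> z + of_real c * \<phi> z))"
    using hardy_mult_large[OF p] by blast
  have "\<exists>c. \<forall>k. \<forall>c'\<ge>c k. \<forall>b. \<exists>C\<ge>0. \<forall>\<phi>. bip 0 \<phi> \<longrightarrow>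
    nrm b (\<lambda>z. dz k p z * \<phi> z) \<le> C * nrm (b + 2) (\<lambda>z. dz k p z * (eul \<phi> z + of_real c' * \<phi> z))"
    by (intro choice allI hardy_mult_large dp)
  then obtain c1 where c1: "\<And>k c b. c \<ge> c1 k \<Longrightarrow> \<exists>C\<ge>0. \<forall>\<phi>. bip 0 \<phi> \<longrightarrow>
    nrm b (\<lambda>z. dz k p z * \<phi> z) \<le> C * nrm (b + 2) (\<lambda>z. dz k p z * (eul \<phi> z + of_real c * \<phi> z))"
    by blast
  \<comment> \<open>One shift above the thresholds of \<open>p\<close> and of every
    \<open>dz k p\<close>, and positive so that \<open>(R + c) \<phi> = f\<close> is
    solvable.\<close>
  define c where "c = \<bar>c0\<bar> + (\<Sum>k\<in>UNIV. \<bar>c1 k\<bar>) + 1"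
  have "0 \<le> (\<Sum>k\<in>UNIV. \<bar>c1 k\<bar>)" by (intro sum_nonneg) auto
  then have c: "c > 0" "c \<ge> c0" unfolding c_def by linarith+
  have c': "c \<ge> c1 k" for k
  proof -
    have "\<bar>c1 k\<bar> \<le> (\<Sum>k\<in>UNIV. \<bar>c1 k\<bar>)" by (rule member_le_sum) auto
    then show ?thesis unfolding c_def by linarith
  qed
  obtain H0 where H0: "H0 \<ge> 0" "\<And>\<phi>. bip 0 \<phi> \<Longrightarrow>
    nrm 0 (\<lambda>z. p z * \<phi> z) \<le> H0 * nrm 2 (\<lambda>z. p z * (eul \<phi> z + of_real c * \<phi> z))"
    using c0[OF c(2), of 0] by (auto simp: numeral_2_eq_2)
  have "\<exists>C\<ge>0. \<forall>\<phi> k. bip 0 \<phi> \<longrightarrow>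
    nrm 1 (\<lambda>z. dz k p z * \<phi> z) \<le> C * nrm 3 (\<lambda>z. dz k p z * (eul \<phi> z + of_real c * \<phi> z))"
    using c1[OF c', of 1] by (intro uniform_bound) (auto simp: numeral_3_eq_3)
  then obtain H1 where H1: "H1 \<ge> 0" "\<And>\<phi> k. bip 0 \<phi> \<Longrightarrow>
    nrm 1 (\<lambda>z. dz k p z * \<phi> z) \<le> H1 * nrm 3 (\<lambda>z. dz k p z * (eul \<phi> z + of_real c * \<phi> z))"
    by blast
  obtain C where C: "C \<ge> 0" "\<And>f j. bip 0 f \<Longrightarrow> nrm 3 (\<lambda>z. f z * dz j p z) \<le> C * nrm 1 (\<lambda>z. p z * f z)"
    "\<And>f j k. bip 0 f \<Longrightarrow> nrm 2 (\<lambda>z. f z * tz j k p z) \<le> C * nrm 1 (\<lambda>z. p z * f z)"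
    using holomorphic_mult_bounds[OF p, of 1] by (auto simp: numeral_3_eq_3 numeral_2_eq_2)
  obtain D where D: "D \<ge> 0" "\<And>f j. bip 0 f \<Longrightarrow> nrm 2 (\<lambda>z. p z * dz j f z) \<le> D * nrm 0 (\<lambda>z. p z * f z)"
    using holomorphic_mult_bounds[OF p, of 0] by (auto simp: numeral_2_eq_2)
  obtain E where E: "E \<ge> 0" "\<And>f j. bip 0 f \<Longrightarrow> nrm 3 (\<lambda>z. r z * dz j f z) \<le> E * nrm 1 (\<lambda>z. r z * f z)"
    "\<And>f j k. bip 0 f \<Longrightarrow> nrm 2 (\<lambda>z. r z * tz j k f z) \<le> E * nrm 1 (\<lambda>z. r z * f z)"
    using holomorphic_mult_bounds[OF r, of 1] by (auto simp: numeral_3_eq_3 numeral_2_eq_2)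
  \<comment> \<open>The three summands come from the bounds \<open>b1\<close>, \<open>b2\<close> and
    \<open>b9\<close> below, one for each term of the identity for
    \<open>(R + n + 1) (e - p * dz j \<phi>)\<close>.\<close>
  define T where "T = \<bar>c - ?n\<bar> * (D * H0) + c * (H1 * C) + ((C + c * (H1 * C) + E * (?n * (H1 * C)))
    + (?n * (C + c * (H1 * C + H1 * C)) + ?n * (E * (?n * (H1 * C)))))"
  have main: "nrm 0 (\<lambda>z. e z - p z * dz j \<phi> z) \<le> T * nrm 1 (\<lambda>z. p z * f z)"
    if \<phi>: "bip 0 \<phi>" and f: "f = (\<lambda>z. eul \<phi> z + of_real c * \<phi> z)" and e: "bip 0 e"
      "(\<lambda>z. eul e z + of_real (?n + 1) * e z) = dz j (\<lambda>z. p z * f z)" for \<phi> f e j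
  proof -
    define N where "N = nrm 1 (\<lambda>z. p z * f z)"
    have N: "N \<ge> 0" by (simp add: N_def)
    have bf: "bip 0 f" unfolding f by (intro bip_add bip_eul bip_scale \<phi>)
    note d\<phi> = bip_dz[OF \<phi>] and e\<phi> = bip_eul[OF \<phi>]
    have t: "bip 1 (\<lambda>z. u z * tz j k v z)" if "bip 0 u" "bip 0 v" for u v :: "complex^'n \<Rightarrow> complex" and j k
      using bip_mult0[OF that(1) bip_tz[OF that(2)]] by simp
    note bips = p r dp \<phi> bf d\<phi> e\<phi>
    have up: "nrm 2 u \<le> nrm 1 u" "nrm 4 u \<le> nrm 3 u" if "bip m u" for u :: "complex^'n \<Rightarrow> complex" and m
      using bip_sqi[OF that] by (auto intro: nrm_antimono)
    have b1: "nrm 2 (\<lambda>z. p z * dz j \<phi> z) \<le> D * H0 * N"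
    proof -
      have "nrm 2 (\<lambda>z. p z * dz j \<phi> z) \<le> D * nrm 0 (\<lambda>z. p z * \<phi> z)" by (rule D(2)[OF \<phi>])
      also have "\<dots> \<le> D * (H0 * nrm 2 (\<lambda>z. p z * f z))" unfolding f by (intro mult_left_mono D H0 \<phi>)
      also have "\<dots> \<le> D * (H0 * N)" unfolding N_def
        by (intro mult_left_mono D H0 up(1)[OF bip_mult0[OF p bf]])
      finally show ?thesis by simp
    qed
    \<comment> \<open>Hardy is used with \<open>dz k p\<close> in the role of \<open>p\<close>: the
      two powers that the derivative of \<open>p\<close> costs are regained by passing from
      \<open>f\<close> to \<open>\<phi>\<close>.\<close>
    have b2: "nrm 1 (\<lambda>z. \<phi> z * dz k p z) \<le> H1 * C * N" for k
    proof -
      have "nrm 1 (\<lambda>z. dz k p z * \<phi> z) \<le> H1 * nrm 3 (\<lambda>z. f z * dz k p z)"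
        using H1(2)[OF \<phi>, of k] unfolding f by (simp add: mult.commute)
      also have "\<dots> \<le> H1 * (C * N)" unfolding N_def by (intro mult_left_mono H1 C bf)
      finally show ?thesis by (simp add: mult_ac)
    qed
    have b3: "nrm 1 (\<lambda>z. r z * \<phi> z) \<le> ?n * (H1 * C) * N"
    proof -
      have "(\<lambda>z. r z * \<phi> z) = (\<lambda>z. \<Sum>k\<in>UNIV. z $ k * (\<phi> z * dz k p z))"
        by (simp add: r_def eul_def sum_distrib_left algebra_simps)
      then have "nrm 1 (\<lambda>z. r z * \<phi> z) \<le> (\<Sum>k\<in>UNIV. nrm 1 (\<lambda>z. z $ k * (\<phi> z * dz k p z)))"
        by (simp only:) (intro nrm_sum[of _ 0] bip_coord_mult bip_mult0 \<phi> dp)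
      also have "\<dots> \<le> (\<Sum>k\<in>(UNIV::'n set). H1 * C * N)"
        by (intro sum_mono order_trans[OF nrm_coord b2] bip_sqi[of 0] bip_mult0 \<phi> dp)
      finally show ?thesis by simp
    qed
    have b4: "nrm 3 (\<lambda>z. r z * dz j \<phi> z) \<le> E * (?n * (H1 * C)) * N"
      using E(2)[OF \<phi>, of j] mult_left_mono[OF b3 E(1)] by (simp add: mult_ac)
    have b5: "nrm 2 (\<lambda>z. r z * tz j k \<phi> z) \<le> E * (?n * (H1 * C)) * N" for k
      using E(3)[OF \<phi>, of j k] mult_left_mono[OF b3 E(1)] by (simp add: mult_ac)
    have b6: "nrm 2 (\<lambda>z. \<phi> z * tz j k p z) \<le> (H1 * C + H1 * C) * N" for k
    proof -
      have dd: "bip 0 (\<lambda>z. \<phi> z * dz l p z)" for l by (intro bip_mult0 \<phi> dp)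
      have "(\<lambda>z. \<phi> z * tz j k p z) = (\<lambda>z. cnj (z $ k) * (\<phi> z * dz j p z) - cnj (z $ j) * (\<phi> z * dz k p z))"
        by (simp add: tz_def algebra_simps)
      then have "nrm 2 (\<lambda>z. \<phi> z * tz j k p z) \<le> nrm 2 (\<lambda>z. cnj (z $ k) * (\<phi> z * dz j p z)) + nrm 2 (\<lambda>z. cnj (z $ j) * (\<phi> z * dz k p z))"
        by (simp only:) (intro nrm_triangle_diff bip_sqi[of "Suc 0"] bip_cnj_coord_mult dd)
      also have "\<dots> \<le> H1 * C * N + H1 * C * N"
        by (intro add_mono order_trans[OF nrm_cnj_coord order_trans[OF up(1)[OF dd] b2]] bip_sqi[OF dd])
      finally show ?thesis by (simp add: distrib_right)
    qed
    \<comment> \<open>\<open>eul \<phi>\<close> is replaced by \<open>f - c * \<phi>\<close>, so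
      that products with it reduce to bounds already at hand.\<close>
    have e\<phi>f: "(\<lambda>z. eul \<phi> z * u z) = (\<lambda>z. f z * u z - of_real c * (\<phi> z * u z))" for u
      by (simp add: f algebra_simps)
    have b7: "nrm 4 (\<lambda>z. eul \<phi> z * dz j p z) \<le> (C + c * (H1 * C)) * N"
    proof -
      have dd: "bip 0 (\<lambda>z. f z * dz j p z)" "bip 0 (\<lambda>z. \<phi> z * dz j p z)" by (intro bip_mult0 \<phi> dp bf)+
      have "nrm 4 (\<lambda>z. eul \<phi> z * dz j p z) \<le> nrm 4 (\<lambda>z. f z * dz j p z) + c * nrm 4 (\<lambda>z. \<phi> z * dz j p z)"
        unfolding e\<phi>f using nrm_triangle_diff[OF bip_sqi[OF dd(1)] bip_sqi[OF bip_scale[OF dd(2)]], of 4 "of_real c"] c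
        by (simp add: nrm_scale)
      also have "nrm 4 (\<lambda>z. f z * dz j p z) \<le> C * N"
        unfolding N_def by (rule order_trans[OF up(2)[OF dd(1)] C(2)[OF bf]])
      also have "nrm 4 (\<lambda>z. \<phi> z * dz j p z) \<le> nrm 1 (\<lambda>z. \<phi> z * dz j p z)"
        by (intro nrm_antimono bip_sqi[OF dd(2)]) simp
      also note b2
      finally show ?thesis using c by (simp add: algebra_simps)
    qed
    have b8: "nrm 2 (\<lambda>z. eul \<phi> z * tz j k p z) \<le> (C + c * (H1 * C + H1 * C)) * N" for k
    proof -
      note dd = t[OF bf p] t[OF \<phi> p]
      have "nrm 2 (\<lambda>z. eul \<phi> z * tz j k p z) \<le> nrm 2 (\<lambda>z. f z * tz j k p z) + c * nrm 2 (\<lambda>z. \<phi> z * tz j k p z)"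
        unfolding e\<phi>f using nrm_triangle_diff[OF bip_sqi[OF dd(1)] bip_sqi[OF bip_scale[OF dd(2)]], of 2 j k "of_real c" j k] c
        by (simp add: nrm_scale)
      also have "\<dots> \<le> C * N + c * ((H1 * C + H1 * C) * N)"
        unfolding N_def using c by (intro add_mono mult_left_mono C(3)[OF bf] b6[unfolded N_def]) auto
      finally show ?thesis by (simp add: algebra_simps)
    qed
    define X where "X = (\<lambda>z. eul \<phi> z * dz j p z - r z * dz j \<phi> z)"
    have bX: "bip 0 X" unfolding X_def by (intro bip_diff bip_mult0 e\<phi> dp r d\<phi>)
    have b9: "nrm 2 X \<le> ((C + c * (H1 * C) + E * (?n * (H1 * C)))
        + (?n * (C + c * (H1 * C + H1 * C)) + ?n * (E * (?n * (H1 * C))))) * N"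
    proof -
      let ?A = "\<lambda>z. \<Sum>k\<in>UNIV. z $ k * (eul \<phi> z * tz j k p z)"
      let ?B = "\<lambda>z. \<Sum>k\<in>UNIV. z $ k * (r z * tz j k \<phi> z)"
      \<comment> \<open>Tangential derivatives recover the full one, up to the factor
        \<open>1 - wt\<close> and the radial term \<open>cnj (z $ j) * eul u\<close>.\<close>
      have tsum: "(\<Sum>k\<in>UNIV. z $ k * tz j k u z) = (1 - of_real (wt z)) * dz j u z - cnj (z $ j) * eul u z" for u z
        unfolding wt_complex tz_def eul_def
        by (simp add: sum_subtractf sum_distrib_left sum_distrib_right algebra_simps)
      \<comment> \<open>The radial terms cancel by antisymmetry, so the tangential sums amount to
        \<open>(1 - wt) * X\<close>. The rest \<open>wt * X\<close> carries two extra powers of the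
        weight, for which the ordinary bounds suffice.\<close>
      have "X z = of_real (wt z) * X z + (?A z - ?B z)" for z
      proof -
        have AB: "?A z = eul \<phi> z * (\<Sum>k\<in>UNIV. z $ k * tz j k p z)" "?B z = r z * (\<Sum>k\<in>UNIV. z $ k * tz j k \<phi> z)"
          by (simp_all add: sum_distrib_left mult.left_commute)
        show ?thesis unfolding AB tsum X_def by (simp add: r_def algebra_simps)
      qed
      then have Xe: "X = (\<lambda>z. of_real (wt z) * X z + (?A z - ?B z))" by auto
      have bA: "bip 1 ?A" "bip 1 ?B" by (intro bip_sum bip_coord_mult t e\<phi> r p \<phi>)+
      have "nrm 2 X \<le> nrm 2 (\<lambda>z. of_real (wt z) * X z) + nrm 2 (\<lambda>z. ?A z - ?B z)"
        using nrm_triangle[OF bip_sqi[OF bip_mult[OF bip_wt bX]] bip_sqi[OF bip_diff[OF bA]], of 2]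
        unfolding Xe[symmetric] .
      also have "nrm 2 (\<lambda>z. of_real (wt z) * X z) \<le> (C + c * (H1 * C) + E * (?n * (H1 * C))) * N"
      proof -
        have "nrm 4 X \<le> nrm 4 (\<lambda>z. eul \<phi> z * dz j p z) + nrm 4 (\<lambda>z. r z * dz j \<phi> z)"
          unfolding X_def by (intro nrm_triangle_diff bip_sqi[of 0] bip_mult0 e\<phi> dp r d\<phi>)
        moreover have "nrm 4 (\<lambda>z. r z * dz j \<phi> z) \<le> E * (?n * (H1 * C)) * N"
          by (rule order_trans[OF up(2)[OF bip_mult0[OF r d\<phi>]] b4])
        ultimately have "nrm 4 X \<le> (C + c * (H1 * C) + E * (?n * (H1 * C))) * N"
          using b7 by (simp add: algebra_simps)
        then show ?thesis unfolding nrm_wt by simp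
      qed
      also have "nrm 2 (\<lambda>z. ?A z - ?B z) \<le> nrm 2 ?A + nrm 2 ?B"
        by (intro nrm_triangle_diff bip_sqi[OF bA(1)] bip_sqi[OF bA(2)])
      also have "nrm 2 ?A \<le> (\<Sum>k\<in>(UNIV::'n set). (C + c * (H1 * C + H1 * C)) * N)"
        by (intro order_trans[OF nrm_sum[where m=1]] sum_mono order_trans[OF nrm_coord b8] bip_sqi[of 1] bip_coord_mult t e\<phi> p)
      also have "nrm 2 ?B \<le> (\<Sum>k\<in>(UNIV::'n set). E * (?n * (H1 * C)) * N)"
        by (intro order_trans[OF nrm_sum[where m=1]] sum_mono order_trans[OF nrm_coord b5] bip_sqi[of 1] bip_coord_mult t r \<phi>)
      finally show ?thesis by (simp add: algebra_simps)
    qed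
    let ?d = "\<lambda>z. e z - p z * dz j \<phi> z"
    have bd: "bip 0 ?d" by (intro bip_diff e(1) bip_mult0 p d\<phi>)
    \<comment> \<open>At \<open>b = 0\<close> and \<open>c = n + 1\<close> the Hardy constant is
      \<open>min 1 1\<close>.\<close>
    have "nrm 0 ?d \<le> nrm 2 (\<lambda>z. eul ?d z + of_real (?n + 1) * ?d z)"
      using hardy[OF bd, of "?n + 1" 0] by (simp add: numeral_2_eq_2)
    also have "(\<lambda>z. eul ?d z + of_real (?n + 1) * ?d z) =
        (\<lambda>z. of_real (c - ?n) * (p z * dz j \<phi> z) + (of_real c * (\<phi> z * dz j p z) + X z))"
    proof
      fix z
      \<comment> \<open>The derivative \<open>dz j\<close> commutes with the Euler field up to
        \<open>dz j\<close> itself, so the second-order terms \<open>p * eul (dz j \<phi>)\<close>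
        cancel below.\<close>
      have "dz j f = (\<lambda>z. dz j \<phi> z + eul (dz j \<phi>) z + of_real c * dz j \<phi> z)"
        unfolding f dz_bip_add[OF e\<phi> bip_scale[OF \<phi>]] dz_bip_scale[OF \<phi>] dz_eul[OF \<phi>] ..
      then have e1: "eul e z + of_real (?n + 1) * e z = dz j p z * f z + p z * (dz j \<phi> z + eul (dz j \<phi>) z + of_real c * dz j \<phi> z)"
        using fun_cong[OF e(2), of z] dz_bip_mult(1)[OF p bf, of j] by simp
      have e2: "eul ?d z = eul e z - (r z * dz j \<phi> z + p z * eul (dz j \<phi>) z)"
        unfolding eul_diff[OF e(1) bip_mult0[OF p d\<phi>]] eul_mult[OF p d\<phi>] r_def ..
      have fz: "f z = eul \<phi> z + of_real c * \<phi> z" by (simp add: f)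
      have "eul ?d z + of_real (?n + 1) * ?d z = (eul e z + of_real (?n + 1) * e z)
          - (r z * dz j \<phi> z + p z * eul (dz j \<phi>) z) - of_real (?n + 1) * (p z * dz j \<phi> z)"
        unfolding e2 by (simp add: algebra_simps)
      also have "\<dots> = of_real (c - ?n) * (p z * dz j \<phi> z) + (of_real c * (\<phi> z * dz j p z) + X z)"
        unfolding e1 fz X_def by (simp add: algebra_simps)
      finally show "eul ?d z + of_real (?n + 1) * ?d z =
          of_real (c - ?n) * (p z * dz j \<phi> z) + (of_real c * (\<phi> z * dz j p z) + X z)" .
    qed
    also have "nrm 2 \<dots> \<le> nrm 2 (\<lambda>z. of_real (c - ?n) * (p z * dz j \<phi> z)) + (nrm 2 (\<lambda>z. of_real c * (\<phi> z * dz j p z)) + nrm 2 X)"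
      by (intro order_trans[OF nrm_triangle] add_mono order_refl nrm_triangle bip_sqi[of 0] bip_add bip_scale bip_mult0 p d\<phi> \<phi> dp bX)
    also have "\<dots> = \<bar>c - ?n\<bar> * nrm 2 (\<lambda>z. p z * dz j \<phi> z) + (c * nrm 2 (\<lambda>z. \<phi> z * dz j p z) + nrm 2 X)"
      unfolding nrm_scale using c by (simp del: of_real_diff)
    also have "\<dots> \<le> \<bar>c - ?n\<bar> * (D * H0 * N) + (c * (H1 * C * N) + ((C + c * (H1 * C) + E * (?n * (H1 * C)))
        + (?n * (C + c * (H1 * C + H1 * C)) + ?n * (E * (?n * (H1 * C))))) * N)"
      using c by (intro add_mono mult_left_mono b1 b9 order_trans[OF up(1)[OF bip_mult0[OF \<phi> dp]] b2]) auto
    also have "\<dots> = T * N" unfolding T_def by (simp add: algebra_simps)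
    finally show ?thesis unfolding N_def .
  qed
  have "T \<ge> 0" unfolding T_def using C D E H0 H1 c by (intro add_nonneg_nonneg mult_nonneg_nonneg) auto
  moreover have "\<exists>g. bip 0 g \<and> (\<forall>e. bip 0 e \<longrightarrow>
    (\<lambda>z. eul e z + of_real (?n + 1) * e z) = dz j (\<lambda>z. p z * f z) \<longrightarrow>
    nrm 0 (\<lambda>z. e z - p z * g z) \<le> T * nrm 1 (\<lambda>z. p z * f z))" if f: "bip 0 f" for f j
  proof -
    obtain \<phi> where \<phi>: "bip 0 \<phi>" "(\<lambda>z. eul \<phi> z + of_real c * \<phi> z) = f"
      using eul_solve[OF f c(1)] by blast
    show ?thesis
      by (intro exI[of _ "dz j \<phi>"] conjI allI impI bip_dz[OF \<phi>(1)]) (rule main[OF \<phi>(1) \<phi>(2)[symmetric]])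
  qed
  ultimately show ?thesis by (intro exI[of _ T] conjI allI impI)
qed

text \<open>This identifies \<open>e\<close> as the adjoint of multiplication by
  \<open>z $ j\<close> in the whole Bergman space, at \<open>F\<close>. Integration by parts at
  weight 1 produces \<open>dz j F\<close>, and \<open>ip_eul_solve\<close> passes to weight
  0.\<close>

lemma ip_coord_adjoint:
  fixes e F G :: "complex^'n::finite \<Rightarrow> complex"
  assumes e: "bip 0 e" "(\<lambda>z. eul e z + of_real (real CARD('n) + 1) * e z) = dz j F"
    and F: "bip 0 F" and G: "bip 0 G"
  shows "ip 0 (\<lambda>z. z $ j * G z) F = ip 0 G e"
proof -
  have "ip 1 (dz j F) G = ip 0 F (\<lambda>z. z $ j * G z)"
    using ip_dz(1)[OF F G, of 1 j] dzb_bip0[OF G, of j] by (simp add: ip_def)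
  moreover have "ip 1 (dz j F) G = ip 0 e G" using ip_eul_solve[OF e(1) G] e(2) by simp
  ultimately have "cnj (ip 0 F (\<lambda>z. z $ j * G z)) = cnj (ip 0 e G)" by simp
  then show ?thesis by (simp only: ip_cnj)
qed

text \<open>The difference is the form of the commutator on the whole Bergman space. With
  \<open>k\<close> the adjoint at \<open>z $ i * F\<close> it equals \<open>ip 0 Y G\<close>, which
  \<open>ip_eul_solve\<close> rewrites at weight 1, where Cauchy-Schwarz gives the product of two
  norms of weight 1.\<close>

lemma bergman_commutator_bound:
  "\<exists>C\<ge>0. \<forall>(F :: complex^'n::finite \<Rightarrow> complex) G e e' i j. bip 0 F \<longrightarrow> bip 0 G \<longrightarrow> bip 0 e \<longrightarrow> bip 0 e' \<longrightarrow>
    (\<lambda>z. eul e z + of_real (real CARD('n) + 1) * e z) = dz j F \<longrightarrow>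
    (\<lambda>z. eul e' z + of_real (real CARD('n) + 1) * e' z) = dz i G \<longrightarrow>
    norm (ip 0 e e' - ip 0 (\<lambda>z. z $ i * F z) (\<lambda>z. z $ j * G z)) \<le> C * nrm 1 F * nrm 1 G"
proof -
  let ?n = "real CARD('n)"
  obtain C where C: "C \<ge> 0" "\<And>(u::complex^'n \<Rightarrow> complex) j. bip 0 u \<Longrightarrow> nrm 3 (dz j u) \<le> C * nrm 1 u"
    using caccioppoli[of 0 1] by (auto simp: numeral_3_eq_3)
  have "norm (ip 0 e e' - ip 0 (\<lambda>z. z $ i * F z) (\<lambda>z. z $ j * G z)) \<le> (C + 1) * nrm 1 F * nrm 1 G"
    if b: "bip 0 F" "bip 0 G" "bip 0 e" "bip 0 e'" and e: "(\<lambda>z. eul e z + of_real (?n + 1) * e z) = dz j F"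
      and e': "(\<lambda>z. eul e' z + of_real (?n + 1) * e' z) = dz i G"
    for F G e e' :: "complex^'n \<Rightarrow> complex" and i j
  proof -
    obtain k where k: "bip 0 k" "(\<lambda>z. eul k z + of_real (?n + 1) * k z) = dz j (\<lambda>z. z $ i * F z)"
      using eul_solve[OF bip_dz[OF bip_coord_mult[OF b(1)]], of "?n + 1"] by auto
    define Y where "Y = (\<lambda>z. z $ i * e z - k z)"
    have Y: "bip 0 Y" unfolding Y_def by (intro bip_diff bip_coord_mult b k)
    have "ip 0 e e' = ip 0 (\<lambda>z. z $ i * e z) G" by (rule ip_coord_adjoint[OF b(4) e' b(2,3), symmetric])
    moreover have "ip 0 (\<lambda>z. z $ i * F z) (\<lambda>z. z $ j * G z) = ip 0 k G"
      using ip_coord_adjoint[OF k bip_coord_mult[OF b(1)] b(2)] by (metis ip_cnj)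
    ultimately have "ip 0 e e' - ip 0 (\<lambda>z. z $ i * F z) (\<lambda>z. z $ j * G z) = ip 0 Y G"
      unfolding Y_def by (simp add: ip_diff_left bip_sqi[OF bip_coord_mult[OF b(3)]] bip_sqi[OF k(1)] bip_sqi[OF b(2)])
    also have "\<dots> = ip 1 (\<lambda>z. eul Y z + of_real (?n + 1) * Y z) G" by (rule ip_eul_solve[OF Y b(2), symmetric])
    \<comment> \<open>The terms \<open>z $ i * dz j F\<close> from \<open>e\<close> and from
      \<open>k\<close> cancel, so no derivative of \<open>F\<close> is left.\<close>
    also have "(\<lambda>z. eul Y z + of_real (?n + 1) * Y z) = (\<lambda>z. z $ i * e z - (if j = i then F z else 0))"
    proof
      fix z
      have 1: "eul Y z = z $ i * (e z + eul e z) - eul k z"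
        unfolding Y_def eul_diff[OF bip_coord_mult[OF b(3)] k(1)] eul_coord_mult[OF b(3)] ..
      have "eul k z + of_real (?n + 1) * k z = (if j = i then F z else 0) + z $ i * dz j F z"
        using fun_cong[OF k(2), of z] unfolding dz_coord_mult[OF b(1)] .
      have "eul e z + of_real (?n + 1) * e z = dz j F z" using fun_cong[OF e, of z] .
      have Yz: "Y z = z $ i * e z - k z" by (simp add: Y_def)
      have "eul Y z + of_real (?n + 1) * Y z =
          z $ i * e z + z $ i * (eul e z + of_real (?n + 1) * e z) - (eul k z + of_real (?n + 1) * k z)"
        unfolding 1 Yz by (simp add: algebra_simps)
      then show "eul Y z + of_real (?n + 1) * Y z = z $ i * e z - (if j = i then F z else 0)"
        unfolding \<open>eul e z + of_real (?n + 1) * e z = dz j F z\<close>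
          \<open>eul k z + of_real (?n + 1) * k z = (if j = i then F z else 0) + z $ i * dz j F z\<close> by simp
    qed
    finally have eq: "ip 0 e e' - ip 0 (\<lambda>z. z $ i * F z) (\<lambda>z. z $ j * G z)
        = ip 1 (\<lambda>z. z $ i * e z - (if j = i then F z else 0)) G" .
    have bi: "bip 0 (\<lambda>z. if j = i then F z else 0)" using b(1) by (cases "j = i") auto
    have "nrm 1 (\<lambda>z. z $ i * e z - (if j = i then F z else 0)) \<le> nrm 1 (\<lambda>z. z $ i * e z) + nrm 1 (\<lambda>z. if j = i then F z else 0)"
      by (intro nrm_triangle_diff bip_sqi[OF bip_coord_mult[OF b(3)]] bip_sqi[OF bi])
    also have "nrm 1 (\<lambda>z. z $ i * e z) \<le> nrm 1 e" by (intro nrm_coord bip_sqi[OF b(3)])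
    \<comment> \<open>Hardy at \<open>b = 1\<close> with shift \<open>n + 1\<close> has constant
      \<open>min 2 1\<close>; it regains the two powers that \<open>dz j\<close> costs in the next
      step.\<close>
    also have "nrm 1 e \<le> nrm 3 (dz j F)"
      using hardy[OF b(3), of "?n + 1" 1] e by (simp add: numeral_3_eq_3)
    also have "\<dots> \<le> C * nrm 1 F" by (rule C(2)[OF b(1)])
    also have "nrm 1 (\<lambda>z. if j = i then F z else 0) \<le> nrm 1 F" by (cases "j = i") auto
    finally have "nrm 1 (\<lambda>z. z $ i * e z - (if j = i then F z else 0)) \<le> (C + 1) * nrm 1 F"
      by (simp add: algebra_simps)
    moreover have "norm (ip 1 (\<lambda>z. z $ i * e z - (if j = i then F z else 0)) G)
        \<le> nrm 1 (\<lambda>z. z $ i * e z - (if j = i then F z else 0)) * nrm 1 G"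
      by (intro ip_bound bip_sqi[OF bip_diff[OF bip_coord_mult[OF b(3)] bi]] bip_sqi[OF b(2)]) simp
    ultimately show ?thesis unfolding eq
      by (meson mult_right_mono nrm_nonneg order_trans)
  qed
  then show ?thesis using C(1) by (intro exI[of _ "C + 1"]) auto
qed

section \<open>Monomials\<close>

definition zpow :: "('n::finite \<Rightarrow>\<^sub>0 nat) \<Rightarrow> complex^'n \<Rightarrow> complex" where
  "zpow m z = (\<Prod>i\<in>UNIV. z $ i ^ Poly_Mapping.lookup m i)"

definition mdeg :: "('n::finite \<Rightarrow>\<^sub>0 nat) \<Rightarrow> nat" where
  "mdeg m = (\<Sum>i\<in>UNIV. Poly_Mapping.lookup m i)"

lemma eval_cpoly_zpow: "eval_cpoly p z = (\<Sum>m\<in>Poly_Mapping.keys p. Poly_Mapping.lookup p m * zpow m z)"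
  by (simp add: eval_cpoly_def zpow_def)

lemma zpow_add: "zpow (m + k) z = zpow m z * zpow k z"
  by (simp add: zpow_def lookup_add power_add prod.distrib)

lemma bip_zpow: "bip 0 (zpow m)"
proof -
  have "bip 0 (\<lambda>z. \<Prod>i\<in>UNIV. z $ i ^ Poly_Mapping.lookup m i)"
    by (intro bip_prod0 bip_power0) simp
  then show ?thesis by (simp add: zpow_def[abs_def])
qed

lemma bip_eval_cpoly: "bip 0 (eval_cpoly p)"
proof -
  have "bip 0 (\<lambda>z. \<Sum>m\<in>Poly_Mapping.keys p. Poly_Mapping.lookup p m * zpow m z)"
    by (intro bip_sum bip_scale bip_zpow)
  then show ?thesis by (simp add: eval_cpoly_zpow[abs_def])
qed

lemma eval_cpoly_superset:
  "finite S \<Longrightarrow> Poly_Mapping.keys p \<subseteq> S \<Longrightarrow> eval_cpoly p z = (\<Sum>m\<in>S. Poly_Mapping.lookup p m * zpow m z)"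
  unfolding eval_cpoly_zpow by (rule sum.mono_neutral_left) (auto simp: in_keys_iff)

lemma eval_cpoly_add: "eval_cpoly (p + q) z = eval_cpoly p z + eval_cpoly q z"
proof -
  let ?S = "Poly_Mapping.keys p \<union> Poly_Mapping.keys q"
  have "finite ?S" "Poly_Mapping.keys (p + q) \<subseteq> ?S" using Poly_Mapping.keys_add[of p q] by auto
  then show ?thesis
    by (simp add: eval_cpoly_superset[of ?S] lookup_add distrib_right sum.distrib)
qed

lemma eval_cpoly_single: "eval_cpoly (Poly_Mapping.single m c) z = c * zpow m z"
  using eval_cpoly_superset[of "{m}" "Poly_Mapping.single m c" z] by (simp split: if_splits)

lemma eval_cpoly_0 [simp]: "eval_cpoly 0 z = 0"
  by (simp add: eval_cpoly_zpow)

lemma eval_cpoly_sum: "eval_cpoly (\<Sum>i\<in>I. p i) z = (\<Sum>i\<in>I. eval_cpoly (p i) z)"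
  by (induction I rule: infinite_finite_induct) (auto simp: eval_cpoly_add)

lemma cpoly_sum_single: "p = (\<Sum>m\<in>Poly_Mapping.keys p. Poly_Mapping.single m (Poly_Mapping.lookup p m))"
  for p :: "'n::finite cpoly"
proof (rule poly_mapping_eqI)
  fix k
  show "Poly_Mapping.lookup p k = Poly_Mapping.lookup (\<Sum>m\<in>Poly_Mapping.keys p. Poly_Mapping.single m (Poly_Mapping.lookup p m)) k"
    by (simp add: lookup_sum lookup_single when_def in_keys_iff)
qed

lemma eval_cpoly_mult: "eval_cpoly (p * q) z = eval_cpoly p z * eval_cpoly q z"
proof -
  let ?s = "\<lambda>p m. Poly_Mapping.single m (Poly_Mapping.lookup p m)"
  have "p * q = (\<Sum>m\<in>Poly_Mapping.keys p. \<Sum>k\<in>Poly_Mapping.keys q. ?s p m * ?s q k)"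
    by (subst cpoly_sum_single[of p], subst cpoly_sum_single[of q]) (simp only: sum_product)
  also have "eval_cpoly \<dots> z = (\<Sum>m\<in>Poly_Mapping.keys p. \<Sum>k\<in>Poly_Mapping.keys q.
      (Poly_Mapping.lookup p m * zpow m z) * (Poly_Mapping.lookup q k * zpow k z))"
    by (simp add: eval_cpoly_sum mult_single eval_cpoly_single zpow_add mult_ac)
  also have "\<dots> = eval_cpoly p z * eval_cpoly q z"
    by (simp only: eval_cpoly_zpow sum_product)
  finally show ?thesis .
qed

lemma zpow_zero [simp]: "zpow 0 z = 1" by (simp add: zpow_def)

lemma zpow_single: "zpow (Poly_Mapping.single k 1) z = z $ k"
proof -
  have "zpow (Poly_Mapping.single k 1) z = (\<Prod>i\<in>UNIV. if i = k then z $ i else 1)"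
    unfolding zpow_def by (intro prod.cong) (auto simp: lookup_single when_def)
  then show ?thesis by simp
qed

lemma bip0_eval_cpoly: "bip 0 u \<Longrightarrow> \<exists>r. u = eval_cpoly r"
proof (induction "0::nat" u rule: bip.induct)
  case (bip_const c)
  show ?case by (intro exI[of _ "Poly_Mapping.single 0 c"]) (simp add: eval_cpoly_single fun_eq_iff)
next
  case (bip_coord_mult u k)
  then obtain r where "u = eval_cpoly r" by auto
  then show ?case
    by (intro exI[of _ "Poly_Mapping.single (Poly_Mapping.single k 1) 1 * r"])
       (simp add: fun_eq_iff eval_cpoly_mult eval_cpoly_single zpow_single[simplified])
next
  case (bip_add u v)
  then obtain r s where "u = eval_cpoly r" "v = eval_cpoly s" by auto
  then show ?case by (intro exI[of _ "r + s"]) (simp add: fun_eq_iff eval_cpoly_add)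
qed

lemma zpow_expansion:
  assumes "bip 0 u" obtains S c where "finite S" "u = (\<lambda>z. \<Sum>m\<in>S. c m * zpow m z)"
proof -
  obtain r where "u = eval_cpoly r" using bip0_eval_cpoly[OF assms] by blast
  then have "u = (\<lambda>z. \<Sum>m\<in>Poly_Mapping.keys r. Poly_Mapping.lookup r m * zpow m z)"
    by (simp add: eval_cpoly_zpow fun_eq_iff)
  then show ?thesis using that finite_keys by blast
qed

text \<open>With the factor \<open>z $ k\<close> the derivative is diagonal on monomials, and no
  exponent has to be lowered.\<close>

lemma coord_dz_zpow: "z $ k * dz k (zpow m) z = of_nat (Poly_Mapping.lookup m k) * zpow m z"
proof -
  have 1: "z $ k * dz k (\<lambda>z. z $ i ^ a) z = (if i = k then of_nat a * z $ i ^ a else 0)" for i a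
  proof (induction a)
    case (Suc a)
    have "dz k (\<lambda>z. z $ i ^ Suc a) z = (if k = i then z $ i ^ a else 0) + z $ i * dz k (\<lambda>z. z $ i ^ a) z"
      using dz_coord_mult(1)[OF bip_power0[OF bip_coord[of 0 i]], of k i a] by simp
    then have "z $ k * dz k (\<lambda>z. z $ i ^ Suc a) z = (if k = i then z $ k * z $ i ^ a else 0) + z $ i * (z $ k * dz k (\<lambda>z. z $ i ^ a) z)"
      by (simp add: distrib_left mult_ac)
    then show ?case unfolding Suc by (auto simp: algebra_simps)
  qed simp
  have b: "bip 0 (\<lambda>z. \<Prod>i\<in>I. z $ i ^ Poly_Mapping.lookup m i)" for I :: "'a set"
    by (intro bip_prod0 bip_power0) simp
  have "finite I \<Longrightarrow> z $ k * dz k (\<lambda>z. \<Prod>i\<in>I. z $ i ^ Poly_Mapping.lookup m i) z =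
     (if k \<in> I then of_nat (Poly_Mapping.lookup m k) * (\<Prod>i\<in>I. z $ i ^ Poly_Mapping.lookup m i) else 0)" for I
  proof (induction I rule: finite_induct)
    case (insert i I)
    have "z $ k * dz k (\<lambda>z. \<Prod>i\<in>insert i I. z $ i ^ Poly_Mapping.lookup m i) z =
      (z $ k * dz k (\<lambda>z. z $ i ^ Poly_Mapping.lookup m i) z) * (\<Prod>i\<in>I. z $ i ^ Poly_Mapping.lookup m i)
       + z $ i ^ Poly_Mapping.lookup m i * (z $ k * dz k (\<lambda>z. \<Prod>i\<in>I. z $ i ^ Poly_Mapping.lookup m i) z)"
      using insert.hyps dz_bip_mult(1)[OF bip_power0[OF bip_coord[of 0 i]] b, of k "Poly_Mapping.lookup m i" I]
      by (simp add: algebra_simps)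
    then show ?case unfolding 1 insert.IH using insert.hyps by auto
  qed simp
  from this[of UNIV] show ?thesis by (simp add: zpow_def[abs_def])
qed

lemma eul_zpow: "eul (zpow m) = (\<lambda>z. of_nat (mdeg m) * zpow m z)"
  by (simp add: eul_def[abs_def] coord_dz_zpow mdeg_def sum_distrib_right)

text \<open>By \<open>ip_coord_dz\<close> the operator \<open>z $ k * dz k\<close> is symmetric at
  positive weight. Monomials are eigenvectors of it, and \<open>k\<close> is chosen such that the
  two eigenvalues differ.\<close>

lemma ip_zpow_orthogonal_Suc:
  assumes "m \<noteq> m'" shows "ip (b + 1) (zpow m) (zpow m') = 0"
proof -
  obtain k where k: "Poly_Mapping.lookup m k \<noteq> Poly_Mapping.lookup m' k"
    using assms by (metis poly_mapping_eqI)
  define J where "J = ip (b + 1) (zpow m) (zpow m')"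
  define L where "L = of_nat (b + 1) * ip b (\<lambda>z. z $ k * zpow m z) (\<lambda>z. z $ k * zpow m' z)"
  have 1: "of_nat (Poly_Mapping.lookup m k) * J = L - J"
    using ip_coord_dz[OF bip_zpow bip_zpow, of b k m m'] by (simp add: coord_dz_zpow ip_scale_left J_def L_def)
  have "of_nat (Poly_Mapping.lookup m' k) * cnj J = cnj L - cnj J"
    using ip_coord_dz[OF bip_zpow bip_zpow, of b k m' m] by (simp add: coord_dz_zpow ip_scale_left J_def L_def ip_cnj)
  then have "cnj (of_nat (Poly_Mapping.lookup m' k) * cnj J) = cnj (cnj L - cnj J)" by (rule arg_cong)
  then have "of_nat (Poly_Mapping.lookup m' k) * J = L - J" by simp
  with 1 have "of_nat (Poly_Mapping.lookup m k) * J = of_nat (Poly_Mapping.lookup m' k) * J" by simp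
  then show ?thesis using k by (simp add: J_def)
qed

text \<open>The Euler field acts by the degree, so \<open>ip_eul_solve\<close> becomes a scalar
  relation. It is the source of the gain \<open>1 / (d + 1)\<close>, and it reduces orthogonality at
  weight 0 to weight 1.\<close>

lemma ip_zpow0: "ip 0 (zpow m) G = of_real (real (mdeg m) + real CARD('n) + 1) * ip 1 (zpow m) G"
  if "bip 0 G" for m :: "'n::finite \<Rightarrow>\<^sub>0 nat"
proof -
  have "ip 0 (zpow m) G = ip 1 (\<lambda>z. (of_real (real (mdeg m) + real CARD('n) + 1)) * zpow m z) G"
    unfolding ip_eul_solve[OF bip_zpow that, symmetric] eul_zpow by (simp add: algebra_simps)
  then show ?thesis by (simp only: ip_scale_left)
qed

lemma ip_zpow_orthogonal: "m \<noteq> m' \<Longrightarrow> ip b (zpow m) (zpow m') = 0"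
  using ip_zpow_orthogonal_Suc[of m m' "b - 1"] ip_zpow_orthogonal_Suc[of m m' 0] ip_zpow0[of "zpow m'" m]
  by (cases b) (auto simp: bip_zpow)

lemma ip_sum_right:
  assumes "\<And>i. i \<in> I \<Longrightarrow> bip m (u i)" "sqi v"
  shows "ip b v (\<lambda>z. \<Sum>i\<in>I. u i z) = (\<Sum>i\<in>I. ip b v (u i))"
  using ip_sum_left[of I m u v b] assms
  by (subst ip_cnj[symmetric]) (simp add: cnj_sum ip_cnj)

lemma ip_zpow_sums:
  assumes "finite S" "finite T"
  shows "ip b (\<lambda>z. \<Sum>m\<in>S. c m * zpow m z) (\<lambda>z. \<Sum>m\<in>T. d m * zpow m z) =
    (\<Sum>m\<in>S \<inter> T. c m * cnj (d m) * of_real ((nrm b (zpow m))\<^sup>2))"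
proof -
  have bs: "bip 0 (\<lambda>z. c m * zpow m z)" for c :: "_ \<Rightarrow> complex" and m :: "'a \<Rightarrow>\<^sub>0 nat" by (intro bip_scale bip_zpow)
  have "ip b (\<lambda>z. \<Sum>m\<in>S. c m * zpow m z) (\<lambda>z. \<Sum>m\<in>T. d m * zpow m z) =
    (\<Sum>m\<in>S. ip b (\<lambda>z. c m * zpow m z) (\<lambda>z. \<Sum>m\<in>T. d m * zpow m z))"
    by (rule ip_sum_left[OF bs bip_sqi[OF bip_sum[OF bs]]])
  also have "\<dots> = (\<Sum>m\<in>S. \<Sum>k\<in>T. ip b (\<lambda>z. c m * zpow m z) (\<lambda>z. d k * zpow k z))"
    by (intro sum.cong refl ip_sum_right[OF bs bip_sqi[OF bs]])
  also have "\<dots> = (\<Sum>m\<in>S. \<Sum>k\<in>T. c m * (cnj (d k) * ip b (zpow m) (zpow k)))"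
    by (simp only: ip_scale_left ip_scale_right)
  also have "\<dots> = (\<Sum>m\<in>S. \<Sum>k\<in>T. if m = k then c m * cnj (d m) * of_real ((nrm b (zpow m))\<^sup>2) else 0)"
    by (intro sum.cong refl) (auto simp: ip_zpow_orthogonal ip_self)
  also have "\<dots> = (\<Sum>m\<in>S. if m \<in> T then c m * cnj (d m) * of_real ((nrm b (zpow m))\<^sup>2) else 0)"
    using assms(2) by simp
  also have "\<dots> = (\<Sum>m\<in>S \<inter> T. c m * cnj (d m) * of_real ((nrm b (zpow m))\<^sup>2))"
    by (rule sum.inter_restrict[OF assms(1), symmetric])
  finally show ?thesis .
qed

lemma nrm_zpow_sum:
  assumes "finite S"
  shows "(nrm b (\<lambda>z. \<Sum>m\<in>S. c m * zpow m z))\<^sup>2 = (\<Sum>m\<in>S. (norm (c m))\<^sup>2 * (nrm b (zpow m))\<^sup>2)"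
proof -
  have "complex_of_real ((nrm b (\<lambda>z. \<Sum>m\<in>S. c m * zpow m z))\<^sup>2) = of_real (\<Sum>m\<in>S. (norm (c m))\<^sup>2 * (nrm b (zpow m))\<^sup>2)"
    using ip_zpow_sums[OF assms assms, of b c c] unfolding ip_self by (simp flip: complex_norm_square)
  then show ?thesis by (simp only: of_real_eq_iff)
qed

lemma nrm_zpow01: "(nrm 0 (zpow m))\<^sup>2 = (real (mdeg m) + real CARD('n) + 1) * (nrm 1 (zpow m))\<^sup>2"
  for m :: "'n::finite \<Rightarrow>\<^sub>0 nat"
  using ip_zpow0[OF bip_zpow, of m m] unfolding ip_self
  by (simp only: of_real_mult[symmetric] of_real_eq_iff)

text \<open>Both norms are diagonal in the monomials, so the ratio in \<open>nrm_zpow01\<close> can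
  be used term by term.\<close>

lemma nrm_high_degree:
  fixes S :: "('n::finite \<Rightarrow>\<^sub>0 nat) set"
  assumes "finite S" "\<And>m. m \<in> S \<Longrightarrow> d \<le> mdeg m"
  shows "(real d + 1) * (nrm 1 (\<lambda>z. \<Sum>m\<in>S. c m * zpow m z))\<^sup>2 \<le> (nrm 0 (\<lambda>z. \<Sum>m\<in>S. c m * zpow m z))\<^sup>2"
proof -
  have "(real d + 1) * (nrm 1 (\<lambda>z. \<Sum>m\<in>S. c m * zpow m z))\<^sup>2 = (\<Sum>m\<in>S. (norm (c m))\<^sup>2 * ((real d + 1) * (nrm 1 (zpow m))\<^sup>2))"
    unfolding nrm_zpow_sum[OF assms(1)] by (simp add: sum_distrib_left mult_ac)
  also have "\<dots> \<le> (\<Sum>m\<in>S. (norm (c m))\<^sup>2 * (nrm 0 (zpow m))\<^sup>2)"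
  proof (intro sum_mono mult_left_mono)
    fix m assume "m \<in> S"
    then have "real d + 1 \<le> real (mdeg m) + real CARD('n) + 1" using assms(2)[of m] by simp
    then show "(real d + 1) * (nrm 1 (zpow m))\<^sup>2 \<le> (nrm 0 (zpow m))\<^sup>2"
      unfolding nrm_zpow01 by (intro mult_right_mono) auto
  qed simp
  finally show ?thesis unfolding nrm_zpow_sum[OF assms(1)] .
qed

lemma card_mdeg_less: "finite {m :: 'n::finite \<Rightarrow>\<^sub>0 nat. mdeg m < d} \<and> card {m :: 'n \<Rightarrow>\<^sub>0 nat. mdeg m < d} \<le> d ^ CARD('n)"
proof -
  let ?A = "{m :: 'n \<Rightarrow>\<^sub>0 nat. mdeg m < d}" and ?B = "PiE (UNIV :: 'n set) (\<lambda>_. {..<d})"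
  have i: "inj_on Poly_Mapping.lookup ?A" by (auto intro: inj_onI poly_mapping_eqI)
  have "Poly_Mapping.lookup m i < d" if "mdeg m < d" for m :: "'n \<Rightarrow>\<^sub>0 nat" and i
    using that member_le_sum[of i UNIV "Poly_Mapping.lookup m"] by (simp add: mdeg_def)
  then have s: "Poly_Mapping.lookup ` ?A \<subseteq> ?B" by (auto simp: PiE_def)
  have f: "finite ?B" by (intro finite_PiE) auto
  have "card ?A \<le> card ?B" by (rule card_inj_on_le[OF i s f])
  then show ?thesis using inj_on_finite[OF i s f] by (simp add: card_PiE)
qed

lemma nrm_one: "nrm 0 (\<lambda>_::complex^'n::finite. 1) = 1"
  by (simp add: nrm_def measure_def prob_space_ball_measure)

lemma zpow_at_0: "m \<noteq> 0 \<Longrightarrow> zpow m 0 = 0"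
  unfolding zpow_def by (subst prod_zero_iff) (auto intro: poly_mapping_eqI)

text \<open>The mean value property: the nonconstant monomials are orthogonal to 1, and they vanish
  at 0.\<close>

lemma ip_one:
  fixes u :: "complex^'n::finite \<Rightarrow> complex"
  assumes "bip 0 u" shows "ip b u (\<lambda>_. 1) = u 0 * ip b (\<lambda>_::complex^'n. 1) (\<lambda>_. 1)"
proof -
  obtain S c where S: "finite S" "u = (\<lambda>z. \<Sum>m\<in>S. c m * zpow m z)" using zpow_expansion[OF assms] .
  have m0: "zpow 0 = (\<lambda>_. 1)" by auto
  have "ip b u (\<lambda>_. 1) = (\<Sum>m\<in>S \<inter> {0}. c m * of_real ((nrm b (zpow m))\<^sup>2))"
    using ip_zpow_sums[OF S(1), of "{0}" b c "\<lambda>_. 1"] by (simp add: S(2) m0)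
  also have "\<dots> = (\<Sum>m\<in>S \<inter> {0}. c m) * ip b (\<lambda>_::complex^'n. 1) (\<lambda>_. 1)"
    by (cases "0 \<in> S") (auto simp: ip_self m0)
  also have "(\<Sum>m\<in>S \<inter> {0}. c m) = u 0"
    unfolding S(2) sum.inter_restrict[OF S(1)] by (intro sum.cong) (auto simp: zpow_at_0)
  finally show ?thesis .
qed

section \<open>Polynomials in the Bergman space\<close>

definition restr :: "(complex^'n::finite \<Rightarrow> complex) \<Rightarrow> complex^'n \<Rightarrow> complex" where
  "restr u z = (if z \<in> ball 0 1 then u z else 0)"

text \<open>Takes functions where \<open>bergman_of_cpoly\<close> takes formal polynomials, so that
  \<open>dz\<close> and \<open>eul\<close> can be applied to the argument. \<open>Rep_polb\<close>
  describes it for \<open>bip 0\<close>.\<close>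

definition polb :: "(complex^'n::finite \<Rightarrow> complex) \<Rightarrow> 'n bergman" where
  "polb u = Abs_bergman (restr u)"

lemma polb_eval_cpoly: "polb (eval_cpoly r) = bergman_of_cpoly r"
proof -
  have "restr (eval_cpoly r) = Rep_bergman (bergman_of_cpoly r)"
    by (simp add: restr_def[abs_def] bergman_of_cpoly.rep_eq)
  then show ?thesis by (simp add: polb_def Rep_bergman_inverse)
qed

lemma Rep_polb: assumes "bip 0 u" shows "Rep_bergman (polb u) = restr u"
proof -
  obtain r where "u = eval_cpoly r" using bip0_eval_cpoly[OF assms] by blast
  then show ?thesis by (simp add: polb_eval_cpoly restr_def[abs_def] bergman_of_cpoly.rep_eq)
qed

lemma range_bergman_of_cpoly: "range (\<lambda>r. bergman_of_cpoly (p * r)) = (\<lambda>f. polb (\<lambda>z. eval_cpoly p z * f z)) ` {f. bip 0 f}"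
proof -
  have 1: "bergman_of_cpoly (p * r) = polb (\<lambda>z. eval_cpoly p z * eval_cpoly r z)" for r
    by (simp add: polb_eval_cpoly[symmetric] eval_cpoly_mult[abs_def])
  have 2: "{f. bip 0 f} = range (eval_cpoly :: 'a cpoly \<Rightarrow> _)"
    using bip0_eval_cpoly bip_eval_cpoly by (auto simp: image_iff)
  show ?thesis unfolding 1 2 image_image ..
qed

lemma cinner_ip: "cinner F G = ip 0 (Rep_bergman F) (Rep_bergman G)"
  by (simp add: cinner.rep_eq ip_def)

lemma norm_nrm: "norm F = nrm 0 (Rep_bergman F)"
  by (simp add: norm_bergman_def inner_bergman_def cinner_self nrm_def)

lemma nrm_restr: "nrm b (restr u) = nrm b u" 
  if "u \<in> borel_measurable borel"
proof -
  note [measurable] = that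
  have "(LINT z|ball_measure. wt z ^ b * (norm (restr u z))\<^sup>2) = (LINT z|ball_measure. wt z ^ b * (norm (u z))\<^sup>2)"
    by (intro integral_cong_AE eventually_mono[OF AE_ball]) (auto simp: restr_def)
  then show ?thesis by (simp add: nrm_def)
qed

lemma ip_restr: "ip b (restr u) (restr v) = ip b u v"
  if "u \<in> borel_measurable borel" "v \<in> borel_measurable borel"
proof -
  note [measurable] = that
  have [measurable]: "cnj \<in> borel_measurable borel"
    by (intro borel_measurable_continuous_onI continuous_intros)
  show ?thesis unfolding ip_def
    by (intro integral_cong_AE eventually_mono[OF AE_ball]) (auto simp: restr_def)
qed

lemma cinner_polb: "bip 0 u \<Longrightarrow> bip 0 v \<Longrightarrow> cinner (polb u) (polb v) = ip 0 u v"
  by (simp add: cinner_ip Rep_polb ip_restr bip_measurable)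

lemma norm_polb: "bip 0 u \<Longrightarrow> norm (polb u) = nrm 0 u"
  by (simp add: norm_nrm Rep_polb nrm_restr bip_measurable)

lemma Rep_bergman_eqI: "Rep_bergman F = Rep_bergman G \<Longrightarrow> F = G"
  by (simp add: Rep_bergman_inject)

lemma polb_add: "bip 0 u \<Longrightarrow> bip 0 v \<Longrightarrow> polb (\<lambda>z. u z + v z) = polb u + polb v"
  by (rule Rep_bergman_eqI) (auto simp: Rep_polb plus_bergman.rep_eq bip_add restr_def)

lemma polb_diff: "bip 0 u \<Longrightarrow> bip 0 v \<Longrightarrow> polb (\<lambda>z. u z - v z) = polb u - polb v"
  by (rule Rep_bergman_eqI) (auto simp: Rep_polb minus_bergman.rep_eq bip_diff restr_def)

lemma polb_scale: "bip 0 u \<Longrightarrow> polb (\<lambda>z. c * u z) = scaleC c (polb u)"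
  by (rule Rep_bergman_eqI) (auto simp: Rep_polb scaleC.rep_eq bip_scale restr_def)

lemma polb_zero: "polb (\<lambda>_. 0) = 0"
  by (rule Rep_bergman_eqI) (auto simp: Rep_polb zero_bergman.rep_eq restr_def)

lemma coord_mult_polb: "bip 0 u \<Longrightarrow> coord_mult i (polb u) = polb (\<lambda>z. z $ i * u z)"
  by (rule Rep_bergman_eqI) (auto simp: Rep_polb coord_mult.rep_eq bip_coord_mult restr_def)

definition wnorm :: "'n::finite bergman \<Rightarrow> real" where "wnorm F = nrm 1 (Rep_bergman F)"

lemma wnorm_polb: "bip 0 u \<Longrightarrow> wnorm (polb u) = nrm 1 u"
  by (simp add: wnorm_def Rep_polb nrm_restr bip_measurable)

lemma wnorm_nonneg [simp]: "0 \<le> wnorm F" by (simp add: wnorm_def)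

lemma wnorm_le_norm: "wnorm F \<le> norm F"
  unfolding wnorm_def norm_nrm by (intro nrm_antimono bergman_sqi) simp

lemma wnorm_add: "wnorm (F + G) \<le> wnorm F + wnorm G"
  unfolding wnorm_def plus_bergman.rep_eq by (intro nrm_triangle bergman_sqi)

lemma wnorm_diff: "wnorm (F - G) \<le> wnorm F + wnorm G"
  unfolding wnorm_def minus_bergman.rep_eq by (intro nrm_triangle_diff bergman_sqi)

lemma cinner_simps:
  "cinner (x + y) z = cinner x z + cinner y z" "cinner z (x + y) = cinner z x + cinner z y"
  "cinner (x - y) z = cinner x z - cinner y z" "cinner z (x - y) = cinner z x - cinner z y"
  "cinner (scaleC c x) z = c * cinner x z" "cinner z (scaleC c x) = cnj c * cinner z x"
  unfolding cinner_ip plus_bergman.rep_eq minus_bergman.rep_eq scaleC.rep_eq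
  by (simp_all add: ip_add_left ip_add_right ip_diff_left ip_diff_right ip_scale_left ip_scale_right bergman_sqi)

lemma cinner_cnj: "cnj (cinner x y) = cinner y x"
  unfolding cinner_ip by (rule ip_cnj)

lemma cinner_norm: "cinner x x = of_real ((norm x)\<^sup>2)"
  unfolding cinner_ip norm_nrm by (rule ip_self)

lemma cinner_bound: "norm (cinner x y) \<le> norm x * norm y"
  unfolding cinner_ip norm_nrm by (rule ip_bound) (auto simp: bergman_sqi)

lemma norm_scaleC: "norm (scaleC c x) = norm c * norm x" for x :: "'n::finite bergman"
  unfolding norm_nrm scaleC.rep_eq by (rule nrm_scale)

lemma norm_coord_mult: "norm (coord_mult i F) \<le> norm F"
  unfolding norm_nrm coord_mult.rep_eq by (rule nrm_coord[OF bergman_sqi])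

section \<open>Point evaluations and limits of polynomials\<close>

lemma bip0_has_derivative: "bip 0 u \<Longrightarrow> (u has_derivative (\<lambda>h. \<Sum>j\<in>UNIV. h $ j * dz j u x)) (at x)"
proof (induction "0::nat" u rule: bip.induct)
  case (bip_coord_mult u k)
  have "((\<lambda>z. z $ k * u z) has_derivative (\<lambda>h. x $ k * (\<Sum>j\<in>UNIV. h $ j * dz j u x) + h $ k * u x)) (at x)"
    by (intro has_derivative_mult bip_coord_mult.hyps(2) bounded_linear_imp_has_derivative bounded_linear_vec_nth)
  moreover have "(\<Sum>j\<in>UNIV. h $ j * dz j (\<lambda>z. z $ k * u z) x) = x $ k * (\<Sum>j\<in>UNIV. h $ j * dz j u x) + h $ k * u x" for h
  proof -
    have "(\<Sum>j\<in>UNIV. h $ j * (if j = k then u x else 0)) = h $ k * u x"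
      by (simp add: if_distrib cong: if_cong)
    then show ?thesis unfolding dz_coord_mult[OF bip_coord_mult.hyps(1)]
      by (simp add: distrib_left sum.distrib sum_distrib_left mult.left_commute)
  qed
  ultimately show ?case by simp
next
  case (bip_add u v)
  have "((\<lambda>z. u z + v z) has_derivative (\<lambda>h. (\<Sum>j\<in>UNIV. h $ j * dz j u x) + (\<Sum>j\<in>UNIV. h $ j * dz j v x))) (at x)"
    by (intro has_derivative_add bip_add.hyps)
  then show ?case unfolding dz_bip_add[OF bip_add.hyps(1,3)] by (simp add: distrib_left sum.distrib)
qed (simp add: has_derivative_const)

lemma bip_affine:
  "bip 0 u \<Longrightarrow> bip 0 (\<lambda>z. u (a + e *\<^sub>R z)) \<and> dz j (\<lambda>z. u (a + e *\<^sub>R z)) = (\<lambda>z. of_real e * dz j u (a + e *\<^sub>R z))"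
proof (induction "0::nat" u rule: bip.induct)
  case (bip_coord_mult u k)
  have b: "bip 0 (\<lambda>z. (a + e *\<^sub>R z) $ k)" 
    using bip_add[OF bip_const[of 0 "a $ k"] bip_scale[OF bip_coord[of 0 k], of "of_real e"]] by (simp add: scaleR_conv_of_real[of _ "_ :: complex"])
  have d: "dz j (\<lambda>z. (a + e *\<^sub>R z) $ k) = (\<lambda>z. of_real e * (if j = k then 1 else 0))"
    using dz_bip_add(1)[OF bip_const[of 0 "a $ k"] bip_scale[OF bip_coord[of 0 k], of "of_real e"], of j]
    by (simp add: scaleR_conv_of_real[of _ "_ :: complex"] dz_bip_scale[OF bip_coord[of 0 k]] dz_coord)
  have IH: "bip 0 (\<lambda>z. u (a + e *\<^sub>R z))" "dz j (\<lambda>z. u (a + e *\<^sub>R z)) = (\<lambda>z. of_real e * dz j u (a + e *\<^sub>R z))"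
    using bip_coord_mult.hyps by auto
  show ?case
    unfolding dz_bip_mult(1)[OF b IH(1)] d IH(2) dz_coord_mult(1)[OF bip_coord_mult.hyps(1)]
    by (intro conjI bip_mult0[OF b IH(1)]) (simp add: fun_eq_iff distrib_left mult.left_commute)
qed (auto simp: dz_bip_add algebra_simps)

text \<open>The affine map sends the unit ball into itself and has real Jacobian
  \<open>e ^ (2 * n)\<close>; the factor is the root of its inverse.\<close>

lemma nrm_affine:
  fixes a :: "complex^'n::finite"
  assumes u: "bip 0 u" and e: "e > 0" "norm a + e \<le> 1"
  shows "nrm 0 (\<lambda>z. u (a + e *\<^sub>R z)) \<le> (1 / e) ^ CARD('n) * nrm 0 u"
proof -
  let ?B = "ball (0::complex^'n) 1" and ?D = "DIM(complex^'n)"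
  have D: "?D = CARD('n) * 2" by simp
  define V where "V = measure lborel ?B"
  define g where "g = (\<lambda>z. if z \<in> ?B then (norm (u z))\<^sup>2 else 0)"
  note [measurable] = bip_measurable[OF u]
  have gm [measurable]: "g \<in> borel_measurable borel" unfolding g_def
    by (intro measurable_If_set measurable_const) measurable
  have um: "bip 0 (\<lambda>z. u (a + e *\<^sub>R z))" using bip_affine[OF u] by blast
  have int: "integrable lborel (\<lambda>z. if z \<in> ?B then (norm (v z))\<^sup>2 else 0)" if v: "bip 0 v" for v
  proof -
    obtain C where C: "C \<ge> 0" "\<forall>z\<in>cball 0 1. norm (v z) \<le> C" using bip_bounded[OF v] by blast
    note [measurable] = bip_measurable[OF v]
    show ?thesis
    proof (rule Bochner_Integration.integrable_bound)
      show "integrable lborel (\<lambda>x. indicator ?B x *\<^sub>R (C\<^sup>2))"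
        using emeasure_ball(2) by (intro integrable_scaleR_left integrable_real_indicator) (auto simp: less_top)
    qed (use C in \<open>auto simp: indicator_def intro!: power_mono\<close>)
  qed
  have nr: "(nrm 0 v)\<^sup>2 = (LINT z|lborel. (if z \<in> ?B then (norm (v z))\<^sup>2 else 0)) / V" if "bip 0 v" for v
    using bip_measurable[OF that] by (simp add: nrm_sq integral_ball_measure V_def divide_inverse mult.commute)
  have V: "V \<ge> 0" by (simp add: V_def)
  have eq: "(LINT z|lborel. g z) = e ^ ?D * (LINT z|lborel. g (a + e *\<^sub>R z))"
  proof -
    have "(LINT z|lborel. g z) = (LINT z|density (distr lborel borel (\<lambda>x. a + e *\<^sub>R x)) (\<lambda>_. ennreal (\<bar>e\<bar> ^ ?D)). g z)"
      by (subst lborel_affine[of e a]) (use e in \<open>auto simp: ennreal_power\<close>)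
    also have "\<dots> = (LINT z|distr lborel borel (\<lambda>x. a + e *\<^sub>R x). \<bar>e\<bar> ^ ?D *\<^sub>R g z)"
      by (rule integral_density) auto
    also have "\<dots> = (LINT z|lborel. \<bar>e\<bar> ^ ?D *\<^sub>R g (a + e *\<^sub>R z))"
      by (rule integral_distr) auto
    finally show ?thesis using e by simp
  qed
  have "integrable lborel (\<lambda>z. g (a + e *\<^sub>R z))"
  proof -
    have "integrable (density (distr lborel borel (\<lambda>x. a + e *\<^sub>R x)) (\<lambda>_. ennreal (\<bar>e\<bar> ^ ?D))) g"
      using int[OF u] unfolding g_def[symmetric]
      by (subst (asm) lborel_affine[of e a]) (use e in \<open>auto simp: ennreal_power\<close>)
    then have "integrable (distr lborel borel (\<lambda>x. a + e *\<^sub>R x)) (\<lambda>z. \<bar>e\<bar> ^ ?D *\<^sub>R g z)"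
      by (subst (asm) integrable_density) auto
    then have "integrable lborel (\<lambda>z. \<bar>e\<bar> ^ ?D *\<^sub>R g (a + e *\<^sub>R z))"
      by (subst (asm) integrable_distr_eq) auto
    then show ?thesis using e by simp
  qed
  then have "(LINT z|lborel. (if z \<in> ?B then (norm (u (a + e *\<^sub>R z)))\<^sup>2 else 0)) \<le> (LINT z|lborel. g (a + e *\<^sub>R z))"
  proof (intro integral_mono int[OF um])
    fix z
    have "a + e *\<^sub>R z \<in> ?B" if "z \<in> ?B"
    proof -
      have "norm (a + e *\<^sub>R z) \<le> norm a + e * norm z" using norm_triangle_ineq[of a "e *\<^sub>R z"] e by simp
      also have "\<dots> < norm a + e * 1" using that e by (intro add_strict_left_mono mult_strict_left_mono) auto
      finally show ?thesis using e by simp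
    qed
    then show "(if z \<in> ?B then (norm (u (a + e *\<^sub>R z)))\<^sup>2 else 0) \<le> g (a + e *\<^sub>R z)" by (auto simp: g_def)
  qed
  also have "\<dots> = (1 / e) ^ ?D * (LINT z|lborel. g z)" unfolding eq using e by (simp add: power_divide)
  finally have "(nrm 0 (\<lambda>z. u (a + e *\<^sub>R z)))\<^sup>2 \<le> (1 / e) ^ ?D * (nrm 0 u)\<^sup>2"
    unfolding nr[OF um] nr[OF u] g_def using V by (simp add: divide_right_mono)
  also have "\<dots> = ((1 / e) ^ CARD('n) * nrm 0 u)\<^sup>2" unfolding D power_mult power_mult_distrib ..
  finally show ?thesis using e by (intro power2_le_imp_le[OF _ mult_nonneg_nonneg]) auto
qed

text \<open>Normalisation gives 1 at weight 0, and \<open>ip_eul\<close> for constants gives the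
  ratio \<open>(b + 1) / (b + 1 + n)\<close> of consecutive weights, so no integral has to be
  computed.\<close>

lemma ip_one_one_pos: "\<exists>\<kappa>>0. ip b (\<lambda>_::complex^'n::finite. 1) (\<lambda>_. 1) = complex_of_real \<kappa>"
proof (induction b)
  case 0
  show ?case by (intro exI[of _ 1]) (simp add: ip_self nrm_one)
next
  case (Suc b)
  then obtain \<kappa> where \<kappa>: "\<kappa> > 0" "ip b (\<lambda>_::complex^'n. 1) (\<lambda>_. 1) = complex_of_real \<kappa>" by auto
  let ?J = "ip (Suc b) (\<lambda>_::complex^'n. 1) (\<lambda>_. 1)"
  have z: "ip (Suc b) (\<lambda>_::complex^'n. 0) (\<lambda>_. 1) = 0" by (simp add: ip_def)
  have "0 = of_nat (Suc b) * (of_real \<kappa> - ?J) - of_nat CARD('n) * ?J"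
    using ip_eul[OF bip_const[of 0 1] bip_const[of 0 1], where 'n='n, of b] by (simp add: \<kappa>(2) z)
  then have "of_real (real (Suc b) + real CARD('n)) * ?J = complex_of_real (real (Suc b) * \<kappa>)"
    by (simp add: algebra_simps)
  moreover have p: "real (Suc b) + real CARD('n) > 0" by simp
  ultimately have "?J = complex_of_real (real (Suc b) * \<kappa> / (real (Suc b) + real CARD('n)))"
    by (simp only: of_real_divide nonzero_eq_divide_eq of_real_eq_0_iff mult.commute)
  then show ?case using \<kappa>(1) p by (intro exI[of _ "real (Suc b) * \<kappa> / (real (Suc b) + real CARD('n))"]) (simp del: of_real_divide of_nat_Suc)
qed

text \<open>The mean value property on the ball of radius \<open>e\<close> around \<open>a\<close>,
  pulled back to the unit ball. For the derivative it is used at weight 2, where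
  \<open>caccioppoli\<close> bounds \<open>dz j\<close> of the pulled back function.\<close>

lemma point_bound:
  assumes e: "0 < e"
  shows "\<exists>C\<ge>0. \<forall>(u :: complex^'n::finite \<Rightarrow> complex) a j. bip 0 u \<longrightarrow> norm a + e \<le> 1 \<longrightarrow>
    norm (u a) \<le> C * nrm 0 u \<and> norm (dz j u a) \<le> C * nrm 0 u"
proof -
  obtain \<kappa> where \<kappa>: "\<kappa> > 0" "ip 2 (\<lambda>_::complex^'n. 1) (\<lambda>_. 1) = complex_of_real \<kappa>"
    using ip_one_one_pos[of 2] by auto
  obtain D where D: "D \<ge> 0" "\<And>(u::complex^'n \<Rightarrow> complex) j. bip 0 u \<Longrightarrow> nrm 2 (dz j u) \<le> D * nrm 0 u"
    using caccioppoli[of 0 0] by (auto simp: numeral_2_eq_2)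
  define E where "E = (1 / e) ^ CARD('n)"
  have E: "E \<ge> 0" using e by (simp add: E_def)
  have one: "sqi (\<lambda>_::complex^'n. 1)" by (rule bip_sqi[OF bip_const])
  \<comment> \<open>\<open>E\<close> serves the value and the quotient serves the derivative:
    \<open>\<kappa>\<close> is the mass of 1 at weight 2, and \<open>e\<close> comes from the chain
    rule.\<close>
  have "norm (u a) \<le> (E + D * E / (\<kappa> * e)) * nrm 0 u \<and> norm (dz j u a) \<le> (E + D * E / (\<kappa> * e)) * nrm 0 u"
    if u: "bip 0 u" and a: "norm a + e \<le> 1" for u :: "complex^'n \<Rightarrow> complex" and a j
  proof -
    let ?v = "\<lambda>z. u (a + e *\<^sub>R z)"
    have v: "bip 0 ?v" "dz j ?v = (\<lambda>z. of_real e * dz j u (a + e *\<^sub>R z))" using bip_affine[OF u] by blast+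
    have nv: "nrm 0 ?v \<le> E * nrm 0 u" unfolding E_def by (rule nrm_affine[OF u e a])
    have "ip 0 ?v (\<lambda>_. 1) = u a" using ip_one[OF v(1), of 0] by (simp add: ip_self nrm_one)
    moreover have "norm (ip 0 ?v (\<lambda>_. 1)) \<le> nrm 0 ?v * nrm 0 (\<lambda>_::complex^'n. 1)"
      by (intro ip_bound bip_sqi[OF v(1)] one) simp
    ultimately have 1: "norm (u a) \<le> E * nrm 0 u" using nv by (simp add: nrm_one)
    have "ip 2 (dz j ?v) (\<lambda>_. 1) = of_real e * dz j u a * of_real \<kappa>"
      using ip_one[OF bip_dz[OF v(1)], of 2 j] unfolding \<kappa>(2) by (simp add: v(2))
    moreover have "norm (ip 2 (dz j ?v) (\<lambda>_. 1)) \<le> nrm 2 (dz j ?v) * nrm 2 (\<lambda>_::complex^'n. 1)"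
      by (intro ip_bound bip_sqi[OF bip_dz[OF v(1)]] one) simp
    moreover have "nrm 2 (\<lambda>_::complex^'n. 1) \<le> nrm 0 (\<lambda>_::complex^'n. 1)" by (intro nrm_antimono one) simp
    then have "nrm 2 (dz j ?v) * nrm 2 (\<lambda>_::complex^'n. 1) \<le> nrm 2 (dz j ?v) * 1"
      by (intro mult_left_mono) (auto simp: nrm_one)
    ultimately have "(\<kappa> * e) * norm (dz j u a) \<le> nrm 2 (dz j ?v)" using e \<kappa>(1) by (simp add: norm_mult mult_ac)
    also have "\<dots> \<le> D * nrm 0 ?v" by (rule D(2)[OF v(1)])
    also have "\<dots> \<le> D * (E * nrm 0 u)" by (intro mult_left_mono nv D)
    finally have 2: "norm (dz j u a) \<le> D * E / (\<kappa> * e) * nrm 0 u" using e \<kappa>(1) by (simp add: field_simps)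
    have "0 \<le> D * E / (\<kappa> * e)" using e \<kappa>(1) D E by simp
    then have "0 \<le> D * E / (\<kappa> * e) * nrm 0 u" "0 \<le> E * nrm 0 u"
      using E by (rule_tac mult_nonneg_nonneg; simp)+
    then show ?thesis using 1 2 by (simp add: distrib_right)
  qed
  moreover have "0 \<le> E + D * E / (\<kappa> * e)" using e \<kappa>(1) D E by simp
  ultimately show ?thesis by blast
qed

text \<open>Point evaluations of polynomials and of their derivatives are bounded, so an \<open>L\<^sup>2\<close> Cauchy sequence of
  polynomials converges locally uniformly together with its derivatives.\<close>

lemma polb_Cauchy_convergent:
  fixes u :: "nat \<Rightarrow> complex^'n::finite \<Rightarrow> complex"
  assumes u: "\<And>k. bip 0 (u k)" and Cau: "Cauchy (\<lambda>k. polb (u k))"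
  shows "\<exists>F. (\<lambda>k. polb (u k)) \<longlonglongrightarrow> F"
proof -
  have bd: "bip 0 (\<lambda>z. u k z - u l z)" for k l by (intro bip_diff u)
  have N: "\<exists>N. \<forall>k\<ge>N. \<forall>l\<ge>N. nrm 0 (\<lambda>z. u k z - u l z) < e" if "e > 0" for e
    using CauchyD[OF Cau that] by (simp add: polb_diff[OF u u, symmetric] norm_polb[OF bd])
  have unif: "\<exists>N. \<forall>k\<ge>N. \<forall>l\<ge>N. \<forall>a. norm a \<le> \<rho> \<longrightarrow>
      norm (u k a - u l a) < e \<and> (\<forall>j. norm (dz j (u k) a - dz j (u l) a) < e)" if "\<rho> < 1" "e > 0" for \<rho> e
  proof -
    have "0 < 1 - \<rho>" using that by simp
    from point_bound[OF this, where 'n = 'n] obtain C where C0: "C \<ge> 0"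
      and CC: "\<forall>(v :: complex^'n \<Rightarrow> complex) a j. bip 0 v \<longrightarrow> norm a + (1 - \<rho>) \<le> 1 \<longrightarrow>
        norm (v a) \<le> C * nrm 0 v \<and> norm (dz j v a) \<le> C * nrm 0 v" by (elim exE conjE)
    note C = C0 CC[rule_format]
    obtain N where N: "\<And>k l. k \<ge> N \<Longrightarrow> l \<ge> N \<Longrightarrow> nrm 0 (\<lambda>z. u k z - u l z) < e / (C + 1)"
      using N[of "e / (C + 1)"] \<open>e > 0\<close> C(1) by auto
    have "norm (u k a - u l a) < e \<and> norm (dz j (u k) a - dz j (u l) a) < e"
      if "k \<ge> N" "l \<ge> N" "norm a \<le> \<rho>" for k l a j
    proof -
      have "C * nrm 0 (\<lambda>z. u k z - u l z) \<le> C * (e / (C + 1))"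
        using N[OF that(1,2)] C(1) by (intro mult_left_mono) auto
      also have "\<dots> < e" using C(1) \<open>e > 0\<close> by (simp add: field_simps)
      finally show ?thesis using C(2)[OF bd, of a k l j] that(3) by (simp add: dz_bip_diff[OF u u])
    qed
    then show ?thesis by blast
  qed
  have Cf: "convergent (\<lambda>k. u k z) \<and> (\<forall>j. convergent (\<lambda>k. dz j (u k) z))" if "z \<in> ball 0 1" for z
  proof -
    have z: "norm z < 1" using that by simp
    have "\<exists>N. \<forall>k\<ge>N. \<forall>l\<ge>N. norm (u k z - u l z) < e \<and> (\<forall>j. norm (dz j (u k) z - dz j (u l) z) < e)"
      if e: "e > 0" for e
    proof -
      obtain N where "\<forall>k\<ge>N. \<forall>l\<ge>N. \<forall>a. norm a \<le> norm z \<longrightarrow>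
          norm (u k a - u l a) < e \<and> (\<forall>j. norm (dz j (u k) a - dz j (u l) a) < e)"
        using unif[OF z e] by (elim exE)
      then show ?thesis by (intro exI[of _ N]) simp
    qed
    then have "Cauchy (\<lambda>k. u k z)" "\<And>j. Cauchy (\<lambda>k. dz j (u k) z)"
      by (intro CauchyI; fast)+
    then show ?thesis by (simp add: Cauchy_convergent)
  qed
  define f where "f = restr (\<lambda>z. lim (\<lambda>k. u k z))"
  define D where "D = (\<lambda>j z. lim (\<lambda>k. dz j (u k) z))"
  have f: "(\<lambda>k. u k z) \<longlonglongrightarrow> f z" and D: "(\<lambda>k. dz j (u k) z) \<longlonglongrightarrow> D j z" if "z \<in> ball 0 1" for z j
    using Cf[OF that] that by (simp_all add: f_def restr_def D_def convergent_LIMSEQ_iff)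
  have an: "analytic_sev f (ball 0 1)"
    unfolding analytic_sev_def
  proof
    fix z :: "complex^'n" assume z: "z \<in> ball 0 1"
    \<comment> \<open>A ball that contains \<open>z\<close> but stays away from the sphere, so that
      the convergence on it is uniform.\<close>
    define \<rho> where "\<rho> = (1 + norm z) / 2"
    have \<rho>: "\<rho> < 1" "z \<in> ball 0 \<rho>" using z by (auto simp: \<rho>_def)
    have sub: "ball 0 \<rho> \<subseteq> ball (0::complex^'n) 1" using \<rho> by auto
    have "\<exists>g. \<forall>x\<in>ball 0 \<rho>. (\<lambda>n. u n x) \<longlonglongrightarrow> g x \<and>
        (g has_derivative (\<lambda>h. \<Sum>j\<in>UNIV. h $ j * D j x)) (at x within ball 0 \<rho>)"
    proof (rule has_derivative_sequence[where f' = "\<lambda>n x h. \<Sum>j\<in>UNIV. h $ j * dz j (u n) x"])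
      show "(u n has_derivative (\<lambda>h. \<Sum>j\<in>UNIV. h $ j * dz j (u n) x)) (at x within ball 0 \<rho>)" for n x
        by (rule has_derivative_at_withinI[OF bip0_has_derivative[OF u]])
      show "\<forall>\<^sub>F n in sequentially. \<forall>x\<in>ball 0 \<rho>. \<forall>h.
          norm ((\<Sum>j\<in>UNIV. h $ j * dz j (u n) x) - (\<Sum>j\<in>UNIV. h $ j * D j x)) \<le> e * norm h" if e: "e > 0" for e
      proof -
        have "0 < e / real CARD('n)" using e by simp
        from unif[OF \<rho>(1) this] obtain N where N0: "\<forall>k\<ge>N. \<forall>l\<ge>N. \<forall>a. norm a \<le> \<rho> \<longrightarrow>
          norm (u k a - u l a) < e / real CARD('n) \<and> (\<forall>j. norm (dz j (u k) a - dz j (u l) a) < e / real CARD('n))"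
          by (elim exE)
        have N: "norm (dz j (u k) a - dz j (u l) a) < e / real CARD('n)" if "k \<ge> N" "l \<ge> N" "norm a \<le> \<rho>" for k l a j
          using N0 that by simp
        have "norm ((\<Sum>j\<in>UNIV. h $ j * dz j (u n) x) - (\<Sum>j\<in>UNIV. h $ j * D j x)) \<le> e * norm h"
          if n: "n \<ge> N" and x: "x \<in> ball 0 \<rho>" for n x h
        proof -
          have "norm (dz j (u n) x - D j x) \<le> e / real CARD('n)" for j
          proof (rule LIMSEQ_le_const2)
            show "(\<lambda>l. norm (dz j (u n) x - dz j (u l) x)) \<longlonglongrightarrow> norm (dz j (u n) x - D j x)"
              using x sub by (intro tendsto_intros D) auto
            show "\<exists>N. \<forall>l\<ge>N. norm (dz j (u n) x - dz j (u l) x) \<le> e / real CARD('n)"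
              using N[OF n, of _ x j] x by (intro exI[of _ N]) (auto simp: less_imp_le)
          qed
          then have "norm (h $ j * (dz j (u n) x - D j x)) \<le> norm h * (e / real CARD('n))" for j
            unfolding norm_mult by (intro mult_mono Finite_Cartesian_Product.norm_nth_le) auto
          then have "norm (\<Sum>j\<in>UNIV. h $ j * (dz j (u n) x - D j x)) \<le> (\<Sum>j\<in>(UNIV::'n set). norm h * (e / real CARD('n)))"
            by (intro sum_norm_le)
          then show ?thesis by (simp add: right_diff_distrib sum_subtractf mult.commute)
        qed
        then show ?thesis unfolding eventually_sequentially by blast
      qed
      show "(\<lambda>n. u n z) \<longlonglongrightarrow> f z" by (rule f[OF z])
    qed (use \<rho> in auto)
    then obtain g where g: "\<And>x. x \<in> ball 0 \<rho> \<Longrightarrow> (\<lambda>n. u n x) \<longlonglongrightarrow> g x"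
      "\<And>x. x \<in> ball 0 \<rho> \<Longrightarrow> (g has_derivative (\<lambda>h. \<Sum>j\<in>UNIV. h $ j * D j x)) (at x within ball 0 \<rho>)" by blast
    have "g x = f x" if "x \<in> ball 0 \<rho>" for x
      using LIMSEQ_unique[OF g(1)[OF that] f] that sub by blast
    moreover have "(g has_derivative (\<lambda>h. \<Sum>j\<in>UNIV. h $ j * D j z)) (at z)"
      using g(2)[OF \<rho>(2)] at_within_open[OF \<rho>(2)] by simp
    ultimately have "(f has_derivative (\<lambda>h. \<Sum>j\<in>UNIV. h $ j * D j z)) (at z)"
      by (elim has_derivative_transform_within_open[OF _ open_ball \<rho>(2)])
    then show "\<exists>D. (f has_derivative D) (at z) \<and> (\<forall>c v. D (c *s v) = c * D v)"
      by (intro exI[of _ "\<lambda>h. \<Sum>j\<in>UNIV. h $ j * D j z"]) (simp add: sum_distrib_left mult.assoc)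
  qed
  have f0: "f z = 0" if "z \<notin> ball 0 1" for z using that by (simp add: f_def restr_def)
  have fm [measurable]: "f \<in> borel_measurable borel"
  proof -
    have "restr f \<in> borel_measurable borel" unfolding restr_def[abs_def]
      by (intro borel_measurable_continuous_on_if analytic_sev_continuous_on[OF an]) auto
    moreover have "restr f = f" using f0 by (auto simp: restr_def)
    ultimately show ?thesis by simp
  qed
  note [measurable] = bip_measurable[OF u]
  \<comment> \<open>Locally uniform convergence says nothing near the sphere; Fatou's lemma carries
    the Cauchy bound over to the limit.\<close>
  have fatou: "(\<integral>\<^sup>+z. ennreal ((norm (f z - u k z))\<^sup>2) \<partial>ball_measure) \<le> ennreal (e\<^sup>2)"
    if e: "e > 0" and N: "\<And>l. l \<ge> N \<Longrightarrow> nrm 0 (\<lambda>z. u l z - u k z) < e" for k e N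
  proof -
    have "(\<integral>\<^sup>+z. ennreal ((norm (f z - u k z))\<^sup>2) \<partial>ball_measure)
        = (\<integral>\<^sup>+z. liminf (\<lambda>l. ennreal ((norm (u l z - u k z))\<^sup>2)) \<partial>ball_measure)"
    proof (intro nn_integral_cong_AE eventually_mono[OF AE_ball])
      fix z :: "complex^'n" assume "z \<in> ball 0 1"
      then have "(\<lambda>l. ennreal ((norm (u l z - u k z))\<^sup>2)) \<longlonglongrightarrow> ennreal ((norm (f z - u k z))\<^sup>2)"
        by (intro tendsto_intros f)
      then show "ennreal ((norm (f z - u k z))\<^sup>2) = liminf (\<lambda>l. ennreal ((norm (u l z - u k z))\<^sup>2))"
        by (intro lim_imp_Liminf[symmetric]) auto
    qed
    also have "\<dots> \<le> liminf (\<lambda>l. \<integral>\<^sup>+z. ennreal ((norm (u l z - u k z))\<^sup>2) \<partial>ball_measure)"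
      by (intro nn_integral_liminf) measurable
    also have "\<dots> \<le> ennreal (e\<^sup>2)"
    proof (rule order_trans[OF Liminf_le_Limsup Limsup_bounded])
      have "(\<integral>\<^sup>+z. ennreal ((norm (u l z - u k z))\<^sup>2) \<partial>ball_measure) \<le> ennreal (e\<^sup>2)" if "l \<ge> N" for l
      proof -
        have "(\<integral>\<^sup>+z. ennreal ((norm (u l z - u k z))\<^sup>2) \<partial>ball_measure) = ennreal ((nrm 0 (\<lambda>z. u l z - u k z))\<^sup>2)"
          using bip_sqi[OF bd, of l k] by (subst nn_integral_eq_integral) (auto simp: sqi_def nrm_sq)
        also have "\<dots> \<le> ennreal (e\<^sup>2)"
          using N[OF that] by (intro ennreal_leI power_mono) auto
        finally show ?thesis .
      qed
      then show "\<forall>\<^sub>F l in sequentially. (\<integral>\<^sup>+z. ennreal ((norm (u l z - u k z))\<^sup>2) \<partial>ball_measure) \<le> ennreal (e\<^sup>2)"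
        by (auto simp: eventually_sequentially)
    qed auto
    finally show ?thesis .
  qed
  have sq: "sqi (\<lambda>z. f z - u k z) \<and> nrm 0 (\<lambda>z. f z - u k z) \<le> e"
    if e: "e > 0" and N: "\<And>l. l \<ge> N \<Longrightarrow> nrm 0 (\<lambda>z. u l z - u k z) < e" for k e N
  proof -
    have ft: "(\<integral>\<^sup>+z. ennreal ((norm (f z - u k z))\<^sup>2) \<partial>ball_measure) \<le> ennreal (e\<^sup>2)"
      by (rule fatou[OF e N])
    have i: "integrable ball_measure (\<lambda>z. (norm (f z - u k z))\<^sup>2)"
    proof (rule integrableI_bounded)
      show "(\<integral>\<^sup>+z. ennreal (norm ((norm (f z - u k z))\<^sup>2)) \<partial>ball_measure) < \<infinity>"
        using le_less_trans[OF ft ennreal_less_top] by simp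
    qed measurable
    have "ennreal ((nrm 0 (\<lambda>z. f z - u k z))\<^sup>2) \<le> ennreal (e\<^sup>2)"
      using ft i by (subst (asm) nn_integral_eq_integral) (auto simp: nrm_sq)
    then have "nrm 0 (\<lambda>z. f z - u k z) \<le> e" using e by (auto intro: power2_le_imp_le)
    moreover have "sqi (\<lambda>z. f z - u k z)" using i unfolding sqi_def by simp
    ultimately show ?thesis by simp
  qed
  obtain N1 where "\<And>k l. k \<ge> N1 \<Longrightarrow> l \<ge> N1 \<Longrightarrow> nrm 0 (\<lambda>z. u k z - u l z) < 1" using N[of 1] by auto
  then have "sqi (\<lambda>z. f z - u N1 z)" using sq[of 1 N1 N1] by simp
  then have "sqi (\<lambda>z. (f z - u N1 z) + u N1 z)" by (intro sqi_add bip_sqi[OF u])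
  then have "f \<in> bergman_functions" using an f0 by (simp add: bergman_functions_def sqi_def)
  then have Rf: "Rep_bergman (Abs_bergman f) = f" by (simp add: Abs_bergman_inverse)
  have nF: "norm (polb (u k) - Abs_bergman f) = nrm 0 (\<lambda>z. f z - u k z)" for k
  proof -
    have e: "Rep_bergman (polb (u k) - Abs_bergman f) = (\<lambda>z. - restr (\<lambda>z. f z - u k z) z)"
      using f0 by (auto simp: minus_bergman.rep_eq Rep_polb[OF u] Rf restr_def)
    show ?thesis unfolding norm_nrm e nrm_uminus by (rule nrm_restr) measurable
  qed
  have "(\<lambda>k. polb (u k)) \<longlonglongrightarrow> Abs_bergman f"
  proof (rule LIMSEQ_I)
    fix r :: real assume r: "r > 0"
    obtain N where N: "\<And>k l. k \<ge> N \<Longrightarrow> l \<ge> N \<Longrightarrow> nrm 0 (\<lambda>z. u k z - u l z) < r / 2" using N[of "r / 2"] r by auto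
    have "norm (polb (u k) - Abs_bergman f) < r" if "k \<ge> N" for k
    proof -
      have "nrm 0 (\<lambda>z. f z - u k z) \<le> r / 2" using sq[of "r / 2" N k] N that r by auto
      then show ?thesis unfolding nF using r by linarith
    qed
    then show "\<exists>no. \<forall>n\<ge>no. norm (polb (u n) - Abs_bergman f) < r" by blast
  qed
  then show ?thesis ..
qed

text \<open>Each member of a Cauchy sequence in the closure is replaced by a polynomial at distance
  less than \<open>1 / Suc n\<close>. The new sequence is Cauchy, converges by
  \<open>polb_Cauchy_convergent\<close>, and its limit is also that of the given one.\<close>

lemma complete_closure_polb:
  assumes S: "S \<subseteq> polb ` {u. bip 0 u}"
  shows "complete (closure S)"
  unfolding complete_def
proof (intro allI impI)
  fix x :: "nat \<Rightarrow> 'a bergman" assume x: "(\<forall>n. x n \<in> closure S) \<and> Cauchy x"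
  have "\<exists>s\<in>S. dist s (x n) < 1 / real (Suc n)" for n
    using x closure_approachable[of "x n" S] by simp
  then obtain s where s: "\<And>n. s n \<in> S" "\<And>n. dist (s n) (x n) < 1 / real (Suc n)" by metis
  have "\<forall>n. \<exists>v. bip 0 v \<and> s n = polb v"
  proof
    fix n
    have "s n \<in> polb ` {u. bip 0 u}" using S s(1)[of n] by (rule set_mp)
    then show "\<exists>v. bip 0 v \<and> s n = polb v" by (elim imageE) auto
  qed
  from choice[OF this] obtain u where u: "\<And>n. bip 0 (u n)" "\<And>n. s n = polb (u n)" by auto
  have "norm (s n - x n) \<le> 1 / real (Suc n)" for n
    using s(2)[of n] unfolding dist_norm by (rule less_imp_le)
  then have d: "(\<lambda>n. s n - x n) \<longlonglongrightarrow> 0"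
    by (intro Lim_null_comparison[OF _ LIMSEQ_inverse_real_of_nat[unfolded inverse_eq_divide]] always_eventually allI)
  have "Cauchy s"
  proof (rule CauchyI)
    fix e :: real assume e: "e > 0"
    have e3: "0 < e / 3" using e by simp
    obtain N1 where N1: "\<forall>n\<ge>N1. norm (s n - x n) < e / 3" using LIMSEQ_D[OF d e3] by auto
    obtain N2 where N2: "\<forall>m\<ge>N2. \<forall>n\<ge>N2. norm (x m - x n) < e / 3" using CauchyD[OF conjunct2[OF x] e3] by auto
    have "norm (s m - s n) < e" if "m \<ge> max N1 N2" "n \<ge> max N1 N2" for m n
    proof -
      have "s m - s n = (s m - x m) + (x m - x n) - (s n - x n)" by simp
      also have "norm \<dots> \<le> norm (s m - x m) + norm (x m - x n) + norm (s n - x n)"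
        by (rule order_trans[OF norm_triangle_ineq4 add_right_mono[OF norm_triangle_ineq]])
      also have "\<dots> < e / 3 + e / 3 + e / 3" using N1 N2 that by (intro add_strict_mono) auto
      finally show ?thesis by simp
    qed
    then show "\<exists>M. \<forall>m\<ge>M. \<forall>n\<ge>M. norm (s m - s n) < e" by (intro exI[of _ "max N1 N2"] allI impI)
  qed
  moreover have su: "s = (\<lambda>n. polb (u n))" using u(2) by auto
  ultimately obtain F where F: "s \<longlonglongrightarrow> F"
    using polb_Cauchy_convergent[of u, OF u(1)] unfolding su by blast
  have "x \<longlonglongrightarrow> F" using tendsto_diff[OF F d] by simp
  moreover have "F \<in> closure S"
    by (rule closed_sequentially[OF closed_closure _ \<open>x \<longlonglongrightarrow> F\<close>]) (use x in simp)
  ultimately show "\<exists>l\<in>closure S. x \<longlonglongrightarrow> l" by blast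
qed

section \<open>Adjoints on closed subspaces\<close>

text \<open>\<open>h\<close> minimises \<open>(norm x)\<^sup>2 - 2 * l x\<close> over
  \<open>M\<close>. The parallelogram law makes minimising sequences Cauchy, completeness supplies
  the limit, and the first variation in every direction of \<open>M\<close> vanishes.\<close>

lemma riesz_real:
  fixes M :: "'a::real_inner set" and l :: "'a \<Rightarrow> real"
  assumes M: "subspace M" "complete M"
    and add: "\<And>x y. x \<in> M \<Longrightarrow> y \<in> M \<Longrightarrow> l (x + y) = l x + l y"
    and scale: "\<And>c x. x \<in> M \<Longrightarrow> l (c *\<^sub>R x) = c * l x"
    and bound: "\<And>x. x \<in> M \<Longrightarrow> \<bar>l x\<bar> \<le> B * norm x"
  shows "\<exists>h\<in>M. \<forall>x\<in>M. l x = inner x h"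
proof -
  define J where "J = (\<lambda>x. (norm x)\<^sup>2 - 2 * l x)"
  have Jlow: "J x \<ge> - (B\<^sup>2)" if "x \<in> M" for x
  proof -
    have "l x \<le> B * norm x" using bound[OF that] by simp
    then show ?thesis using sum_squares_bound[of B "norm x"] by (simp add: J_def)
  qed
  have M0: "0 \<in> M" using M(1) by (rule subspace_0)
  define I where "I = Inf (J ` M)"
  have bdd: "bdd_below (J ` M)" by (rule bdd_belowI2[OF Jlow])
  have I: "I \<le> J x" if "x \<in> M" for x unfolding I_def using bdd that by (intro cINF_lower)
  have "\<exists>x\<in>M. J x < I + 1 / real (Suc n)" for n
  proof -
    have "Inf (J ` M) < I + 1 / real (Suc n)" by (simp add: I_def)
    then show ?thesis using M0 bdd by (subst (asm) cInf_less_iff) auto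
  qed
  then obtain x where x: "\<And>n. x n \<in> M" "\<And>n. J (x n) < I + 1 / real (Suc n)" by metis
  have par: "(norm (a - b))\<^sup>2 \<le> 2 * (J a - I) + 2 * (J b - I)" if "a \<in> M" "b \<in> M" for a b
  proof -
    have m: "(1/2) *\<^sub>R (a + b) \<in> M" using M(1) that by (intro subspace_scale subspace_add)
    have lm: "l ((1/2) *\<^sub>R (a + b)) = (l a + l b) / 2"
      using scale[of "a + b" "1/2"] add[OF that] M(1) that by (simp add: subspace_add)
    have "(norm (a - b))\<^sup>2 = 2 * (norm a)\<^sup>2 + 2 * (norm b)\<^sup>2 - 4 * (norm ((1/2) *\<^sub>R (a + b)))\<^sup>2"
      unfolding power2_norm_eq_inner by (simp add: inner_simps inner_commute algebra_simps)
    also have "\<dots> = 2 * J a + 2 * J b - 4 * J ((1/2) *\<^sub>R (a + b))" unfolding J_def lm by (simp add: algebra_simps)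
    also have "\<dots> \<le> 2 * J a + 2 * J b - 4 * I" using I[OF m] by simp
    finally show ?thesis by simp
  qed
  have "Cauchy x"
  proof (rule CauchyI)
    fix e :: real assume e: "e > 0"
    obtain N where N: "1 / real (Suc N) < e\<^sup>2 / 4"
      using reals_Archimedean[of "e\<^sup>2 / 4"] e by (auto simp: inverse_eq_divide)
    have "norm (x m - x n) < e" if "m \<ge> N" "n \<ge> N" for m n
    proof -
      have s: "J (x k) - I < e\<^sup>2 / 4" if "k \<ge> N" for k
      proof -
        have "1 / real (Suc k) \<le> 1 / real (Suc N)" using that by (intro divide_left_mono) auto
        then show ?thesis using x(2)[of k] N by linarith
      qed
      have "(norm (x m - x n))\<^sup>2 \<le> 2 * (J (x m) - I) + 2 * (J (x n) - I)" by (rule par[OF x(1) x(1)])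
      also have "\<dots> < 2 * (e\<^sup>2 / 4) + 2 * (e\<^sup>2 / 4)"
        by (intro add_strict_mono mult_strict_left_mono s that) auto
      finally have "(norm (x m - x n))\<^sup>2 < e\<^sup>2" by simp
      then show ?thesis using e by (simp add: power_less_imp_less_base)
    qed
    then show "\<exists>M. \<forall>m\<ge>M. \<forall>n\<ge>M. norm (x m - x n) < e" by blast
  qed
  then obtain h where h: "h \<in> M" "x \<longlonglongrightarrow> h" using M(2) x(1) by (auto simp: complete_def)
  have diff: "l (a - b) = l a - l b" if "a \<in> M" "b \<in> M" for a b
    using add[OF that(1), of "- b"] scale[OF that(2), of "-1"] M(1) that(2) by (simp add: subspace_neg)
  have "(\<lambda>n. l (x n)) \<longlonglongrightarrow> l h"
  proof (rule LIM_zero_cancel, rule Lim_null_comparison)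
    show "\<forall>\<^sub>F n in sequentially. norm (l (x n) - l h) \<le> B * norm (x n - h)"
      using bound[of "x n - h" for n] diff[OF x(1) h(1)] M(1) x(1) h(1) by (auto simp: subspace_diff)
    show "(\<lambda>n. B * norm (x n - h)) \<longlonglongrightarrow> 0"
      using h(2) by (auto intro!: tendsto_eq_intros)
  qed
  then have "(\<lambda>n. J (x n)) \<longlonglongrightarrow> J h" unfolding J_def using h(2) by (intro tendsto_intros)
  moreover have "(\<lambda>n. I + 1 / real (Suc n)) \<longlonglongrightarrow> I + 0"
    by (intro tendsto_add tendsto_const LIMSEQ_inverse_real_of_nat[unfolded inverse_eq_divide])
  ultimately have "J h \<le> I" using x(2) by (auto intro: LIMSEQ_le less_imp_le)
  have "l y = inner y h" if y: "y \<in> M" for y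
  proof (cases "y = 0")
    case True
    then show ?thesis using scale[of 0 0] M0 by simp
  next
    case False
    define s where "s = inner y h - l y"
    \<comment> \<open>The minimum point of \<open>2 * t * s + t\<^sup>2 * (norm y)\<^sup>2\<close>,
      whose value there is \<open>- s\<^sup>2 / (norm y)\<^sup>2\<close>; minimality of
      \<open>h\<close> forces \<open>s = 0\<close>.\<close>
    define t where "t = - s / (norm y)\<^sup>2"
    have ny: "(norm y)\<^sup>2 > 0" using False by simp
    have m: "h + t *\<^sub>R y \<in> M" using M(1) h(1) y by (intro subspace_add subspace_scale)
    have "J (h + t *\<^sub>R y) = J h + 2 * t * s + t\<^sup>2 * (norm y)\<^sup>2"
      using add[OF h(1), of "t *\<^sub>R y"] scale[OF y, of t] M(1) y
      unfolding J_def s_def power2_norm_eq_inner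
      by (simp add: subspace_scale inner_simps inner_commute power2_eq_square algebra_simps)
    moreover have "J h \<le> J (h + t *\<^sub>R y)" using I[OF m] \<open>J h \<le> I\<close> by linarith
    ultimately have "0 \<le> 2 * t * s + t\<^sup>2 * (norm y)\<^sup>2" by linarith
    also have "\<dots> = - (s\<^sup>2 / (norm y)\<^sup>2)" using ny by (simp add: t_def power2_eq_square field_simps)
    finally have "s\<^sup>2 / (norm y)\<^sup>2 \<le> 0" by simp
    then have "s\<^sup>2 \<le> 0" using ny by (simp add: divide_le_0_iff)
    then have "s = 0" by simp
    then show ?thesis by (simp add: s_def)
  qed
  then show ?thesis using h(1) by blast
qed

text \<open>Completeness is demanded of \<open>M\<close> itself: Riesz needs limits inside
  \<open>M\<close>, and the ambient type is never shown to be complete.\<close>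

definition hilbert_subspace :: "'n::finite bergman set \<Rightarrow> bool" where
  "hilbert_subspace M \<longleftrightarrow> 0 \<in> M \<and> (\<forall>x\<in>M. \<forall>y\<in>M. x + y \<in> M) \<and> (\<forall>c. \<forall>x\<in>M. scaleC c x \<in> M) \<and> complete M"

lemma hilbert_subspaceD:
  assumes "hilbert_subspace M"
  shows "0 \<in> M" "\<And>x y. x \<in> M \<Longrightarrow> y \<in> M \<Longrightarrow> x + y \<in> M" "\<And>c x. x \<in> M \<Longrightarrow> scaleC c x \<in> M" "complete M"
    "\<And>x y. x \<in> M \<Longrightarrow> y \<in> M \<Longrightarrow> x - y \<in> M"
proof -
  show 1: "0 \<in> M" "\<And>x y. x \<in> M \<Longrightarrow> y \<in> M \<Longrightarrow> x + y \<in> M" "\<And>c x. x \<in> M \<Longrightarrow> scaleC c x \<in> M" "complete M"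
    using assms by (auto simp: hilbert_subspace_def)
  show "x - y \<in> M" if "x \<in> M" "y \<in> M" for x y
    using 1(2)[OF that(1) 1(3)[OF that(2), of "-1"]] by simp
qed

text \<open>The real part of \<open>L\<close> is represented by the real inner product, and
  evaluation at \<open>scaleC \<i> x\<close> recovers the imaginary part.\<close>

lemma riesz_complex:
  fixes M :: "'n::finite bergman set" and L :: "'n bergman \<Rightarrow> complex"
  assumes M: "hilbert_subspace M"
    and add: "\<And>x y. x \<in> M \<Longrightarrow> y \<in> M \<Longrightarrow> L (x + y) = L x + L y"
    and scale: "\<And>c x. x \<in> M \<Longrightarrow> L (scaleC c x) = c * L x"
    and bound: "\<And>x. x \<in> M \<Longrightarrow> norm (L x) \<le> B * norm x"
  shows "\<exists>h\<in>M. \<forall>x\<in>M. L x = cinner x h"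
proof -
  note MD = hilbert_subspaceD[OF M]
  have "\<exists>h\<in>M. \<forall>x\<in>M. Re (L x) = inner x h"
  proof (rule riesz_real)
    show "subspace M" using MD unfolding subspace_def scaleR_bergman_def by auto
    show "\<bar>Re (L x)\<bar> \<le> B * norm x" if "x \<in> M" for x
      using bound[OF that] abs_Re_le_cmod[of "L x"] by linarith
  qed (use MD add scale in \<open>auto simp: scaleR_bergman_def\<close>)
  then obtain h where h: "h \<in> M" "\<And>x. x \<in> M \<Longrightarrow> Re (L x) = Re (cinner x h)"
    by (auto simp: inner_bergman_def)
  have "L x = cinner x h" if x: "x \<in> M" for x
  proof (rule complex_eqI)
    show "Re (L x) = Re (cinner x h)" by (rule h(2)[OF x])
    show "Im (L x) = Im (cinner x h)"
      using h(2)[OF MD(3)[OF x], of \<i>] by (simp add: scale[OF x] cinner_simps)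
  qed
  then show ?thesis using h(1) by blast
qed

text \<open>Riesz supplies the vector and definiteness its uniqueness, so the description in the
  definition of \<open>adjoint_on\<close> denotes.\<close>

lemma adjoint_on:
  assumes M: "hilbert_subspace M" and T: "bounded_operator_on M T" and g: "g \<in> M"
  shows "adjoint_on M T g \<in> M" "f \<in> M \<Longrightarrow> cinner (T f) g = cinner f (adjoint_on M T g)"
proof -
  note MD = hilbert_subspaceD[OF M]
  obtain B where B: "\<And>f. f \<in> M \<Longrightarrow> norm (T f) \<le> B * norm f" using T unfolding bounded_operator_on_def by blast
  have "\<exists>h\<in>M. \<forall>x\<in>M. cinner (T x) g = cinner x h"
  proof (rule riesz_complex[OF M])
    show "norm (cinner (T x) g) \<le> (B * norm g) * norm x" if "x \<in> M" for x
      using cinner_bound[of "T x" g] mult_right_mono[OF B[OF that], of "norm g"] by (simp add: mult_ac)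
  qed (use T in \<open>auto simp: bounded_operator_on_def cinner_simps\<close>)
  then obtain h where h: "h \<in> M" "\<forall>x\<in>M. cinner (T x) g = cinner x h" by blast
  have "h' = h" if "h' \<in> M" "\<forall>x\<in>M. cinner (T x) g = cinner x h'" for h'
  proof -
    have "h' - h \<in> M" by (rule MD(5)[OF that(1) h(1)])
    then have "cinner (h' - h) (h' - h) = 0" using that(2) h(2) by (simp add: cinner_simps(4))
    then show ?thesis by (simp add: cinner_norm)
  qed
  then have "\<exists>!h. h \<in> M \<and> (\<forall>f\<in>M. cinner (T f) g = cinner f h)" using h by blast
  from theI'[OF this] show "adjoint_on M T g \<in> M" "f \<in> M \<Longrightarrow> cinner (T f) g = cinner f (adjoint_on M T g)"
    unfolding adjoint_on_def by auto
qed

lemma cinner_separates: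
  assumes M: "hilbert_subspace M" and "x \<in> M" "y \<in> M" "\<And>f. f \<in> M \<Longrightarrow> cinner f x = cinner f y"
  shows "x = y"
proof -
  have "cinner (x - y) (x - y) = 0"
    using assms(4)[OF hilbert_subspaceD(5)[OF M assms(2,3)]] by (simp add: cinner_simps(4))
  then show ?thesis by (simp add: cinner_norm)
qed

lemma adjoint_bounded_operator:
  assumes M: "hilbert_subspace M" and T: "bounded_operator_on M T"
  shows "bounded_operator_on M (adjoint_on M T)"
proof -
  note MD = hilbert_subspaceD[OF M]
  note A = adjoint_on[OF M T]
  obtain B where B: "\<And>f. f \<in> M \<Longrightarrow> norm (T f) \<le> B * norm f" using T unfolding bounded_operator_on_def by blast
  have "norm (adjoint_on M T g) \<le> B * norm g" if g: "g \<in> M" for g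
  proof -
    let ?h = "adjoint_on M T g"
    \<comment> \<open>The adjoint is tested on its own value, which allows one factor
      \<open>norm ?h\<close> to be cancelled.\<close>
    have "cinner ?h ?h = cinner (T ?h) g" using A(2)[OF g A(1)[OF g]] by simp
    then have "norm (cinner ?h ?h) = norm (cinner (T ?h) g)" by simp
    then have "(norm ?h)\<^sup>2 = norm (cinner (T ?h) g)" unfolding cinner_norm by (simp add: norm_power)
    also have "\<dots> \<le> norm (T ?h) * norm g" by (rule cinner_bound)
    also have "\<dots> \<le> (B * norm ?h) * norm g" by (intro mult_right_mono B A(1) g) simp
    finally have *: "norm ?h * norm ?h \<le> (B * norm g) * norm ?h" by (simp add: power2_eq_square mult_ac)
    show ?thesis
    proof (cases "?h = 0")
      case True
      have "0 \<le> B * norm g" using B[OF g] norm_ge_zero order_trans by blast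
      then show ?thesis using True by simp
    next
      case False
      then show ?thesis using mult_right_le_imp_le[OF *] by simp
    qed
  qed
  moreover have "adjoint_on M T (f + g) = adjoint_on M T f + adjoint_on M T g" if fg: "f \<in> M" "g \<in> M" for f g
  proof (rule cinner_separates[OF M])
    note s = MD(2)[OF fg]
    show "adjoint_on M T (f + g) \<in> M" "adjoint_on M T f + adjoint_on M T g \<in> M"
      by (intro A(1) s MD(2) fg)+
    show "cinner h (adjoint_on M T (f + g)) = cinner h (adjoint_on M T f + adjoint_on M T g)" if "h \<in> M" for h
      unfolding cinner_simps(2) A(2)[OF s that, symmetric] A(2)[OF fg(1) that, symmetric] A(2)[OF fg(2) that, symmetric] ..
  qed
  moreover have "adjoint_on M T (scaleC c f) = scaleC c (adjoint_on M T f)" if f: "f \<in> M" for f c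
  proof (rule cinner_separates[OF M])
    note s = MD(3)[OF f]
    show "adjoint_on M T (scaleC c f) \<in> M" "scaleC c (adjoint_on M T f) \<in> M"
      by (intro A(1) s MD(3) f)+
    show "cinner h (adjoint_on M T (scaleC c f)) = cinner h (scaleC c (adjoint_on M T f))" if "h \<in> M" for h
      unfolding cinner_simps(6) A(2)[OF s that, symmetric] A(2)[OF f that, symmetric] ..
  qed
  ultimately show ?thesis unfolding bounded_operator_on_def using A(1) by blast
qed

lemma bounded_bilinear_cinner: "bounded_bilinear (cinner :: 'n::finite bergman \<Rightarrow> _)"
proof
  show "\<exists>K. \<forall>a b. norm (cinner a b) \<le> norm (a :: 'n bergman) * norm b * K"
    by (intro exI[of _ 1]) (simp add: cinner_bound)
qed (simp_all add: cinner_simps scaleR_bergman_def scaleR_conv_of_real)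

lemma bounded_linear_coord_mult: "bounded_linear (coord_mult i)"
proof
  fix x y :: "'a bergman" and r :: real
  show "coord_mult i (x + y) = coord_mult i x + coord_mult i y"
    by (rule Rep_bergman_eqI) (simp add: coord_mult.rep_eq plus_bergman.rep_eq distrib_left)
  show "coord_mult i (r *\<^sub>R x) = r *\<^sub>R coord_mult i x" unfolding scaleR_bergman_def
    by (rule Rep_bergman_eqI) (simp add: coord_mult.rep_eq scaleC.rep_eq mult_ac)
  show "\<exists>K. \<forall>x :: 'a bergman. norm (coord_mult i x) \<le> norm x * K"
    by (intro exI[of _ 1]) (simp add: norm_coord_mult)
qed

lemma coord_mult_scaleC: "coord_mult i (scaleC c x) = scaleC c (coord_mult i x)"
  by (rule Rep_bergman_eqI) (simp add: coord_mult.rep_eq scaleC.rep_eq mult_ac)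

lemma bounded_linear_scaleC: "bounded_linear (scaleC c :: 'n::finite bergman \<Rightarrow> _)"
proof
  fix x y :: "'n bergman" and r :: real
  show "scaleC c (x + y) = scaleC c x + scaleC c y"
    by (rule bergman.scale_right_distrib)
  show "scaleC c (r *\<^sub>R x) = r *\<^sub>R scaleC c x" unfolding scaleR_bergman_def
    by (simp add: mult.commute)
  show "\<exists>K. \<forall>x :: 'n bergman. norm (scaleC c x) \<le> norm x * K"
    by (intro exI[of _ "norm c"]) (simp add: norm_scaleC)
qed

section \<open>Principal submodules and the coordinate operators on them\<close>

lemma principal_submodule_eq:
  "principal_submodule p = closure ((\<lambda>f. polb (\<lambda>z. eval_cpoly p z * f z)) ` {f. bip 0 f})"
  unfolding principal_submodule_def range_bergman_of_cpoly ..

lemma bip_cpoly_mult: "bip 0 f \<Longrightarrow> bip 0 (\<lambda>z. eval_cpoly p z * f z)"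
  by (rule bip_mult0[OF bip_eval_cpoly])

lemma closure_invariant:
  assumes "bounded_linear h" "h ` S \<subseteq> S" shows "x \<in> closure S \<Longrightarrow> h x \<in> closure S"
proof -
  have "h ` closure S \<subseteq> closure S"
    using assms(2) closure_subset by (intro image_closure_subset linear_continuous_on assms(1)) auto
  then show "x \<in> closure S \<Longrightarrow> h x \<in> closure S" by auto
qed

lemma coord_mult_principal_submodule:
  "f \<in> principal_submodule p \<Longrightarrow> coord_mult i f \<in> principal_submodule p"
  unfolding principal_submodule_eq
proof (rule closure_invariant[OF bounded_linear_coord_mult])
  let ?q = "\<lambda>f. polb (\<lambda>z. eval_cpoly p z * f z)"
  have "coord_mult i (?q f) = ?q (\<lambda>z. z $ i * f z)" if "bip 0 f" for f
    unfolding coord_mult_polb[OF bip_cpoly_mult[OF that]] by (simp add: mult.left_commute)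
  then show "coord_mult i ` ?q ` {f. bip 0 f} \<subseteq> ?q ` {f. bip 0 f}"
    using bip_coord_mult by fastforce
qed

lemma hilbert_subspace_principal_submodule: "hilbert_subspace (principal_submodule p)"
proof -
  let ?q = "\<lambda>f. polb (\<lambda>z. eval_cpoly p z * f z)" and ?S = "(\<lambda>f. polb (\<lambda>z. eval_cpoly p z * f z)) ` {f. bip 0 f}"
  have q0: "?q (\<lambda>_. 0) = 0" by (simp add: polb_zero)
  have "?q (\<lambda>_. 0) \<in> ?S" by (rule imageI) simp
  then have 0: "0 \<in> closure ?S" unfolding q0 by (rule set_mp[OF closure_subset])
  have a: "?q f + ?q g \<in> ?S" if "bip 0 f" "bip 0 g" for f g
  proof -
    have "?q f + ?q g = ?q (\<lambda>z. f z + g z)"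
      unfolding polb_add[OF bip_cpoly_mult[OF that(1)] bip_cpoly_mult[OF that(2)], symmetric] by (simp add: distrib_left)
    then show ?thesis using that by auto
  qed
  have add: "x + y \<in> closure ?S" if xy: "x \<in> closure ?S" "y \<in> closure ?S" for x y
  proof -
    obtain s t where s: "\<forall>n. s n \<in> ?S" "s \<longlonglongrightarrow> x" and t: "\<forall>n. t n \<in> ?S" "t \<longlonglongrightarrow> y"
      using xy unfolding closure_sequential by blast
    have "s n + t n \<in> ?S" for n using s(1)[rule_format, of n] t(1)[rule_format, of n] a by auto
    then have "\<forall>n. s n + t n \<in> ?S" by blast
    moreover have "(\<lambda>n. s n + t n) \<longlonglongrightarrow> x + y" by (intro tendsto_add s t)
    ultimately show ?thesis unfolding closure_sequential by (intro exI[of _ "\<lambda>n. s n + t n"] conjI)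
  qed
  have scale: "scaleC c x \<in> closure ?S" if "x \<in> closure ?S" for c x
  proof (rule closure_invariant[OF bounded_linear_scaleC _ that])
    have "scaleC c (?q f) = ?q (\<lambda>z. c * f z)" if "bip 0 f" for f
      unfolding polb_scale[OF bip_cpoly_mult[OF that], symmetric] by (simp add: mult.left_commute)
    then show "scaleC c ` ?S \<subseteq> ?S" using bip_scale by fastforce
  qed
  have "complete (closure ?S)"
    by (rule complete_closure_polb) (use bip_cpoly_mult in blast)
  then show ?thesis unfolding hilbert_subspace_def principal_submodule_eq using 0 add scale by blast
qed

lemma bounded_operator_coord_mult:
  "bounded_operator_on (principal_submodule p) (coord_mult i)"
  unfolding bounded_operator_on_def
  by (intro conjI ballI allI exI[of _ 1])
     (simp_all add: coord_mult_principal_submodule coord_mult_scaleC norm_coord_mult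
        linear_add[OF bounded_linear.linear[OF bounded_linear_coord_mult]])

lemma bounded_operator_compose:
  assumes "bounded_operator_on M S" "bounded_operator_on M T"
  shows "bounded_operator_on M (\<lambda>f. S (T f))"
proof -
  obtain A where A: "\<forall>f\<in>M. norm (S f) \<le> A * norm f" using assms(1) unfolding bounded_operator_on_def by blast
  obtain B where B: "\<forall>f\<in>M. norm (T f) \<le> B * norm f" using assms(2) unfolding bounded_operator_on_def by blast
  have "norm (S (T f)) \<le> \<bar>A\<bar> * B * norm f" if f: "f \<in> M" for f
  proof -
    have "T f \<in> M" using assms(2) f unfolding bounded_operator_on_def by blast
    then have "norm (S (T f)) \<le> A * norm (T f)" using A by blast
    also have "\<dots> \<le> \<bar>A\<bar> * norm (T f)" by (intro mult_right_mono) auto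
    also have "\<dots> \<le> \<bar>A\<bar> * (B * norm f)" using B f by (intro mult_left_mono) auto
    finally show ?thesis by (simp add: mult.assoc)
  qed
  then have "\<exists>B. \<forall>f\<in>M. norm (S (T f)) \<le> B * norm f" by blast
  then show ?thesis using assms unfolding bounded_operator_on_def by simp
qed

lemma bounded_operator_diff:
  assumes M: "hilbert_subspace M" and "bounded_operator_on M S" "bounded_operator_on M T"
  shows "bounded_operator_on M (\<lambda>f. S f - T f)"
proof -
  obtain A where A: "\<forall>f\<in>M. norm (S f) \<le> A * norm f" using assms(2) unfolding bounded_operator_on_def by blast
  obtain B where B: "\<forall>f\<in>M. norm (T f) \<le> B * norm f" using assms(3) unfolding bounded_operator_on_def by blast
  have "norm (S f - T f) \<le> (A + B) * norm f" if f: "f \<in> M" for f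
    using norm_triangle_ineq4[of "S f" "T f"] A[rule_format, OF f] B[rule_format, OF f] by (simp add: distrib_right)
  then have "\<exists>B. \<forall>f\<in>M. norm (S f - T f) \<le> B * norm f" by blast
  then show ?thesis using assms hilbert_subspaceD(5)[OF M] unfolding bounded_operator_on_def
    by (simp add: bergman.scale_right_diff_distrib)
qed

lemma bounded_operator_adj_commutator:
  "bounded_operator_on (principal_submodule p) (adj_commutator (principal_submodule p) (coord_mult i) (coord_mult j))"
proof -
  note h = hilbert_subspace_principal_submodule[of p] and b = bounded_operator_coord_mult[of p]
  note a = adjoint_bounded_operator[OF h b[of j]]
  show ?thesis unfolding adj_commutator_def
    by (rule bounded_operator_diff[OF h bounded_operator_compose[OF b a] bounded_operator_compose[OF a b]])
qed

section \<open>The commutator on a principal submodule\<close>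

lemma wnorm_tendsto:
  assumes "x \<longlonglongrightarrow> F" shows "(\<lambda>k. wnorm (x k)) \<longlonglongrightarrow> wnorm F"
proof (rule LIM_zero_cancel, rule Lim_null_comparison)
  have "\<bar>wnorm (x k) - wnorm F\<bar> \<le> norm (x k - F)" for k
    using wnorm_add[of "x k - F" F] wnorm_diff[of "x k" "x k - F"] wnorm_le_norm[of "x k - F"] by simp
  then show "\<forall>\<^sub>F k in sequentially. norm (wnorm (x k) - wnorm F) \<le> norm (x k - F)" by simp
  show "(\<lambda>k. norm (x k - F)) \<longlonglongrightarrow> 0" using assms by (intro tendsto_norm_zero LIM_zero)
qed

text \<open>For multiples of \<open>p\<close>, the Bergman space adjoint differs from the adjoint in
  \<open>M\<close> by an error orthogonal to \<open>M\<close>. So the form is that of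
  \<open>bergman_commutator_bound\<close> minus the inner product of two errors, each bounded by
  \<open>adjoint_approximation\<close>. Density and continuity extend the estimate to
  \<open>M\<close>.\<close>

lemma commutator_bound:
  fixes p :: "'n::finite cpoly"
  defines "M \<equiv> principal_submodule p"
  shows "\<exists>C\<ge>0. \<forall>F\<in>M. \<forall>G\<in>M. \<forall>i j.
    norm (cinner (adj_commutator M (coord_mult i) (coord_mult j) F) G) \<le> C * wnorm F * wnorm G"
proof -
  let ?P = "eval_cpoly p" and ?n = "real CARD('n)"
  let ?q = "\<lambda>f. polb (\<lambda>z. ?P z * f z)"
  let ?D = "(\<lambda>f. polb (\<lambda>z. eval_cpoly p z * f z)) ` {f. bip 0 f}"
  have M: "M = closure ?D" unfolding M_def by (rule principal_submodule_eq)
  have DM: "?q f \<in> M" if "bip 0 f" for f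
    unfolding M by (rule set_mp[OF closure_subset], rule imageI) (use that in simp)
  have hM: "hilbert_subspace M" unfolding M_def by (rule hilbert_subspace_principal_submodule)
  note MD = hilbert_subspaceD[OF hM]
  have zM: "coord_mult i f \<in> M" if "f \<in> M" for f i using that unfolding M_def by (rule coord_mult_principal_submodule)
  have bz: "bounded_operator_on M (coord_mult i)" for i unfolding M_def by (rule bounded_operator_coord_mult)
  note adj = adjoint_on[OF hM bz]
  let ?A = "\<lambda>j. adjoint_on M (coord_mult j)"
  obtain C1 where C1: "C1 \<ge> 0" and C1': "\<forall>f j. bip 0 f \<longrightarrow> (\<exists>g. bip 0 g \<and> (\<forall>e. bip 0 e \<longrightarrow>
    (\<lambda>z. eul e z + of_real (?n + 1) * e z) = dz j (\<lambda>z. ?P z * f z) \<longrightarrow>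
    nrm 0 (\<lambda>z. e z - ?P z * g z) \<le> C1 * nrm 1 (\<lambda>z. ?P z * f z)))"
    using adjoint_approximation[OF bip_eval_cpoly, of p] by (elim exE conjE)
  obtain C2 where C2: "C2 \<ge> 0" and C2': "\<forall>(F :: complex^'n \<Rightarrow> complex) G e e' i j. bip 0 F \<longrightarrow> bip 0 G \<longrightarrow> bip 0 e \<longrightarrow> bip 0 e' \<longrightarrow>
    (\<lambda>z. eul e z + of_real (?n + 1) * e z) = dz j F \<longrightarrow>
    (\<lambda>z. eul e' z + of_real (?n + 1) * e' z) = dz i G \<longrightarrow>
    norm (ip 0 e e' - ip 0 (\<lambda>z. z $ i * F z) (\<lambda>z. z $ j * G z)) \<le> C2 * nrm 1 F * nrm 1 G"
    using bergman_commutator_bound[where 'n = 'n] by (elim exE conjE)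
  have err: "(\<forall>h\<in>M. cinner h (polb e - ?A j (?q f)) = 0) \<and> norm (polb e - ?A j (?q f)) \<le> C1 * nrm 1 (\<lambda>z. ?P z * f z)"
    if f: "bip 0 f" and e: "bip 0 e" "(\<lambda>z. eul e z + of_real (?n + 1) * e z) = dz j (\<lambda>z. ?P z * f z)" for f e j
  proof -
    let ?d = "polb e - ?A j (?q f)"
    have A: "?A j (?q f) \<in> M" by (rule adj(1)[OF DM[OF f]])
    have "cinner (?q g) ?d = 0" if g: "bip 0 g" for g
    proof -
      have "cinner (?q g) (?A j (?q f)) = cinner (coord_mult j (?q g)) (?q f)"
        by (rule adj(2)[OF DM[OF f] DM[OF g], symmetric])
      also have "\<dots> = ip 0 (\<lambda>z. z $ j * (?P z * g z)) (\<lambda>z. ?P z * f z)"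
        unfolding coord_mult_polb[OF bip_cpoly_mult[OF g]]
        by (rule cinner_polb[OF bip_coord_mult[OF bip_cpoly_mult[OF g]] bip_cpoly_mult[OF f]])
      also have "\<dots> = ip 0 (\<lambda>z. ?P z * g z) e"
        by (rule ip_coord_adjoint[OF e bip_cpoly_mult[OF f] bip_cpoly_mult[OF g]])
      also have "\<dots> = cinner (?q g) (polb e)" by (rule cinner_polb[OF bip_cpoly_mult[OF g] e(1), symmetric])
      finally show ?thesis by (simp add: cinner_simps)
    qed
    moreover have "closed {h. cinner h ?d = 0}"
      by (intro closed_Collect_eq linear_continuous_on continuous_on_const
          bounded_bilinear.bounded_linear_left[OF bounded_bilinear_cinner])
    ultimately have "closure ?D \<subseteq> {h. cinner h ?d = 0}" by (intro closure_minimal) auto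
    then have orth: "\<forall>h\<in>M. cinner h ?d = 0" unfolding M by blast
    \<comment> \<open>As the error is orthogonal to \<open>M\<close>, its norm is at most the
      distance from \<open>polb e\<close> to the explicit element \<open>?q g\<close> of
      \<open>M\<close>.\<close>
    from C1'[rule_format, OF f, of j] obtain g where g0: "bip 0 g" and g1: "\<forall>e. bip 0 e \<longrightarrow>
      (\<lambda>z. eul e z + of_real (?n + 1) * e z) = dz j (\<lambda>z. ?P z * f z) \<longrightarrow>
      nrm 0 (\<lambda>z. e z - ?P z * g z) \<le> C1 * nrm 1 (\<lambda>z. ?P z * f z)" by (elim exE conjE)
    note g = g0 g1[rule_format, OF e]
    have "cinner ?d ?d = cinner (polb e - ?q g) ?d + cinner (?q g - ?A j (?q f)) ?d"
      unfolding cinner_simps(1)[symmetric] by simp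
    also have "cinner (?q g - ?A j (?q f)) ?d = 0" using orth MD(5)[OF DM[OF g(1)] A] by blast
    finally have "norm (cinner ?d ?d) = norm (cinner (polb e - ?q g) ?d)" by simp
    then have "(norm ?d)\<^sup>2 = norm (cinner (polb e - ?q g) ?d)" unfolding cinner_norm by (simp add: norm_power)
    also have "\<dots> \<le> norm (polb e - ?q g) * norm ?d" by (rule cinner_bound)
    finally have "norm ?d * norm ?d \<le> norm (polb e - ?q g) * norm ?d" by (simp add: power2_eq_square)
    then have "norm ?d \<le> norm (polb e - ?q g)"
      by (cases "norm ?d = 0") (auto simp: mult_le_cancel_right)
    also have "\<dots> = nrm 0 (\<lambda>z. e z - ?P z * g z)"
      unfolding polb_diff[OF e(1) bip_cpoly_mult[OF g(1)], symmetric]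
      by (rule norm_polb[OF bip_diff[OF e(1) bip_cpoly_mult[OF g(1)]]])
    finally show ?thesis using orth g(2) by auto
  qed
  have poly: "norm (cinner (adj_commutator M (coord_mult i) (coord_mult j) (?q f)) (?q g)) \<le> (C1 * C1 + C2) * wnorm (?q f) * wnorm (?q g)"
    if f: "bip 0 f" and g: "bip 0 g" for f g i j
  proof -
    note bf = bip_cpoly_mult[OF f, of p] and bg = bip_cpoly_mult[OF g, of p]
    obtain e where e: "bip 0 e" "(\<lambda>z. eul e z + of_real (?n + 1) * e z) = dz j (\<lambda>z. ?P z * f z)"
      using eul_solve[OF bip_dz[OF bf], of "?n + 1" j] by auto
    obtain e' where e': "bip 0 e'" "(\<lambda>z. eul e' z + of_real (?n + 1) * e' z) = dz i (\<lambda>z. ?P z * g z)"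
      using eul_solve[OF bip_dz[OF bg], of "?n + 1" i] by auto
    let ?d = "polb e - ?A j (?q f)" and ?d' = "polb e' - ?A i (?q g)"
    note d = err[OF f e] and d' = err[OF g e']
    have AM: "?A j (?q f) \<in> M" "?A i (?q g) \<in> M" by (intro adj(1) DM f g)+
    have "cinner (adj_commutator M (coord_mult i) (coord_mult j) (?q f)) (?q g)
        = cinner (coord_mult i (?A j (?q f))) (?q g) - cinner (?A j (coord_mult i (?q f))) (?q g)"
      by (simp add: adj_commutator_def cinner_simps)
    also have "cinner (coord_mult i (?A j (?q f))) (?q g) = cinner (?A j (?q f)) (?A i (?q g))"
      by (rule adj(2)[OF DM[OF g] AM(1)])
    also have "cinner (?A j (coord_mult i (?q f))) (?q g) = cinner (coord_mult i (?q f)) (coord_mult j (?q g))"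
    proof -
      have "cnj (cinner (?q g) (?A j (coord_mult i (?q f)))) = cnj (cinner (coord_mult j (?q g)) (coord_mult i (?q f)))"
        by (rule arg_cong[OF adj(2)[OF zM[OF DM[OF f]] DM[OF g], symmetric]])
      then show ?thesis unfolding cinner_cnj .
    qed
    also have "\<dots> = ip 0 (\<lambda>z. z $ i * (?P z * f z)) (\<lambda>z. z $ j * (?P z * g z))"
      unfolding coord_mult_polb[OF bf] coord_mult_polb[OF bg]
      by (rule cinner_polb[OF bip_coord_mult[OF bf] bip_coord_mult[OF bg]])
    \<comment> \<open>Both cross terms vanish, since the adjoints lie in \<open>M\<close> and the
      errors are orthogonal to it.\<close>
    also have "cinner (?A j (?q f)) (?A i (?q g)) = cinner (polb e) (polb e') - cinner ?d ?d'"
    proof -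
      have "cinner (?A j (?q f)) ?d' = 0" using d' AM(1) by blast
      moreover have "cinner ?d (?A i (?q g)) = 0" using d AM(2) cinner_cnj[of "?A i (?q g)" ?d] by simp
      moreover have "cinner (polb e) (polb e') = cinner (?d + ?A j (?q f)) (?d' + ?A i (?q g))" by simp
      ultimately show ?thesis unfolding cinner_simps(1,2) by simp
    qed
    also have "cinner (polb e) (polb e') = ip 0 e e'" by (rule cinner_polb[OF e(1) e'(1)])
    finally have "cinner (adj_commutator M (coord_mult i) (coord_mult j) (?q f)) (?q g) =
        (ip 0 e e' - ip 0 (\<lambda>z. z $ i * (?P z * f z)) (\<lambda>z. z $ j * (?P z * g z))) - cinner ?d ?d'" by simp
    then have "norm (cinner (adj_commutator M (coord_mult i) (coord_mult j) (?q f)) (?q g)) \<le>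
        norm (ip 0 e e' - ip 0 (\<lambda>z. z $ i * (?P z * f z)) (\<lambda>z. z $ j * (?P z * g z))) + norm (cinner ?d ?d')"
      by (simp only: norm_triangle_ineq4)
    also have "\<dots> \<le> C2 * nrm 1 (\<lambda>z. ?P z * f z) * nrm 1 (\<lambda>z. ?P z * g z)
        + (C1 * nrm 1 (\<lambda>z. ?P z * f z)) * (C1 * nrm 1 (\<lambda>z. ?P z * g z))"
    proof (rule add_mono)
      show "norm (ip 0 e e' - ip 0 (\<lambda>z. z $ i * (?P z * f z)) (\<lambda>z. z $ j * (?P z * g z)))
          \<le> C2 * nrm 1 (\<lambda>z. ?P z * f z) * nrm 1 (\<lambda>z. ?P z * g z)"
        by (rule C2'[rule_format, OF bf bg e(1) e'(1) e(2) e'(2)])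
      show "norm (cinner ?d ?d') \<le> (C1 * nrm 1 (\<lambda>z. ?P z * f z)) * (C1 * nrm 1 (\<lambda>z. ?P z * g z))"
        using d d' C1 by (intro order_trans[OF cinner_bound] mult_mono) auto
    qed
    finally show ?thesis unfolding wnorm_polb[OF bf] wnorm_polb[OF bg] by (simp add: algebra_simps)
  qed
  have bT: "bounded_operator_on M (adj_commutator M (coord_mult i) (coord_mult j))" for i j
    unfolding M_def by (rule bounded_operator_adj_commutator)
  have "norm (cinner (adj_commutator M (coord_mult i) (coord_mult j) F) G) \<le> (C1 * C1 + C2) * wnorm F * wnorm G"
    if F: "F \<in> M" and G: "G \<in> M" for F G i j
  proof -
    let ?T = "adj_commutator M (coord_mult i) (coord_mult j)"
    obtain x y where x: "\<forall>n. x n \<in> ?D" "x \<longlonglongrightarrow> F" and y: "\<forall>n. y n \<in> ?D" "y \<longlonglongrightarrow> G"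
      using F G unfolding M closure_sequential by blast
    have xM: "x n \<in> M" for n
      unfolding M by (rule set_mp[OF closure_subset x(1)[rule_format]])
    obtain B where B: "\<forall>f\<in>M. norm (?T f) \<le> B * norm f" using bT[of i j] unfolding bounded_operator_on_def by blast
    have Tdiff: "?T (a - b) = ?T a - ?T b" if "a \<in> M" "b \<in> M" for a b
    proof -
      have "?T (b + (a - b)) = ?T b + ?T (a - b)" using bT[of i j] that MD(5) unfolding bounded_operator_on_def by blast
      then show ?thesis by simp
    qed
    have "(\<lambda>n. ?T (x n)) \<longlonglongrightarrow> ?T F"
    proof (rule LIM_zero_cancel, rule Lim_null_comparison)
      have "norm (?T (x n) - ?T F) \<le> B * norm (x n - F)" for n
        using B MD(5)[OF xM F] Tdiff[OF xM F] by metis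
      then show "\<forall>\<^sub>F n in sequentially. norm (?T (x n) - ?T F) \<le> B * norm (x n - F)" by simp
      show "(\<lambda>n. B * norm (x n - F)) \<longlonglongrightarrow> 0"
        by (rule tendsto_mult_right_zero[OF tendsto_norm_zero[OF LIM_zero[OF x(2)]]])
    qed
    then have "(\<lambda>n. norm (cinner (?T (x n)) (y n))) \<longlonglongrightarrow> norm (cinner (?T F) G)"
      by (intro tendsto_norm bounded_bilinear.tendsto[OF bounded_bilinear_cinner] y)
    moreover have "(\<lambda>n. (C1 * C1 + C2) * wnorm (x n) * wnorm (y n)) \<longlonglongrightarrow> (C1 * C1 + C2) * wnorm F * wnorm G"
      by (intro tendsto_mult tendsto_const wnorm_tendsto x y)
    moreover have "norm (cinner (?T (x n)) (y n)) \<le> (C1 * C1 + C2) * wnorm (x n) * wnorm (y n)" for n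
    proof -
      obtain f g where "bip 0 f" "x n = ?q f" "bip 0 g" "y n = ?q g" using x(1) y(1) by blast
      then show ?thesis using poly by simp
    qed
    ultimately show ?thesis by (intro LIMSEQ_le) auto
  qed
  then show ?thesis using C1 C2 by (intro exI[of _ "C1 * C1 + C2"]) auto
qed

text \<open>A nearby polynomial is split into its parts of degree below \<open>d\<close> and at
  least \<open>d\<close>. The low part is small because \<open>X\<close> and the high part are
  orthogonal to it, and \<open>nrm_high_degree\<close> treats the high part.\<close>

lemma wnorm_le_of_orthogonal:
  fixes X :: "'n::finite bergman"
  assumes X: "X \<in> closure (polb ` {u. bip 0 u})"
    and orth: "\<And>m. mdeg m < d \<Longrightarrow> cinner X (polb (zpow m)) = 0"
  shows "sqrt (real d + 1) * wnorm X \<le> norm X"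
proof (rule field_le_epsilon)
  fix e :: real assume e: "e > 0"
  define s where "s = sqrt (real d + 1)"
  have s: "s \<ge> 1" by (simp add: s_def)
  \<comment> \<open>The approximation error enters twice with the factor \<open>s\<close> and twice
    with the factor 1.\<close>
  define \<delta> where "\<delta> = e / (2 * s + 2)"
  have \<delta>: "\<delta> > 0" "(2 * s + 2) * \<delta> = e" using e s by (auto simp: \<delta>_def)
  obtain Y where Y: "Y \<in> polb ` {u. bip 0 u}" "dist Y X < \<delta>"
    using X \<delta>(1) unfolding closure_approachable by blast
  then obtain u where u: "bip 0 u" "Y = polb u" by blast
  obtain S c where S: "finite S" "u = (\<lambda>z. \<Sum>m\<in>S. c m * zpow m z)" using zpow_expansion[OF u(1)] .
  define A where "A = {m\<in>S. mdeg m < d}"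
  define v where "v = (\<lambda>z. \<Sum>m\<in>A. c m * zpow m z)"
  define h where "h = (\<lambda>z. \<Sum>m\<in>S - A. c m * zpow m z)"
  have fin: "finite A" "finite (S - A)" using S(1) by (auto simp: A_def)
  have bs: "bip 0 (\<lambda>z. c m * zpow m z)" for m by (intro bip_scale bip_zpow)
  have v: "bip 0 v" and h: "bip 0 h" unfolding v_def h_def by (intro bip_sum bs)+
  have uvh: "u = (\<lambda>z. v z + h z)"
  proof -
    have AS: "A \<subseteq> S" by (auto simp: A_def)
    show ?thesis unfolding S(2) v_def h_def sum.subset_diff[OF AS S(1)] by (simp add: add.commute)
  qed
  have Yvh: "Y = polb v + polb h" unfolding u(2) uvh by (rule polb_add[OF v h])
  have dYX: "norm (Y - X) < \<delta>" using Y(2) by (simp add: dist_norm)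
  have "cinner X (polb v) = 0"
  proof -
    have "polb (\<lambda>z. \<Sum>m\<in>B. c m * zpow m z) = (\<Sum>m\<in>B. scaleC (c m) (polb (zpow m)))" if "finite B" for B
      using that
    proof (induction B)
      case (insert m B)
      then show ?case by (simp add: polb_add[OF bs bip_sum[OF bs]] polb_scale[OF bip_zpow])
    qed (simp add: polb_zero)
    from this[OF fin(1)] have "cinner X (polb v) = (\<Sum>m\<in>A. cnj (c m) * cinner X (polb (zpow m)))"
      unfolding v_def by (simp add: bounded_bilinear.sum_right[OF bounded_bilinear_cinner] cinner_simps)
    also have "\<dots> = 0" using orth by (intro sum.neutral) (auto simp: A_def)
    finally show ?thesis .
  qed
  moreover have "cinner (polb h) (polb v) = 0"
  proof -
    have e: "(S - A) \<inter> A = {}" by blast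
    show ?thesis unfolding cinner_polb[OF h v] unfolding h_def v_def ip_zpow_sums[OF fin(2) fin(1)] e by simp
  qed
  ultimately have "cinner (polb v) (polb v) = cinner (Y - X) (polb v)"
    by (simp add: Yvh cinner_simps)
  then have "norm (complex_of_real ((norm (polb v))\<^sup>2)) = norm (cinner (Y - X) (polb v))" by (simp only: cinner_norm)
  then have "(norm (polb v))\<^sup>2 = norm (cinner (Y - X) (polb v))" by (simp add: norm_power)
  also have "\<dots> \<le> norm (Y - X) * norm (polb v)" by (rule cinner_bound)
  finally have nv: "norm (polb v) \<le> norm (Y - X)"
    by (cases "norm (polb v) = 0") (auto simp: power2_eq_square)
  have "(s * wnorm (polb h))\<^sup>2 \<le> (norm (polb h))\<^sup>2"
  proof -
    have "(real d + 1) * (nrm 1 h)\<^sup>2 \<le> (nrm 0 h)\<^sup>2"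
      unfolding h_def by (rule nrm_high_degree[OF fin(2)]) (auto simp: A_def)
    then show ?thesis unfolding wnorm_polb[OF h] norm_polb[OF h] power_mult_distrib by (simp add: s_def)
  qed
  then have h1: "s * wnorm (polb h) \<le> norm (polb h)" by (rule power2_le_imp_le) simp
  have "X = polb h + (polb v - (Y - X))" by (simp add: Yvh)
  then have "wnorm X \<le> wnorm (polb h) + (norm (polb v) + norm (Y - X))"
    by (metis order_trans[OF wnorm_add] add_left_mono order_trans[OF wnorm_le_norm norm_triangle_ineq4])
  then have "s * wnorm X \<le> s * (wnorm (polb h) + (norm (polb v) + norm (Y - X)))" using s by (intro mult_left_mono) auto
  also have "\<dots> = s * wnorm (polb h) + s * (norm (polb v) + norm (Y - X))" by (rule distrib_left)
  also have "\<dots> \<le> norm (polb h) + s * (\<delta> + \<delta>)"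
    using h1 nv dYX s by (intro add_mono mult_left_mono) auto
  also have "norm (polb h) \<le> norm X + (\<delta> + \<delta>)"
  proof -
    have "polb h = X + ((Y - X) - polb v)" by (simp add: Yvh)
    then have "norm (polb h) \<le> norm X + norm ((Y - X) - polb v)" by (metis norm_triangle_ineq)
    also have "norm ((Y - X) - polb v) \<le> norm (Y - X) + norm (polb v)" by (rule norm_triangle_ineq4)
    finally show ?thesis using nv dYX by linarith
  qed
  finally show "sqrt (real d + 1) * wnorm X \<le> norm X + e"
    unfolding s_def[symmetric] \<delta>(2)[symmetric] by (simp add: algebra_simps)
qed

section \<open>Singular values\<close>

text \<open>Gaussian elimination: an equation with nonzero coefficient at \<open>i0\<close> serves
  to remove the unknown \<open>i0\<close> from the others.\<close>

lemma underdetermined_system: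
  fixes a :: "'j \<Rightarrow> 'i \<Rightarrow> complex"
  assumes "finite J" "finite I" "card J < card I"
  shows "\<exists>c. (\<exists>i\<in>I. c i \<noteq> 0) \<and> (\<forall>j\<in>J. (\<Sum>i\<in>I. c i * a j i) = 0)"
  using assms
proof (induction J arbitrary: I a rule: finite_induct)
  case empty
  then have "I \<noteq> {}" by auto
  then show ?case by (intro exI[of _ "\<lambda>_. 1"]) auto
next
  case (insert j J)
  show ?case
  proof (cases "\<forall>i\<in>I. a j i = 0")
    case True
    have "card J < card I" using insert by simp
    from insert.IH[OF insert.prems(1) this, of a] obtain c where c: "\<exists>i\<in>I. c i \<noteq> 0" "\<forall>j\<in>J. (\<Sum>i\<in>I. c i * a j i) = 0" by blast
    have "(\<Sum>i\<in>I. c i * a j i) = 0" using True by (intro sum.neutral) simp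
    then show ?thesis using c by (intro exI[of _ c]) simp
  next
    case False
    then obtain i0 where i0: "i0 \<in> I" "a j i0 \<noteq> 0" by blast
    define I' where "I' = I - {i0}"
    have I': "finite I'" "card J < card I'" using insert i0 by (auto simp: I'_def)
    from insert.IH[OF I', of "\<lambda>k i. a k i - a j i / a j i0 * a k i0"]
    obtain c where c: "\<exists>i\<in>I'. c i \<noteq> 0" "\<forall>k\<in>J. (\<Sum>i\<in>I'. c i * (a k i - a j i / a j i0 * a k i0)) = 0" by blast
    \<comment> \<open>The value of the unknown \<open>i0\<close> that solves equation
      \<open>j\<close>.\<close>
    define t where "t = - (\<Sum>i\<in>I'. c i * a j i) / a j i0"
    define c' where "c' = (\<lambda>i. if i = i0 then t else c i)"
    have s: "(\<Sum>i\<in>I. c' i * b i) = t * b i0 + (\<Sum>i\<in>I'. c i * b i)" for b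
    proof -
      have "(\<Sum>i\<in>I. c' i * b i) = c' i0 * b i0 + (\<Sum>i\<in>I'. c' i * b i)"
        unfolding I'_def by (rule sum.remove[OF insert.prems(1) i0(1)])
      also have "(\<Sum>i\<in>I'. c' i * b i) = (\<Sum>i\<in>I'. c i * b i)"
        by (intro sum.cong) (auto simp: c'_def I'_def)
      finally show ?thesis by (simp add: c'_def)
    qed
    have "(\<Sum>i\<in>I. c' i * a k i) = 0" if k: "k \<in> insert j J" for k
    proof (cases "k = j")
      case True
      then show ?thesis unfolding s using i0 by (simp add: t_def)
    next
      case False
      then have "(\<Sum>i\<in>I'. c i * (a k i - a j i / a j i0 * a k i0)) = 0" using c(2) k by simp
      then have "(\<Sum>i\<in>I'. c i * a k i) = (\<Sum>i\<in>I'. c i * a j i * (a k i0 / a j i0))"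
        by (simp add: right_diff_distrib sum_subtractf mult_ac)
      then show ?thesis unfolding s t_def by (simp add: sum_distrib_right sum_divide_distrib)
    qed
    moreover have "\<exists>i\<in>I. c' i \<noteq> 0" using c(1) by (auto simp: c'_def I'_def)
    ultimately show ?thesis by (intro exI[of _ c']) simp
  qed
qed

text \<open>Preparation for compactness: a bounded set is cut into finitely many pieces on which
  finitely many coefficients are nearly constant. Each further functional refines the pieces by
  small discs that cover a disc of radius \<open>K\<close>.\<close>

lemma finite_cover_functionals:
  fixes L :: "'m \<Rightarrow> 'x \<Rightarrow> complex"
  assumes "finite A" "\<And>a x. a \<in> A \<Longrightarrow> x \<in> B \<Longrightarrow> norm (L a x) \<le> K" "\<delta> > 0"
  shows "\<exists>\<C>. finite \<C> \<and> B \<subseteq> \<Union>\<C> \<and> (\<forall>c\<in>\<C>. \<forall>x\<in>c. \<forall>y\<in>c. \<forall>a\<in>A. norm (L a x - L a y) \<le> \<delta>)"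
  using assms
proof (induction A rule: finite_induct)
  case empty
  show ?case by (intro exI[of _ "{B}"]) auto
next
  case (insert a A)
  obtain \<C> where \<C>: "finite \<C>" "B \<subseteq> \<Union>\<C>" "\<forall>c\<in>\<C>. \<forall>x\<in>c. \<forall>y\<in>c. \<forall>a\<in>A. norm (L a x - L a y) \<le> \<delta>"
    using insert.IH insert.prems by auto
  have "compact (cball 0 K :: complex set)" by simp
  then obtain W where W: "finite W" "cball (0::complex) K \<subseteq> (\<Union>w\<in>W. ball w (\<delta> / 2))"
    using insert.prems(2) unfolding compact_eq_totally_bounded by (meson half_gt_zero)
  define \<D> where "\<D> = (\<lambda>(c, w). {x\<in>c. L a x \<in> ball w (\<delta> / 2)}) ` (\<C> \<times> W)"
  have "finite \<D>" using \<C>(1) W(1) by (simp add: \<D>_def)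
  moreover have "B \<subseteq> \<Union>\<D>"
  proof
    fix x assume x: "x \<in> B"
    then obtain c where c: "c \<in> \<C>" "x \<in> c" using \<C>(2) by blast
    have "L a x \<in> cball 0 K" using insert.prems(1)[of a x] x by simp
    then obtain w where w: "w \<in> W" "L a x \<in> ball w (\<delta> / 2)" using W(2) by blast
    have "x \<in> {x\<in>c. L a x \<in> ball w (\<delta> / 2)}" using c w by simp
    then show "x \<in> \<Union>\<D>" unfolding \<D>_def using c(1) w(1) by blast
  qed
  moreover have "norm (L b x - L b y) \<le> \<delta>" if d: "d \<in> \<D>" and xy: "x \<in> d" "y \<in> d" and b: "b \<in> insert a A" for d x y b
  proof -
    obtain c w where cw: "c \<in> \<C>" "w \<in> W" "d = {x\<in>c. L a x \<in> ball w (\<delta> / 2)}" using d by (auto simp: \<D>_def)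
    show ?thesis
    proof (cases "b = a")
      case True
      have "dist w (L a x) < \<delta> / 2" "dist w (L a y) < \<delta> / 2" using xy cw(3) by auto
      then have "dist (L a x) (L a y) < \<delta>" by (rule dist_triangle_half_r)
      then show ?thesis using True by (simp add: dist_norm)
    next
      case False
      then show ?thesis using \<C>(3) cw xy b by auto
    qed
  qed
  ultimately show ?case by (intro exI[of _ \<D>]) blast
qed

lemma cinner_zpow_orthogonal: "m \<noteq> m' \<Longrightarrow> cinner (polb (zpow m)) (polb (zpow m')) = 0"
  unfolding cinner_polb[OF bip_zpow bip_zpow] by (rule ip_zpow_orthogonal)

text \<open>As the submodule generated by 1, the closure of all polynomials inherits completeness
  and the subspace properties.\<close>

lemma closure_polb_eq: "closure (polb ` {u. bip 0 u}) = principal_submodule 1"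
proof -
  have "eval_cpoly 1 z = 1" for z :: "complex^'a"
    using eval_cpoly_single[of 0 1 z] by simp
  then show ?thesis unfolding principal_submodule_eq by simp
qed

text \<open>Here the orthogonality of \<open>wnorm_le_of_orthogonal\<close> is relaxed to small
  coefficients: subtracting \<open>Y\<close>, the projection to degrees below \<open>d\<close>,
  restores it, and \<open>norm Y\<close> is at most \<open>\<delta> * K\<close>.\<close>

lemma wnorm_finite_rank_bound:
  fixes Z :: "'n::finite bergman"
  assumes Z: "Z \<in> closure (polb ` {u. bip 0 u})" and \<delta>: "\<And>m. mdeg m < d \<Longrightarrow> norm (cinner Z (polb (zpow m))) \<le> \<delta>"
  defines "K \<equiv> \<Sum>m | mdeg m < d. 1 / norm (polb (zpow m :: complex^'n \<Rightarrow> complex))"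
  shows "sqrt (real d + 1) * wnorm Z \<le> norm Z + (sqrt (real d + 1) + 1) * (\<delta> * K)"
proof -
  let ?e = "\<lambda>m. polb (zpow m) :: 'n bergman" and ?A = "{m :: 'n \<Rightarrow>\<^sub>0 nat. mdeg m < d}"
  define s where "s = sqrt (real d + 1)"
  have s: "s \<ge> 0" by (simp add: s_def)
  have fin: "finite ?A" using card_mdeg_less by blast
  define c where "c = (\<lambda>m. cinner Z (?e m) / of_real ((norm (?e m))\<^sup>2))"
  define Y where "Y = (\<Sum>m\<in>?A. scaleC (c m) (?e m))"
  note H = hilbert_subspace_principal_submodule[of "1 :: 'n cpoly", folded closure_polb_eq]
  have eM: "?e m \<in> closure (polb ` {u. bip 0 u})" for m
    by (rule set_mp[OF closure_subset], rule imageI) (simp add: bip_zpow)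
  have "finite B \<Longrightarrow> (\<Sum>m\<in>B. scaleC (c m) (?e m)) \<in> closure (polb ` {u. bip 0 u})" for B
    by (induction B rule: finite_induct) (auto intro: hilbert_subspaceD[OF H] eM)
  then have YM: "Y \<in> closure (polb ` {u. bip 0 u})" unfolding Y_def using fin by blast
  have "cinner (Z - Y) (?e k) = 0" if k: "mdeg k < d" for k
  proof (cases "?e k = 0")
    case True
    then show ?thesis using bounded_bilinear.zero_right[OF bounded_bilinear_cinner] by simp
  next
    case False
    have "cinner Y (?e k) = (\<Sum>m\<in>?A. c m * cinner (?e m) (?e k))"
      unfolding Y_def bounded_bilinear.sum_left[OF bounded_bilinear_cinner] cinner_simps(5) ..
    also have "\<dots> = (\<Sum>m\<in>?A. if m = k then c k * of_real ((norm (?e k))\<^sup>2) else 0)"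
      by (intro sum.cong refl) (auto simp: cinner_zpow_orthogonal cinner_norm)
    also have "\<dots> = c k * of_real ((norm (?e k))\<^sup>2)" using fin k by simp
    also have "\<dots> = cinner Z (?e k)" using False by (simp add: c_def)
    finally show ?thesis by (simp add: cinner_simps)
  qed
  then have 1: "s * wnorm (Z - Y) \<le> norm (Z - Y)"
    unfolding s_def by (intro wnorm_le_of_orthogonal hilbert_subspaceD(5)[OF H] Z YM)
  have "norm (scaleC (c m) (?e m)) \<le> \<delta> * (1 / norm (?e m))" if "m \<in> ?A" for m
  \<comment> \<open>Division by zero yields 0, so in this case both sides are 0.\<close>
  proof (cases "?e m = 0")
    case True
    then show ?thesis by (simp add: norm_scaleC)
  next
    case False
    have "norm (scaleC (c m) (?e m)) = norm (cinner Z (?e m)) / norm (?e m)"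
      using False by (simp add: norm_scaleC c_def norm_divide norm_mult power2_eq_square)
    also have "\<dots> \<le> \<delta> / norm (?e m)" using \<delta> that by (intro divide_right_mono) auto
    finally show ?thesis by simp
  qed
  then have "norm Y \<le> (\<Sum>m\<in>?A. \<delta> * (1 / norm (?e m)))" unfolding Y_def by (rule sum_norm_le)
  then have Y: "norm Y \<le> \<delta> * K" unfolding K_def sum_distrib_left .
  have "s * wnorm Z \<le> s * (wnorm (Z - Y) + norm Y)"
    using wnorm_add[of "Z - Y" Y] wnorm_le_norm[of Y] s by (intro mult_left_mono) auto
  also have "\<dots> \<le> norm (Z - Y) + s * norm Y" using 1 by (simp add: distrib_left)
  also have "\<dots> \<le> norm Z + (s + 1) * norm Y" using norm_triangle_ineq4[of Z Y] by (simp add: distrib_right)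
  also have "\<dots> \<le> norm Z + (s + 1) * (\<delta> * K)" using Y s by (intro add_left_mono mult_left_mono) auto
  finally show ?thesis unfolding s_def .
qed

text \<open>Isolates what the spectral argument needs: the product bound by \<open>wnorm\<close>
  counts, while the origin of \<open>T\<close> as a commutator is forgotten.\<close>

locale wnorm_bounded_operator =
  fixes M :: "'n::finite bergman set" and T :: "'n bergman \<Rightarrow> 'n bergman" and C :: real
  assumes M: "hilbert_subspace M" and M_polb: "M \<subseteq> closure (polb ` {u. bip 0 u})"
    and T: "bounded_operator_on M T" and C: "C \<ge> 0"
    and bound: "\<And>F G. F \<in> M \<Longrightarrow> G \<in> M \<Longrightarrow> norm (cinner (T F) G) \<le> C * wnorm F * wnorm G"
begin

lemmas MD = hilbert_subspaceD[OF M]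

lemma T_closed: "F \<in> M \<Longrightarrow> T F \<in> M"
  and T_add: "F \<in> M \<Longrightarrow> G \<in> M \<Longrightarrow> T (F + G) = T F + T G"
  and T_scale: "F \<in> M \<Longrightarrow> T (scaleC c F) = scaleC c (T F)"
  using T unfolding bounded_operator_on_def by blast+

lemma T_diff: "F \<in> M \<Longrightarrow> G \<in> M \<Longrightarrow> T (F - G) = T F - T G"
  using T_add[of G "F - G"] MD(5)[of F G] by simp

text \<open>Take \<open>G = T F\<close> in the bound and give up the gain on that factor.\<close>

lemma norm_T: assumes "F \<in> M" shows "norm (T F) \<le> C * wnorm F"
proof -
  have "(norm (T F))\<^sup>2 = norm (cinner (T F) (T F))" unfolding cinner_norm by (simp add: norm_power)
  also have "\<dots> \<le> C * wnorm F * wnorm (T F)" by (intro bound T_closed assms)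
  also have "\<dots> \<le> C * wnorm F * norm (T F)" using C by (intro mult_left_mono wnorm_le_norm) auto
  finally show ?thesis using C
    by (cases "norm (T F) = 0") (auto simp: power2_eq_square mult_le_cancel_right)
qed

text \<open>Total boundedness: the unit ball of \<open>M\<close> is cut into finitely many pieces of
  nearly equal low-degree coefficients. Differences within a piece have small \<open>wnorm\<close>,
  so \<open>norm_T\<close> makes their images close.\<close>

lemma compact_T: "compact (closure (T ` (M \<inter> cball 0 1)))"
proof -
  let ?B = "M \<inter> cball 0 1"
  have clM: "closed M" using MD(4) by (rule complete_imp_closed)
  have "closure (T ` ?B) \<subseteq> M" using T_closed by (intro closure_minimal clM) auto
  then have comp: "complete (closure (T ` ?B))"
    using complete_Int_closed[OF MD(4) closed_closure, of "T ` ?B"] by (simp add: Int_absorb1)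
  have "\<exists>k. finite k \<and> closure (T ` ?B) \<subseteq> (\<Union>x\<in>k. ball x e)" if e: "e > 0" for e
  proof -
    define \<epsilon> where "\<epsilon> = e / (4 * (C + 1))"
    have \<epsilon>: "\<epsilon> > 0" "C * \<epsilon> \<le> e / 4" using e C by (auto simp: \<epsilon>_def field_simps)
    \<comment> \<open>For \<open>s \<ge> 4 / \<epsilon>\<close> the diameter 2 is at most
      \<open>s * (\<epsilon> / 2)\<close>; the later choice of \<open>\<delta>\<close> bounds the
      low-degree contribution by the same amount.\<close>
    obtain d :: nat where d: "(4 / \<epsilon>)\<^sup>2 < real d" using reals_Archimedean2 by blast
    define s where "s = sqrt (real d + 1)"
    have s: "4 / \<epsilon> \<le> s" "s \<ge> 1" unfolding s_def using d \<epsilon> by (auto intro: real_le_rsqrt)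
    let ?A = "{m :: 'n \<Rightarrow>\<^sub>0 nat. mdeg m < d}" and ?e = "\<lambda>m. polb (zpow m) :: 'n bergman"
    have fin: "finite ?A" using card_mdeg_less by blast
    define K where "K = (\<Sum>m\<in>?A. 1 / norm (?e m))"
    have K: "K \<ge> 0" unfolding K_def by (intro sum_nonneg) auto
    define \<delta> where "\<delta> = \<epsilon> / (4 * (K + 1))"
    have \<delta>: "\<delta> > 0" using \<epsilon> K by (simp add: \<delta>_def)
    have \<delta>K: "\<delta> * K \<le> \<epsilon> / 4" unfolding \<delta>_def using \<epsilon> K by (simp add: field_simps)
    have bnd: "norm (cinner x (?e m)) \<le> (\<Sum>m\<in>?A. norm (?e m))" if "m \<in> ?A" "x \<in> ?B" for m x
    proof -
      have "norm (cinner x (?e m)) \<le> norm x * norm (?e m)" by (rule cinner_bound)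
      also have "\<dots> \<le> 1 * norm (?e m)" using that by (intro mult_right_mono) auto
      also have "norm (?e m) \<le> (\<Sum>m\<in>?A. norm (?e m))" using fin that by (intro member_le_sum) auto
      finally show ?thesis by simp
    qed
    have "\<exists>\<C>. finite \<C> \<and> ?B \<subseteq> \<Union>\<C> \<and>
      (\<forall>c\<in>\<C>. \<forall>x\<in>c. \<forall>y\<in>c. \<forall>m\<in>?A. norm (cinner x (?e m) - cinner y (?e m)) \<le> \<delta>)"
      by (rule finite_cover_functionals[where L = "\<lambda>m x. cinner x (?e m)", OF fin _ \<delta>]) (rule bnd)
    then obtain \<C> where \<C>: "finite \<C>" "?B \<subseteq> \<Union>\<C>"
      "\<forall>c\<in>\<C>. \<forall>x\<in>c. \<forall>y\<in>c. \<forall>m\<in>?A. norm (cinner x (?e m) - cinner y (?e m)) \<le> \<delta>" by (elim exE conjE)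
    have close: "norm (T x - T y) \<le> e / 2" if xy: "x \<in> ?B" "y \<in> ?B" and c: "c \<in> \<C>" "x \<in> c" "y \<in> c" for x y c
    proof -
      have Z: "x - y \<in> M" using xy by (intro MD(5)) auto
      have "norm (cinner (x - y) (?e m)) \<le> \<delta>" if "mdeg m < d" for m
        using \<C>(3) c that by (simp add: cinner_simps)
      then have "s * wnorm (x - y) \<le> norm (x - y) + (s + 1) * (\<delta> * K)"
        unfolding s_def K_def using Z M_polb by (intro wnorm_finite_rank_bound) auto
      moreover have "norm (x - y) \<le> 2" using xy norm_triangle_ineq4[of x y] by auto
      moreover have "(s + 1) * (\<delta> * K) \<le> (2 * s) * (\<epsilon> / 4)"
        using s \<delta>K \<delta> K by (intro mult_mono) auto
      moreover have "2 \<le> s * (\<epsilon> / 2)" using s \<epsilon> by (simp add: field_simps)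
      ultimately have "s * wnorm (x - y) \<le> s * (\<epsilon> / 2) + (2 * s) * (\<epsilon> / 4)" by linarith
      then have "s * wnorm (x - y) \<le> s * \<epsilon>" by (simp add: field_simps)
      then have w: "wnorm (x - y) \<le> \<epsilon>" using s by simp
      have "norm (T x - T y) \<le> C * wnorm (x - y)" using norm_T[OF Z] T_diff xy by auto
      also have "\<dots> \<le> C * \<epsilon>" using w C by (intro mult_left_mono)
      finally show ?thesis using \<epsilon>(2) e by linarith
    qed
    define \<C>' where "\<C>' = {c\<in>\<C>. c \<inter> ?B \<noteq> {}}"
    define r where "r = (\<lambda>c. SOME x. x \<in> c \<inter> ?B)"
    have r: "r c \<in> c \<inter> ?B" if "c \<in> \<C>'" for c
    proof -
      have "\<exists>x. x \<in> c \<inter> ?B" using that unfolding \<C>'_def by blast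
      then show ?thesis unfolding r_def by (rule someI_ex)
    qed
    have "T ` ?B \<subseteq> (\<Union>x\<in>(T \<circ> r) ` \<C>'. cball x (e / 2))"
    proof
      fix y assume "y \<in> T ` ?B"
      then obtain x where x: "x \<in> ?B" "y = T x" by blast
      obtain c where c: "c \<in> \<C>" "x \<in> c" using \<C>(2) x(1) by blast
      then have c': "c \<in> \<C>'" using x(1) by (auto simp: \<C>'_def)
      have "norm (T (r c) - T x) \<le> e / 2" using r[OF c'] x(1) c by (intro close) auto
      then show "y \<in> (\<Union>x\<in>(T \<circ> r) ` \<C>'. cball x (e / 2))" using c' x(2) by (auto simp: dist_norm)
    qed
    moreover have fC: "finite \<C>'" using \<C>(1) by (simp add: \<C>'_def)
    ultimately have "closure (T ` ?B) \<subseteq> (\<Union>x\<in>(T \<circ> r) ` \<C>'. cball x (e / 2))"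
      by (intro closure_minimal closed_UN) auto
    \<comment> \<open>Closed balls of half the radius survive the closure; only now are they
      enlarged to open ones.\<close>
    also have "\<dots> \<subseteq> (\<Union>x\<in>(T \<circ> r) ` \<C>'. ball x e)" using e by (intro UN_mono) auto
    finally show ?thesis using fC by (intro exI[of _ "(T \<circ> r) ` \<C>'"]) auto
  qed
  then show ?thesis unfolding compact_eq_totally_bounded using comp by blast
qed

abbreviation "eig \<sigma> \<equiv> {f \<in> M. adjoint_on M T (T f) = scaleC (of_real (\<sigma>\<^sup>2)) f}"

lemma eig_add: "f \<in> eig \<sigma> \<Longrightarrow> g \<in> eig \<sigma> \<Longrightarrow> f + g \<in> eig \<sigma>"
  and eig_scale: "f \<in> eig \<sigma> \<Longrightarrow> scaleC c f \<in> eig \<sigma>"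
  and eig_zero: "0 \<in> eig \<sigma>"
proof -
  have S: "bounded_operator_on M (\<lambda>f. adjoint_on M T (T f))"
    by (rule bounded_operator_compose[OF adjoint_bounded_operator[OF M T] T])
  then have Sa: "\<And>f g. f \<in> M \<Longrightarrow> g \<in> M \<Longrightarrow> adjoint_on M T (T (f + g)) = adjoint_on M T (T f) + adjoint_on M T (T g)"
    and Ss: "\<And>c f. f \<in> M \<Longrightarrow> adjoint_on M T (T (scaleC c f)) = scaleC c (adjoint_on M T (T f))"
    unfolding bounded_operator_on_def by blast+
  show "f \<in> eig \<sigma> \<Longrightarrow> g \<in> eig \<sigma> \<Longrightarrow> f + g \<in> eig \<sigma>"
    by (simp add: Sa MD(2) bergman.scale_right_distrib)
  show sc: "f \<in> eig \<sigma> \<Longrightarrow> scaleC c f \<in> eig \<sigma>" for f c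
    by (simp add: Ss MD(3) mult.commute)
  show "0 \<in> eig \<sigma>" using Ss[OF MD(1), of 0] MD(1) by simp
qed

lemma cinner_T_eig:
  assumes "f \<in> M" "g \<in> eig \<tau>" shows "cinner (T f) (T g) = of_real (\<tau>\<^sup>2) * cinner f g"
  using adjoint_on(2)[OF M T T_closed, of g f] assms by (simp add: cinner_simps)

text \<open>These are eigenvectors of a selfadjoint operator for the eigenvalues
  \<open>\<sigma>\<^sup>2\<close> and \<open>\<tau>\<^sup>2\<close>; positivity keeps them distinct
  after squaring.\<close>

lemma eig_orthogonal:
  assumes f: "f \<in> eig \<sigma>" and g: "g \<in> eig \<tau>" and "\<sigma> > 0" "\<tau> > 0" "\<sigma> \<noteq> \<tau>"
  shows "cinner f g = 0"
proof -
  have "of_real (\<tau>\<^sup>2) * cinner f g = cnj (cinner (T g) (T f))"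
    unfolding cinner_cnj using cinner_T_eig[OF _ g, of f] f by simp
  also have "\<dots> = of_real (\<sigma>\<^sup>2) * cinner f g"
    using cinner_T_eig[OF _ f, of g] g by (simp add: cinner_cnj)
  finally have "(\<tau>\<^sup>2 = \<sigma>\<^sup>2) \<or> cinner f g = 0" by (simp only: mult_cancel_right of_real_eq_iff) blast
  then show ?thesis using assms(3-5) by (auto simp: power2_eq_iff)
qed

text \<open>A combination of singular vectors that is orthogonal, together with its image, to all polynomials
  of degree below \<open>d\<close> exists as soon as there are more than twice as many vectors as such monomials.\<close>

lemma sum_mult_bound:
  assumes X: "finite X" "\<And>\<sigma>. \<sigma> \<in> X \<Longrightarrow> s \<le> \<sigma>" and s: "s > 0" "C < s * (real d + 1)"
  shows "(\<Sum>\<sigma>\<in>X. singular_value_mult M T \<sigma>) \<le> 2 * d ^ CARD('n)"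
proof (rule ccontr)
  assume neg: "\<not> ?thesis"
  let ?A = "{m :: 'n \<Rightarrow>\<^sub>0 nat. mdeg m < d}" and ?e = "\<lambda>m. polb (zpow m) :: 'n bergman"
  have fin: "finite ?A" and cA: "card ?A \<le> d ^ CARD('n)" using card_mdeg_less by blast+
  have pos: "\<sigma> > 0" if "\<sigma> \<in> X" for \<sigma> using X(2)[OF that] s(1) by linarith
  have ex: "\<exists>B. B \<subseteq> eig \<sigma> \<and> bergman.independent B \<and> finite B \<and> card B = singular_value_mult M T \<sigma>" for \<sigma>
  proof -
    obtain B where B: "B \<subseteq> eig \<sigma>" "bergman.independent B" "eig \<sigma> \<subseteq> bergman.span B" "card B = bergman.dim (eig \<sigma>)"
      by (rule bergman.basis_exists)
    show ?thesis
    proof (cases "finite B")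
      case True
      then show ?thesis using B by (intro exI[of _ B]) (simp add: singular_value_mult_def)
    next
      \<comment> \<open>An infinite basis has \<open>card\<close> 0, so the dimension is 0 by
        default and the empty set matches it.\<close>
      case False
      then show ?thesis using B(4) by (intro exI[of _ "{}"]) (simp add: singular_value_mult_def bergman.independent_empty)
    qed
  qed
  have "\<forall>\<sigma>. \<exists>B. B \<subseteq> eig \<sigma> \<and> bergman.independent B \<and> finite B \<and> card B = singular_value_mult M T \<sigma>"
    by (rule allI, rule ex)
  from choice[OF this] obtain B where BB: "\<forall>\<sigma>. B \<sigma> \<subseteq> eig \<sigma> \<and> bergman.independent (B \<sigma>) \<and> finite (B \<sigma>) \<and>
      card (B \<sigma>) = singular_value_mult M T \<sigma>" by (elim exE)
  have B: "B \<sigma> \<subseteq> eig \<sigma>" "bergman.independent (B \<sigma>)" "finite (B \<sigma>)" "card (B \<sigma>) = singular_value_mult M T \<sigma>" for \<sigma>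
    using BB[rule_format, of \<sigma>] by simp_all
  define I where "I = Sigma X B"
  have fI: "finite I" using X(1) B(3) by (simp add: I_def)
  have "card I = (\<Sum>\<sigma>\<in>X. singular_value_mult M T \<sigma>)" using X(1) B(3,4) by (simp add: I_def)
  then have cI: "card (UNIV \<times> ?A :: (bool \<times> _) set) < card I" using neg cA by (simp add: card_cartesian_product)
  \<comment> \<open>Two equations for each low monomial: \<open>True\<close> asks that the image
    under \<open>T\<close> be orthogonal to it, \<open>False\<close> that the vector itself
    be.\<close>
  define a where "a = (\<lambda>(t, m) (\<sigma> :: real, b). if t then cinner (T b) (?e m) else cinner b (?e m))"
  obtain c where c: "\<exists>i\<in>I. c i \<noteq> 0" "\<forall>j\<in>UNIV \<times> ?A. (\<Sum>i\<in>I. c i * a j i) = 0"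
    using underdetermined_system[OF _ fI cI, of a] fin by auto
  define x where "x = (\<lambda>\<sigma>. \<Sum>b\<in>B \<sigma>. scaleC (c (\<sigma>, b)) b)"
  define y where "y = (\<Sum>\<sigma>\<in>X. x \<sigma>)"
  have sumeig: "(\<Sum>b\<in>D. scaleC (g b) b) \<in> eig \<sigma>" if "finite D" "D \<subseteq> eig \<sigma>" for D \<sigma> g
    using that
  proof (induction D rule: finite_induct)
    case empty
    then show ?case using eig_zero by simp
  next
    case (insert b D)
    then have "scaleC (g b) b + (\<Sum>b\<in>D. scaleC (g b) b) \<in> eig \<sigma>"
      by (intro eig_add eig_scale) auto
    then show ?case using insert.hyps by simp
  qed
  have x: "x \<sigma> \<in> eig \<sigma>" for \<sigma> unfolding x_def by (rule sumeig[OF B(3) B(1)])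
  then have xM: "x \<sigma> \<in> M" for \<sigma> by simp
  have Tsum: "T (\<Sum>b\<in>D. g b) = (\<Sum>b\<in>D. T (g b)) \<and> (\<Sum>b\<in>D. g b) \<in> M"
    if "finite D" "\<And>b. b \<in> D \<Longrightarrow> g b \<in> M" for D :: "'z set" and g
    using that
  proof (induction D rule: finite_induct)
    case empty
    show ?case using T_scale[OF MD(1), of 0] MD(1) by simp
  qed (auto simp: T_add MD(2))
  have Ty: "T y = (\<Sum>\<sigma>\<in>X. T (x \<sigma>))" and yM: "y \<in> M"
    unfolding y_def using Tsum[OF X(1) xM] by auto
  have BM: "b \<in> M" if "b \<in> B \<sigma>" for b \<sigma> using B(1)[of \<sigma>] that by auto
  have Tx: "T (x \<sigma>) = (\<Sum>b\<in>B \<sigma>. scaleC (c (\<sigma>, b)) (T b))" for \<sigma>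
  proof -
    have "T (x \<sigma>) = (\<Sum>b\<in>B \<sigma>. T (scaleC (c (\<sigma>, b)) b))"
      unfolding x_def using Tsum[OF B(3), of \<sigma> "\<lambda>b. scaleC (c (\<sigma>, b)) b"] MD(3)[OF BM] by auto
    also have "\<dots> = (\<Sum>b\<in>B \<sigma>. scaleC (c (\<sigma>, b)) (T b))"
      by (intro sum.cong refl T_scale[OF BM])
    finally show ?thesis .
  qed
  note suml = bounded_bilinear.sum_left[OF bounded_bilinear_cinner]
  note sumr = bounded_bilinear.sum_right[OF bounded_bilinear_cinner]
  have o1: "cinner y (?e m) = 0" and o2: "cinner (T y) (?e m) = 0" if "mdeg m < d" for m
  proof -
    have "cinner y (?e m) = (\<Sum>i\<in>I. c i * a (False, m) i)"
      unfolding y_def x_def suml cinner_simps(5) I_def using X(1) B(3) by (simp add: sum.Sigma a_def split_def)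
    then show "cinner y (?e m) = 0" using c(2) that by simp
    have "cinner (T y) (?e m) = (\<Sum>i\<in>I. c i * a (True, m) i)"
      unfolding Ty Tx suml cinner_simps(5) I_def using X(1) B(3) by (simp add: sum.Sigma a_def split_def)
    then show "cinner (T y) (?e m) = 0" using c(2) that by simp
  qed
  define q where "q = sqrt (real d + 1)"
  have q: "q > 0" "q * q = real d + 1" by (auto simp: q_def)
  have w1: "q * wnorm y \<le> norm y" unfolding q_def using yM M_polb o1 by (intro wnorm_le_of_orthogonal) auto
  have w2: "q * wnorm (T y) \<le> norm (T y)"
    unfolding q_def using T_closed[OF yM] M_polb o2 by (intro wnorm_le_of_orthogonal) auto
  \<comment> \<open>Each of \<open>y\<close> and \<open>T y\<close> gains a factor
    \<open>1 / q\<close>, and \<open>q * q = d + 1\<close>.\<close>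
  have "(real d + 1) * (norm (T y))\<^sup>2 \<le> C * (norm y * norm (T y))"
  proof -
    have "(norm (T y))\<^sup>2 = norm (cinner (T y) (T y))" unfolding cinner_norm by (simp add: norm_power)
    also have "\<dots> \<le> C * wnorm y * wnorm (T y)" by (intro bound yM T_closed)
    finally have "(real d + 1) * (norm (T y))\<^sup>2 \<le> (q * q) * (C * wnorm y * wnorm (T y))"
      unfolding q(2) by (intro mult_left_mono) auto
    also have "\<dots> = C * ((q * wnorm y) * (q * wnorm (T y)))" by (simp add: mult_ac)
    also have "\<dots> \<le> C * (norm y * norm (T y))" using w1 w2 q C by (intro mult_left_mono mult_mono) auto
    finally show ?thesis .
  qed
  then have "((real d + 1) * norm (T y)) * norm (T y) \<le> (C * norm y) * norm (T y)" by (simp add: power2_eq_square mult_ac)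
  then have up: "(real d + 1) * norm (T y) \<le> C * norm y"
    using C by (cases "norm (T y) = 0") (auto simp: mult_le_cancel_right)
  have orth: "cinner (x \<sigma>) (x \<tau>) = (if \<sigma> = \<tau> then of_real ((norm (x \<sigma>))\<^sup>2) else 0)" if "\<sigma> \<in> X" "\<tau> \<in> X" for \<sigma> \<tau>
    using eig_orthogonal[OF x x pos pos] that by (auto simp: cinner_norm)
  have ny: "(norm y)\<^sup>2 = (\<Sum>\<sigma>\<in>X. (norm (x \<sigma>))\<^sup>2)"
  proof -
    have "complex_of_real ((norm y)\<^sup>2) = (\<Sum>\<sigma>\<in>X. \<Sum>\<tau>\<in>X. cinner (x \<sigma>) (x \<tau>))"
      unfolding cinner_norm[symmetric] y_def suml sumr by (rule sum.swap)
    also have "\<dots> = (\<Sum>\<sigma>\<in>X. \<Sum>\<tau>\<in>X. if \<sigma> = \<tau> then of_real ((norm (x \<sigma>))\<^sup>2) else 0)"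
      by (intro sum.cong refl orth)
    also have "\<dots> = of_real (\<Sum>\<sigma>\<in>X. (norm (x \<sigma>))\<^sup>2)" using X(1) by simp
    finally show ?thesis by (simp only: of_real_eq_iff)
  qed
  have nTy: "(norm (T y))\<^sup>2 = (\<Sum>\<sigma>\<in>X. \<sigma>\<^sup>2 * (norm (x \<sigma>))\<^sup>2)"
  proof -
    have "complex_of_real ((norm (T y))\<^sup>2) = (\<Sum>\<sigma>\<in>X. \<Sum>\<tau>\<in>X. cinner (T (x \<sigma>)) (T (x \<tau>)))"
      unfolding cinner_norm[symmetric] Ty suml sumr by (rule sum.swap)
    also have "\<dots> = (\<Sum>\<sigma>\<in>X. \<Sum>\<tau>\<in>X. if \<sigma> = \<tau> then of_real (\<sigma>\<^sup>2 * (norm (x \<sigma>))\<^sup>2) else 0)"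
      by (intro sum.cong refl) (auto simp: cinner_T_eig[OF xM x] orth)
    also have "\<dots> = of_real (\<Sum>\<sigma>\<in>X. \<sigma>\<^sup>2 * (norm (x \<sigma>))\<^sup>2)" using X(1) by simp
    finally show ?thesis by (simp only: of_real_eq_iff)
  qed
  \<comment> \<open>The components of \<open>y\<close>, and their images, are orthogonal, so the
    least singular value gives the opposite estimate.\<close>
  have "(s * norm y)\<^sup>2 \<le> (norm (T y))\<^sup>2"
    unfolding nTy power_mult_distrib ny sum_distrib_left
    using X(2) s(1) by (intro sum_mono mult_right_mono power_mono) auto
  then have low: "s * norm y \<le> norm (T y)" by (rule power2_le_imp_le) simp
  have "norm y > 0"
  proof -
    obtain \<sigma> b where i: "\<sigma> \<in> X" "b \<in> B \<sigma>" "c (\<sigma>, b) \<noteq> 0" using c(1) by (auto simp: I_def)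
    have "x \<sigma> \<noteq> 0"
    proof
      assume "x \<sigma> = 0"
      then have "c (\<sigma>, b) = 0"
        using bergman.independentD[where u = "\<lambda>b. c (\<sigma>, b)", OF B(2)[of \<sigma>] B(3)[of \<sigma>] order_refl _ i(2)]
        unfolding x_def by blast
      then show False using i(3) by contradiction
    qed
    then have "0 < (norm (x \<sigma>))\<^sup>2" by simp
    also have "\<dots> \<le> (norm y)\<^sup>2" unfolding ny using X(1) i(1) by (intro member_le_sum) auto
    finally show ?thesis by (simp add: zero_less_power2)
  qed
  moreover have "(real d + 1) * (s * norm y) \<le> C * norm y"
    by (rule order_trans[OF mult_left_mono[OF low] up]) simp
  ultimately have "s * (real d + 1) \<le> C" by (simp add: mult_ac)
  then show False using s(2) by linarith
qed

text \<open>Layer \<open>k\<close> holds the singular values in the interval from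
  \<open>C' / 2 ^ Suc k\<close> to \<open>C' / 2 ^ k\<close>. By \<open>sum_mult_bound\<close> with
  \<open>d = 2 ^ Suc k\<close> it contributes at most a constant times
  \<open>2 powr (k * (n - q))\<close>, the term of a geometric series.\<close>

lemma schatten_T:
  assumes q: "q > real CARD('n)"
  shows "T \<in> schatten_class M q"
proof -
  let ?n = "CARD('n)" and ?\<mu> = "singular_value_mult M T"
  \<comment> \<open>Positive, and strictly above \<open>C\<close>, so that the strict inequality in
    \<open>sum_mult_bound\<close> holds in every layer even if \<open>C = 0\<close>.\<close>
  define C' where "C' = C + 1"
  have C': "C' > 0" "C < C'" using C by (auto simp: C'_def)
  define r where "r = 2 powr (real ?n - q)"
  have r: "0 \<le> r" "r < 1" using q powr_less_mono[of "real ?n - q" 0 2] by (auto simp: r_def)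
  define K where "K = 2 * 2 ^ ?n * C' powr q"
  have K: "K \<ge> 0" by (simp add: K_def)
  have layer: "(\<Sum>\<sigma>\<in>X. real (?\<mu> \<sigma>) * \<sigma> powr q) \<le> K * r ^ k"
    if X: "finite X" "\<And>\<sigma>. \<sigma> \<in> X \<Longrightarrow> C' / 2 ^ Suc k < \<sigma> \<and> \<sigma> \<le> C' / 2 ^ k" for X k
  proof -
    have p: "\<sigma> > 0" if "\<sigma> \<in> X" for \<sigma>
      using X(2)[OF that] C'(1) by (meson divide_pos_pos less_trans zero_less_numeral zero_less_power)
    have "(\<Sum>\<sigma>\<in>X. ?\<mu> \<sigma>) \<le> 2 * (2 ^ Suc k) ^ ?n"
    proof (rule sum_mult_bound[OF X(1), of "C' / 2 ^ Suc k"])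
      have "C' / 2 ^ Suc k * (real (2 ^ Suc k) + 1) = C' + C' / 2 ^ Suc k" by (simp add: field_simps)
      moreover have "0 < C' / 2 ^ Suc k" using C' by simp
      ultimately show "C < C' / 2 ^ Suc k * (real (2 ^ Suc k) + 1)" using C' by linarith
    qed (use X(2) C' in \<open>auto simp: less_imp_le\<close>)
    then have "real (\<Sum>\<sigma>\<in>X. ?\<mu> \<sigma>) \<le> real (2 * (2 ^ Suc k) ^ ?n)" by (simp only: of_nat_le_iff)
    then have cnt: "(\<Sum>\<sigma>\<in>X. real (?\<mu> \<sigma>)) \<le> 2 * (2 ^ Suc k) ^ ?n" by (simp add: power_mult_distrib)
    have "(\<Sum>\<sigma>\<in>X. real (?\<mu> \<sigma>) * \<sigma> powr q) \<le> (\<Sum>\<sigma>\<in>X. real (?\<mu> \<sigma>) * (C' / 2 ^ k) powr q)"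
    proof (intro sum_mono mult_left_mono)
      fix \<sigma> assume "\<sigma> \<in> X"
      then show "\<sigma> powr q \<le> (C' / 2 ^ k) powr q"
        using X(2)[of \<sigma>] p[of \<sigma>] q by (intro powr_mono2) auto
    qed simp
    also have "\<dots> = (\<Sum>\<sigma>\<in>X. real (?\<mu> \<sigma>)) * (C' / 2 ^ k) powr q" by (rule sum_distrib_right[symmetric])
    also have "\<dots> \<le> (2 * (2 ^ Suc k) ^ ?n) * (C' / 2 ^ k) powr q" by (intro mult_right_mono cnt) simp
    also have "\<dots> = K * r ^ k"
    proof -
      have "(C' / 2 ^ k) powr q = C' powr q / (2 powr real k) powr q"
        using C' by (subst powr_divide) (simp_all add: powr_realpow)
      then have "(C' / 2 ^ k) powr q = C' powr q * 2 powr (- (real k * q))"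
        by (simp add: powr_powr powr_minus_divide)
      moreover have "r ^ k = 2 powr (real k * real ?n) * 2 powr (- (real k * q))"
        unfolding r_def by (simp add: powr_power powr_add[symmetric] algebra_simps)
      moreover have "(2 ^ Suc k) ^ ?n = 2 ^ ?n * 2 powr (real k * real ?n)"
        using powr_realpow[of 2 "k * ?n"] by (simp add: power_mult_distrib power_mult)
      ultimately show ?thesis by (simp add: K_def)
    qed
    finally show ?thesis .
  qed
  \<comment> \<open>For \<open>d = 0\<close> there are no low monomials, and
    \<open>0 ^ n = 0\<close> since \<open>n > 0\<close>; hence no singular value exceeds
    \<open>C'\<close>.\<close>
  have zero: "?\<mu> \<sigma> = 0" if "\<sigma> > C'" for \<sigma>
  proof -
    have "(\<Sum>\<sigma>\<in>{\<sigma>}. ?\<mu> \<sigma>) \<le> 2 * 0 ^ ?n"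
      by (rule sum_mult_bound[of _ \<sigma>]) (use that C' in auto)
    then show ?thesis by (simp add: zero_power)
  qed
  have lim: "(\<lambda>s. real (?\<mu> s) * s powr q) summable_on {0<..}"
  proof (rule nonneg_bdd_above_summable_on)
    show "bdd_above (sum (\<lambda>s. real (?\<mu> s) * s powr q) ` {F. F \<subseteq> {0<..} \<and> finite F})"
    proof (rule bdd_aboveI2)
      fix F :: "real set" assume "F \<in> {F. F \<subseteq> {0<..} \<and> finite F}"
      then have F: "F \<subseteq> {0<..}" "finite F" by auto
      define X where "X = F \<inter> {..C'}"
      have fX: "finite X" using F by (simp add: X_def)
      have "\<exists>k. C' / 2 ^ Suc k < \<sigma> \<and> \<sigma> \<le> C' / 2 ^ k" if "\<sigma> \<in> X" for \<sigma>
      proof -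
        have \<sigma>: "\<sigma> > 0" "\<sigma> \<le> C'" using that F by (auto simp: X_def)
        obtain j where "(1 / 2) ^ j < \<sigma> / C'" using real_arch_pow_inv[of "\<sigma> / C'" "1 / 2"] \<sigma> C' by auto
        then have ex: "C' / 2 ^ j < \<sigma>" using C' by (simp add: field_simps power_divide)
        \<comment> \<open>The least exponent that brings \<open>C' / 2 ^ j\<close> below
          \<open>\<sigma>\<close> is positive because \<open>\<sigma> \<le> C'\<close>; its
          predecessor is the layer of \<open>\<sigma>\<close>.\<close>
        define k where "k = (LEAST j. C' / 2 ^ j < \<sigma>)"
        have k: "C' / 2 ^ k < \<sigma>" unfolding k_def using ex by (rule LeastI[of "\<lambda>j. C' / 2 ^ j < \<sigma>"])
        then obtain l where l: "k = Suc l" using \<sigma>(2) by (cases k) auto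
        have "\<not> C' / 2 ^ l < \<sigma>" using not_less_Least[of l "\<lambda>j. C' / 2 ^ j < \<sigma>"] l k_def by simp
        then show ?thesis using k l by (intro exI[of _ l]) auto
      qed
      then obtain \<kappa> where \<kappa>: "\<And>\<sigma>. \<sigma> \<in> X \<Longrightarrow> C' / 2 ^ Suc (\<kappa> \<sigma>) < \<sigma> \<and> \<sigma> \<le> C' / 2 ^ \<kappa> \<sigma>" by metis
      have "sum (\<lambda>s. real (?\<mu> s) * s powr q) F = sum (\<lambda>s. real (?\<mu> s) * s powr q) X"
        unfolding X_def using F(2) zero by (intro sum.mono_neutral_right) (auto simp: not_le[symmetric])
      also have "\<dots> = (\<Sum>k\<in>\<kappa> ` X. \<Sum>\<sigma> | \<sigma> \<in> X \<and> \<kappa> \<sigma> = k. real (?\<mu> \<sigma>) * \<sigma> powr q)"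
        by (rule sum.image_gen[OF fX])
      also have "\<dots> \<le> (\<Sum>k\<in>\<kappa> ` X. K * r ^ k)"
        using fX \<kappa> by (intro sum_mono layer) auto
      also have "\<dots> \<le> suminf (\<lambda>k. K * r ^ k)"
        using r K fX by (intro sum_le_suminf summable_mult summable_geometric) auto
      finally show "sum (\<lambda>s. real (?\<mu> s) * s powr q) F \<le> suminf (\<lambda>k. K * r ^ k)" .
    qed
  qed simp
  then show ?thesis
    unfolding schatten_class_def compact_operator_on_def using T compact_T by simp
qed

end

theorem theorem2p5:
  fixes p :: "'n::finite cpoly" and q :: real
  assumes "q > real CARD('n)"
  shows "essentially_normal q (principal_submodule p)"
proof -
  let ?M = "principal_submodule p"
  obtain C where C: "C \<ge> 0" "\<forall>F\<in>?M. \<forall>G\<in>?M. \<forall>i j.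
    norm (cinner (adj_commutator ?M (coord_mult i) (coord_mult j) F) G) \<le> C * wnorm F * wnorm G"
    using commutator_bound[of p] by (elim exE conjE)
  have "adj_commutator ?M (coord_mult i) (coord_mult j) \<in> schatten_class ?M q" for i j
  proof (rule wnorm_bounded_operator.schatten_T[OF _ assms])
    show "wnorm_bounded_operator ?M (adj_commutator ?M (coord_mult i) (coord_mult j)) C"
    proof
      show "?M \<subseteq> closure (polb ` {u. bip 0 u})"
        unfolding principal_submodule_eq using bip_cpoly_mult by (intro closure_mono) blast
    qed (use C hilbert_subspace_principal_submodule bounded_operator_adj_commutator in auto)
  qed
  then show ?thesis unfolding essentially_normal_def by blast
qed

end
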